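(* Let $P_d$ be any probability distribution on $\mathbb{Z}_+=\{0,1,2,\dots\}$, let $\delta\in[0,1]$, and let $\mu_s\ne\delta_0$ be any non-trivial symmetric probability distribution on $(-\infty,+\infty]$. Let $\mathcal{Q}_s$ be the associated BP operator. Then boundary irrelevance holds: $\mathcal{Q}_s^hB_0$ and $\mathcal{Q}_s^hB_{1/2}$ both converge weakly, as $h\to\infty$, to the same distribution on $(-\infty,+\infty]$, where $B_0$ is the unit mass at $+\infty$ and $B_{1/2}=\delta_0$ is the unit mass at $0$.
   Context: A probability distribution $\mu$ on $(-\infty,+\infty]$ is called symmetric if $\mu[E]=\int e^{-r}\mathbf{1}\{-r\in E\}\,d\mu(r)$ for every measurable $E\subseteq(-\infty,+\infty)$ (an atom at $+\infty$ is allowed). The trivial distribution is $\delta_0$, the unit mass at $0$. Weak convergence is that of probability measures on $(-\infty,+\infty]$ (test functions: bounded functions continuous on $(-\infty,+\infty]$). BP operator: for symmetric $\mu$, $\mathcal{Q}_s\mu$ is the law of $$R=\sum_{u=1}^d Z_uF_\delta(\tilde R_u)+S,\qquad F_\delta(x)=\ln\frac{(1-\delta)e^x+\delta}{\delta e^x+1-\delta},$$ where $d\sim P_d$, $\tilde R_u\sim\mu$ i.i.d., $Z_u$ i.i.d. with $\mathbb{P}[Z_u=-1]=\delta$, $\mathbb{P}[Z_u=1]=1-\delta$, $S\sim\mu_s$, all jointly independent, with $F_\delta(+\infty)$ defined by continuity. *)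

theory Defs
  imports "HOL-Probability.Probability" "HOL-Real_Asymp.Real_Asymp"
begin

text \<open>
  A probability distribution on \<open>(-\<infinity>, \<infinity>]\<close> is represented by a Borel probability
  measure on \<open>ereal\<close> that gives no mass to \<open>-\<infinity>\<close>.
\<close>

definition llr_distribution :: "ereal measure \<Rightarrow> bool" where
  "llr_distribution \<mu> \<longleftrightarrow>
     prob_space \<mu> \<and> sets \<mu> = sets borel \<and> emeasure \<mu> {-\<infinity>} = 0"

text \<open>
  The point \<open>r = \<infinity>\<close> does not contribute to the integral below, since \<open>-\<infinity> \<notin> E\<close>; hence
  the value of \<open>real_of_ereal\<close> there is irrelevant.
\<close>

definition symmetric_distribution :: "ereal measure \<Rightarrow> bool" where
  "symmetric_distribution \<mu> \<longleftrightarrow> llr_distribution \<mu> \<and>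
     (\<forall>E\<in>sets borel. E \<subseteq> {-\<infinity><..<\<infinity>} \<longrightarrow>
        emeasure \<mu> E =
          (\<integral>\<^sup>+ r. ennreal (exp (- real_of_ereal r)) * indicator E (- r) \<partial>\<mu>))"

text \<open>
  The values at \<open>\<infinity>\<close> are the limits of the formula for finite arguments (proved below).
  The value at \<open>-\<infinity>\<close>, given by oddness, only makes the function total.
\<close>

function F_BSC :: "real \<Rightarrow> ereal \<Rightarrow> ereal" where
  "F_BSC \<delta> (ereal x) = ereal (ln (((1 - \<delta>) * exp x + \<delta>) / (\<delta> * exp x + 1 - \<delta>)))"
| "F_BSC \<delta> \<infinity> =
     (if \<delta> = 0 then \<infinity> else if \<delta> = 1 then -\<infinity> else ereal (ln ((1 - \<delta>) / \<delta>)))"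
| "F_BSC \<delta> (-\<infinity>) =
     (if \<delta> = 0 then -\<infinity> else if \<delta> = 1 then \<infinity> else ereal (- ln ((1 - \<delta>) / \<delta>)))"
proof goal_cases
  case (1 P x)
  then show P by (cases "snd x"; cases x) auto
qed simp_all
termination by lexicographic_order

lemma F_BSC_tendsto_PInf:
  assumes "0 \<le> \<delta>" "\<delta> \<le> 1"
  shows "((\<lambda>x. F_BSC \<delta> (ereal x)) \<longlongrightarrow> F_BSC \<delta> \<infinity>) at_top"
proof -
  consider "\<delta> = 0" | "\<delta> = 1" | "0 < \<delta>" "\<delta> < 1"
    using assms by linarith
  then show ?thesis
  proof cases
    case 1
    have "((\<lambda>x::real. ereal x) \<longlongrightarrow> \<infinity>) at_top"
      by (simp add: tendsto_PInfty eventually_gt_at_top)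
    then show ?thesis using 1 by simp
  next
    case 2
    have "((\<lambda>x::real. ereal (- x)) \<longlongrightarrow> -\<infinity>) at_top"
      by (auto simp: tendsto_MInfty minus_less_iff intro: eventually_gt_at_top)
    then show ?thesis using 2 by (simp add: ln_div)
  next
    case 3
    have "((\<lambda>x::real. ((1 - \<delta>) * exp x + \<delta>) / (\<delta> * exp x + 1 - \<delta>))
            \<longlongrightarrow> (1 - \<delta>) * inverse \<delta>) at_top"
      using 3 by real_asymp
    then have "((\<lambda>x::real. ((1 - \<delta>) * exp x + \<delta>) / (\<delta> * exp x + 1 - \<delta>))
            \<longlongrightarrow> (1 - \<delta>) / \<delta>) at_top"
      by (simp only: divide_inverse)
    then have "((\<lambda>x::real. ln (((1 - \<delta>) * exp x + \<delta>) / (\<delta> * exp x + 1 - \<delta>)))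
            \<longlongrightarrow> ln ((1 - \<delta>) / \<delta>)) at_top"
      using 3 by (intro tendsto_ln) auto
    then show ?thesis using 3 by simp
  qed
qed

definition sign_pmf :: "real \<Rightarrow> ereal pmf" where
  "sign_pmf \<delta> = map_pmf (\<lambda>b. if b then -1 else 1) (bernoulli_pmf \<delta>)"

text \<open>
  The joint law of \<open>(d, R, Z, S)\<close> with independent components, where \<open>R\<close> and \<open>Z\<close> are
  i.i.d. sequences.  Only the first \<open>d\<close> terms of these sequences enter the sum.
  For symmetric \<open>\<mu>\<close> no summand is \<open>-\<infinity>\<close> almost surely, so the convention
  \<open>\<infinity> + (-\<infinity>) = \<infinity>\<close> on \<open>ereal\<close> plays no role.
\<close>

definition BP_space ::
  "nat pmf \<Rightarrow> real \<Rightarrow> ereal measure \<Rightarrow> ereal measure \<Rightarrow>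
     (nat \<times> (nat \<Rightarrow> ereal) \<times> (nat \<Rightarrow> ereal) \<times> ereal) measure" where
  "BP_space P \<delta> \<mu>\<^sub>s \<mu> =
     measure_pmf P \<Otimes>\<^sub>M (\<Pi>\<^sub>M u\<in>UNIV. \<mu>) \<Otimes>\<^sub>M (\<Pi>\<^sub>M u\<in>UNIV. measure_pmf (sign_pmf \<delta>)) \<Otimes>\<^sub>M \<mu>\<^sub>s"

definition BP_operator ::
  "nat pmf \<Rightarrow> real \<Rightarrow> ereal measure \<Rightarrow> ereal measure \<Rightarrow> ereal measure" where
  "BP_operator P \<delta> \<mu>\<^sub>s \<mu> =
     distr (BP_space P \<delta> \<mu>\<^sub>s \<mu>) borel
       (\<lambda>(d, R, Z, S). (\<Sum>u=1..d. Z u * F_BSC \<delta> (R u)) + S)"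

definition weak_conv_llr :: "(nat \<Rightarrow> ereal measure) \<Rightarrow> ereal measure \<Rightarrow> bool" where
  "weak_conv_llr M \<nu> \<longleftrightarrow>
     (\<forall>f :: ereal \<Rightarrow> real.
        continuous_on {-\<infinity><..} f \<and> bounded (f ` {-\<infinity><..}) \<longrightarrow>
        (\<lambda>n. LINT x:{-\<infinity><..}|M n. f x) \<longlonglongrightarrow> (LINT x:{-\<infinity><..}|\<nu>. f x))"

lemma borel_measurable_F_BSC [measurable]: "F_BSC \<delta> \<in> borel_measurable borel"
proof -
  have "F_BSC \<delta> = (\<lambda>x. if x = \<infinity> then F_BSC \<delta> \<infinity> else if x = -\<infinity> then F_BSC \<delta> (-\<infinity>)
      else ereal (ln (((1 - \<delta>) * exp (real_of_ereal x) + \<delta>) / (\<delta> * exp (real_of_ereal x) + 1 - \<delta>))))"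
  proof
    fix x show "F_BSC \<delta> x = (if x = \<infinity> then F_BSC \<delta> \<infinity> else if x = -\<infinity> then F_BSC \<delta> (-\<infinity>)
      else ereal (ln (((1 - \<delta>) * exp (real_of_ereal x) + \<delta>) / (\<delta> * exp (real_of_ereal x) + 1 - \<delta>))))"
      by (cases x) simp_all
  qed
  also have "\<dots> \<in> borel_measurable borel" by measurable
  finally show ?thesis .
qed

lemma measurable_BP_sum:
  assumes [measurable_cong]: "sets \<mu>\<^sub>s = sets borel" "sets \<mu> = sets borel"
  shows "(\<lambda>(d, R, Z, S). (\<Sum>u=1..d. Z u * F_BSC \<delta> (R u)) + S)
           \<in> borel_measurable (BP_space P \<delta> \<mu>\<^sub>s \<mu>)"
proof -
  let ?Z = "measure_pmf (sign_pmf \<delta>)"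
  have Z [measurable]: "(\<lambda>z. z) \<in> borel_measurable ?Z" by simp
  have *: "(\<lambda>w. fst (snd (snd w)) u) \<in> borel_measurable (BP_space P \<delta> \<mu>\<^sub>s \<mu>)" for u
  proof -
    have "(\<lambda>w. fst (snd (snd w)) u) \<in> measurable (BP_space P \<delta> \<mu>\<^sub>s \<mu>) ?Z"
      unfolding BP_space_def by measurable
    then show ?thesis by (rule measurable_compose[OF _ Z])
  qed
  have **: "(\<lambda>w. fst (snd w) u) \<in> borel_measurable (BP_space P \<delta> \<mu>\<^sub>s \<mu>)" for u
    unfolding BP_space_def by measurable
  have ***: "fst \<in> measurable (BP_space P \<delta> \<mu>\<^sub>s \<mu>) (count_space UNIV)"
       "(\<lambda>w. snd (snd (snd w))) \<in> borel_measurable (BP_space P \<delta> \<mu>\<^sub>s \<mu>)"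
    unfolding BP_space_def by measurable
  note [measurable] = * ** ***
  have "(\<lambda>w. (\<Sum>u=1..d. fst (snd (snd w)) u * F_BSC \<delta> (fst (snd w) u)) + snd (snd (snd w)))
           \<in> borel_measurable (BP_space P \<delta> \<mu>\<^sub>s \<mu>)" for d
    by measurable
  from measurable_compose_countable[OF this ***(1)]
  show ?thesis by (simp add: case_prod_beta)
qed

lemma F_BSC_neq_MInf:
  assumes "0 \<le> \<delta>" "\<delta> \<le> 1" "z \<in> set_pmf (sign_pmf \<delta>)" "x \<noteq> -\<infinity>"
  shows "z * F_BSC \<delta> x \<noteq> -\<infinity>"
proof -
  have "z = 1 \<and> \<delta> < 1 \<or> z = -1 \<and> \<delta> > 0"
    using assms(1-3) by (auto simp: sign_pmf_def set_pmf_iff split: if_splits)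
  then show ?thesis
  proof (elim disjE conjE)
    assume "z = 1" "\<delta> < 1"
    then show ?thesis using assms(4) by (cases x) auto
  next
    assume "z = -1" "\<delta> > 0"
    moreover have "F_BSC \<delta> x \<noteq> \<infinity>"
      using \<open>\<delta> > 0\<close> assms(4) by (cases x) auto
    ultimately show ?thesis by (cases "F_BSC \<delta> x") auto
  qed
qed

lemma llr_distribution_BP_operator:
  assumes "0 \<le> \<delta>" "\<delta> \<le> 1" "llr_distribution \<mu>\<^sub>s" "llr_distribution \<mu>"
  shows "llr_distribution (BP_operator P \<delta> \<mu>\<^sub>s \<mu>)"
proof -
  interpret s: prob_space \<mu>\<^sub>s using assms by (simp add: llr_distribution_def)
  interpret m: prob_space \<mu> using assms by (simp add: llr_distribution_def)
  interpret PR: product_prob_space "\<lambda>_::nat. \<mu>" UNIV by unfold_locales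
  interpret PZ: product_prob_space "\<lambda>_::nat. measure_pmf (sign_pmf \<delta>)" UNIV
    by (intro product_prob_spaceI measure_pmf.prob_space_axioms)
  let ?R = "\<Pi>\<^sub>M u\<in>(UNIV::nat set). \<mu>"
  let ?Z = "\<Pi>\<^sub>M u\<in>(UNIV::nat set). measure_pmf (sign_pmf \<delta>)"
  let ?f = "\<lambda>(d, R, Z, S). (\<Sum>u=1..d. Z u * F_BSC \<delta> (R u)) + S"
  have sets: "sets \<mu>\<^sub>s = sets borel" "sets \<mu> = sets borel"
    using assms by (auto simp: llr_distribution_def)
  note probs = measure_pmf.prob_space_axioms[of P] PR.prob_space_axioms PZ.prob_space_axioms
    s.prob_space_axioms
  have ps: "prob_space (?Z \<Otimes>\<^sub>M \<mu>\<^sub>s)" "prob_space (?R \<Otimes>\<^sub>M ?Z \<Otimes>\<^sub>M \<mu>\<^sub>s)"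
    "prob_space (BP_space P \<delta> \<mu>\<^sub>s \<mu>)"
    unfolding BP_space_def
    by (rule prob_space_pair[OF probs(3,4)],
        rule prob_space_pair[OF probs(2) prob_space_pair[OF probs(3,4)]],
        rule prob_space_pair[OF probs(1) prob_space_pair[OF probs(2) prob_space_pair[OF probs(3,4)]]])
  have meas: "?f \<in> borel_measurable (BP_space P \<delta> \<mu>\<^sub>s \<mu>)"
    by (rule measurable_BP_sum[OF sets])
  have AE_fst: "AE w in M \<Otimes>\<^sub>M N. Q (fst w)"
    if "prob_space N" "AE x in M. Q x"
    for M :: "'x measure" and N :: "'y measure" and Q
    using that(2) prob_space.distr_pair_fst[OF that(1), of M] AE_distrD[OF measurable_fst, where P = Q]
    by metis
  have AE_snd: "AE w in M \<Otimes>\<^sub>M N. Q (snd w)"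
    if "prob_space M" "prob_space N" "AE x in N. Q x"
    for M :: "'x measure" and N :: "'y measure" and Q
  proof -
    interpret M: prob_space M by fact
    interpret N: prob_space N by fact
    interpret pair_prob_space M N ..
    from that(3) obtain A
      where A: "{x \<in> space N. \<not> Q x} \<subseteq> A" "emeasure N A = 0" "A \<in> sets N"
      by (rule AE_E)
    show ?thesis
    proof (rule AE_I)
      show "{w \<in> space (M \<Otimes>\<^sub>M N). \<not> Q (snd w)} \<subseteq> space M \<times> A"
        using A(1) by (auto simp: space_pair_measure)
      show "emeasure (M \<Otimes>\<^sub>M N) (space M \<times> A) = 0"
        using A by (simp add: N.emeasure_pair_measure_Times)
      show "space M \<times> A \<in> sets (M \<Otimes>\<^sub>M N)"
        using A by simp
    qed
  qed
  have "AE x in \<mu>. x \<noteq> -\<infinity>" "AE x in \<mu>\<^sub>s. x \<noteq> -\<infinity>"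
    using assms sets by (auto simp: llr_distribution_def intro!: AE_I[where N = "{-\<infinity>}"])
  moreover have "AE z in measure_pmf (sign_pmf \<delta>). z \<in> set_pmf (sign_pmf \<delta>)"
    by (simp add: AE_measure_pmf)
  ultimately have
    1: "AE R in ?R. \<forall>u. R u \<noteq> -\<infinity>" and
    2: "AE Z in ?Z. \<forall>u. Z u \<in> set_pmf (sign_pmf \<delta>)" and
    3: "AE S in \<mu>\<^sub>s. S \<noteq> -\<infinity>"
    by (auto simp only: AE_all_countable intro!: PR.AE_component PZ.AE_component)
  have "AE w in BP_space P \<delta> \<mu>\<^sub>s \<mu>. \<forall>u. fst (snd w) u \<noteq> -\<infinity>"
    unfolding BP_space_def by (rule AE_snd[OF probs(1) ps(2) AE_fst[OF ps(1) 1]])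
  moreover have "AE w in BP_space P \<delta> \<mu>\<^sub>s \<mu>. \<forall>u. fst (snd (snd w)) u \<in> set_pmf (sign_pmf \<delta>)"
    unfolding BP_space_def
    by (rule AE_snd[OF probs(1) ps(2) AE_snd[OF probs(2) ps(1) AE_fst[OF probs(4) 2]]])
  moreover have "AE w in BP_space P \<delta> \<mu>\<^sub>s \<mu>. snd (snd (snd w)) \<noteq> -\<infinity>"
    unfolding BP_space_def
    by (rule AE_snd[OF probs(1) ps(2) AE_snd[OF probs(2) ps(1) AE_snd[OF probs(3,4) 3]]])
  ultimately have "AE w in BP_space P \<delta> \<mu>\<^sub>s \<mu>. ?f w \<noteq> -\<infinity>"
  proof eventually_elim
    case (elim w)
    have "(\<Sum>u=1..d. fst (snd (snd w)) u * F_BSC \<delta> (fst (snd w) u)) \<noteq> -\<infinity>" for d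
    proof (induction d)
      case (Suc d)
      then show ?case
        using F_BSC_neq_MInf[OF assms(1,2), of "fst (snd (snd w)) (Suc d)" "fst (snd w) (Suc d)"]
          elim by simp
    qed simp
    then show ?case using elim by (simp add: case_prod_beta)
  qed
  then have "AE x in BP_operator P \<delta> \<mu>\<^sub>s \<mu>. x \<noteq> -\<infinity>"
    unfolding BP_operator_def by (subst AE_distr_iff[OF meas]) auto
  then have "emeasure (BP_operator P \<delta> \<mu>\<^sub>s \<mu>) {-\<infinity>} = 0"
    by (subst (asm) AE_iff_measurable[where N = "{-\<infinity>}"]) (auto simp: BP_operator_def)
  moreover have "prob_space (BP_operator P \<delta> \<mu>\<^sub>s \<mu>)"
    unfolding BP_operator_def by (rule prob_space.prob_space_distr[OF ps(3) meas])
  ultimately show ?thesis by (simp add: llr_distribution_def BP_operator_def)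
qed

end

theory Submission
  imports Defs
begin

text \<open>
  Write \<open>m = tanh (r / 2)\<close> for the posterior bias belonging to a log-likelihood ratio \<open>r\<close>, and order
  symmetric laws by the means of \<open>m\<^sup>2 / (1 - t\<^sup>2 m\<^sup>2)\<close> for all \<open>\<bar>t\<bar> < 1\<close>.  Up to an affine change these are
  the mean squared biases after one more independent observation with bias \<open>\<plusminus> t\<close>, so this family of
  test functions is stable under convolution, and scaling \<open>m\<close> by \<open>s\<close> only changes \<open>t\<close> to \<open>s t\<close>;
  hence the BP operator \<open>Q\<close> is monotone.

  Let \<open>\<mu>\<^sub>h\<close> and \<open>\<nu>\<^sub>h\<close> be the iterates started from perfect and from no boundary information.  Suppose
  that \<open>\<nu>\<^sub>h\<close> dominates \<open>\<mu>\<^sub>h\<close> observed through a binary symmetric channel scaling \<open>m\<close> by \<open>s < 1\<close>.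
  Independent noise on the edges is better than common noise at the root, so after a step of \<open>Q\<close> the
  same holds with \<open>s\<close>, and since the survey at the root is not degraded at all, even with some
  \<open>s' > s\<close> that depends only on \<open>s\<close> and the mean squared bias of the survey.  Iterating, \<open>s\<close> tends to 1, so
  the two monotone sequences of means have the same limits.  Expanding in \<open>t\<close>, all even moments of
  \<open>m\<close> converge, and for symmetric laws this gives weak convergence.
\<close>

section \<open>Rational test functions\<close>

text \<open>An inequality between mean squared biases alone does not survive convolution, so a whole
  family of tests is needed. Combining bias a with an independent observation of bias +-t gives the
  mean squared bias t^2 + (1 - t^2)^2 * \<open>chi t a\<close>; this is the origin of
  \<open>chi\<close>. Taking all |t| < 1 closes the family, because a further observation b merges
  with the test observation t into one of bias (t +- b) / (1 +- t b). At |t| = 1 the function would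
  be unbounded near a = +-1.

  The full degradation order, which tests all even convex functions of m, is too strong for the
  improvement of s. Take perfect information observed through scale s, and a survey of bias +-b with
  b <= s: combining them leaves the mean of |m| equal to s, so no s' > s could work. The functions
  \<open>chi t\<close> have second derivative at least 2 in m for every t, and therefore register a
  gain that is bounded below uniformly in t.\<close>

definition chi :: "real \<Rightarrow> real \<Rightarrow> real" where
  "chi t a = a\<^sup>2 / (1 - t\<^sup>2 * a\<^sup>2)"

text \<open>The mean of \<open>chi t (s * m)\<close>, where \<open>m\<close> is the bias after combining independent observations with
  biases \<open>\<plusminus> a\<close> and \<open>\<plusminus> b\<close>.  Where a denominator vanishes, so does the weight in front of it.\<close>

definition chi2 :: "real \<Rightarrow> real \<Rightarrow> real \<Rightarrow> real \<Rightarrow> real" where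
  "chi2 s t a b = ((1 + a * b) * chi t (s * ((a + b) / (1 + a * b)))
                 + (1 - a * b) * chi t (s * ((a - b) / (1 - a * b)))) / 2"

lemma mult_sq_less_1:
  fixes t a :: real
  assumes "\<bar>t\<bar> < 1" "\<bar>a\<bar> \<le> 1"
  shows "t\<^sup>2 * a\<^sup>2 < 1"
proof -
  have "\<bar>t\<bar> * \<bar>a\<bar> < 1" using assms by (smt (verit) mult_left_le abs_ge_zero)
  then have "\<bar>t * a\<bar> < 1" by (simp add: abs_mult)
  then show ?thesis by (metis abs_square_less_1 power_mult_distrib)
qed

lemma mult_abs_less_1:
  fixes t a :: real
  assumes "\<bar>t\<bar> < 1" "\<bar>a\<bar> \<le> 1"
  shows "\<bar>t * a\<bar> < 1"
  using mult_sq_less_1[OF assms] by (metis abs_square_less_1 power_mult_distrib)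

lemma chi_minus [simp]: "chi t (- a) = chi t a"
  by (simp add: chi_def)

lemma chi_zero [simp]: "chi t 0 = 0"
  by (simp add: chi_def)

lemma chi_scale: "chi t (s * a) = s\<^sup>2 * chi (s * t) a"
  by (simp add: chi_def power_mult_distrib mult_ac)

lemma chi_nonneg: "\<bar>t\<bar> < 1 \<Longrightarrow> \<bar>a\<bar> \<le> 1 \<Longrightarrow> 0 \<le> chi t a"
  using mult_sq_less_1[of t a] by (simp add: chi_def)

lemma chi_le:
  assumes "\<bar>t\<bar> < 1" "\<bar>a\<bar> \<le> 1"
  shows "chi t a \<le> 1 / (1 - t\<^sup>2)"
proof -
  have "a\<^sup>2 \<le> 1" "t\<^sup>2 < 1"
    using assms by (auto simp: abs_square_le_1 abs_square_less_1)
  moreover then have "t\<^sup>2 * a\<^sup>2 \<le> t\<^sup>2" by (simp add: mult_left_le)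
  ultimately show ?thesis unfolding chi_def by (intro frac_le) auto
qed

text \<open>Clearing the inner quotient turns the denominator into a difference of squares, which
  the later identities factor. If 1 + a b = 0, both sides carry this factor and vanish.\<close>

lemma chi2_term:
  assumes "\<bar>a\<bar> \<le> 1" "\<bar>b\<bar> \<le> 1"
  shows "(1 + a * b) * chi t (s * ((a + b) / (1 + a * b))) =
    s\<^sup>2 * (a + b)\<^sup>2 * (1 + a * b) / ((1 + a * b)\<^sup>2 - t\<^sup>2 * (s\<^sup>2 * (a + b)\<^sup>2))"
proof (cases "1 + a * b = 0")
  case False
  define d where "d = 1 + a * b"
  have "d * (v\<^sup>2 / d\<^sup>2 / (1 - t\<^sup>2 * (v\<^sup>2 / d\<^sup>2))) = v\<^sup>2 * d / (d\<^sup>2 - t\<^sup>2 * v\<^sup>2)" for v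
  proof -
    have "1 - t\<^sup>2 * (v\<^sup>2 / d\<^sup>2) = (d\<^sup>2 - t\<^sup>2 * v\<^sup>2) / d\<^sup>2"
      using False by (simp add: d_def field_simps)
    then show ?thesis using False by (simp add: d_def power2_eq_square)
  qed
  from this[of "s * (a + b)"] show ?thesis
    by (simp add: chi_def d_def power_mult_distrib power_divide)
qed simp

lemma chi2_swap: "chi2 s t a b = chi2 s t b a"
proof -
  have "(a - b) / (1 - a * b) = - ((b - a) / (1 - b * a))"
    by (simp add: mult.commute minus_divide_left)
  then show ?thesis
    unfolding chi2_def by (simp only: mult_minus_right chi_minus add.commute mult.commute)
qed

lemma chi2_minus: "chi2 s t a (- b) = chi2 s t a b"
  by (simp add: chi2_def add.commute)

lemma chi2_minus_left: "chi2 s t (- a) b = chi2 s t a b"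
  by (metis chi2_minus chi2_swap)

text \<open>The observations t and b merge into one of bias u = (t +- b) / (1 +- t b), with
  probability (1 +- t b) / 2. Since 1 - u^2 = (1 - t^2)(1 - b^2) / (1 +- t b)^2, rewriting t^2 + (1
  - t^2)^2 * \<open>chi t\<close> for the merged parameter leaves the inverse cubes. All
  coefficients are nonnegative, which is why the order survives convolution.\<close>

lemma chi2_expand:
  assumes "\<bar>a\<bar> \<le> 1" "\<bar>b\<bar> \<le> 1" "\<bar>t\<bar> < 1"
  shows "chi2 1 t a b = chi t b + (1 - b\<^sup>2)\<^sup>2 / 2 *
     (chi ((t + b) / (1 + t * b)) a / (1 + t * b) ^ 3 +
      chi ((t - b) / (1 - t * b)) a / (1 - t * b) ^ 3)"
proof (cases "\<bar>b\<bar> = 1")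
  \<comment> \<open>A perfect observation makes every combined bias +-1. On the right the factor (1
    - b^2)^2 removes the tilted terms, whose parameters have modulus 1.\<close>
  case True
  have one: "chi t (u / v) = 1 / (1 - t\<^sup>2)" if "v \<noteq> 0" "u\<^sup>2 = v\<^sup>2" for u v :: real
    using that by (simp add: chi_def power_divide)
  have b2: "b\<^sup>2 = 1" using True by (metis power2_abs power_one)
  have "(1 + a * b) * chi t ((a + b) / (1 + a * b)) = (1 + a * b) * (1 / (1 - t\<^sup>2))"
  proof (cases "1 + a * b = 0")
    case False
    have "(a + b)\<^sup>2 = (1 + a * b)\<^sup>2" using b2 by algebra
    then show ?thesis using one[OF False] by simp
  qed simp
  moreover have "(1 - a * b) * chi t ((a - b) / (1 - a * b)) = (1 - a * b) * (1 / (1 - t\<^sup>2))"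
  proof (cases "1 - a * b = 0")
    case False
    have "(a - b)\<^sup>2 = (1 - a * b)\<^sup>2" using b2 by algebra
    then show ?thesis using one[OF False] by simp
  qed simp
  moreover have "((1 + p) * q + (1 - p) * q) / 2 = q" for p q :: real
    by (simp add: algebra_simps)
  ultimately have "chi2 1 t a b = 1 / (1 - t\<^sup>2)"
    by (simp only: chi2_def mult_1)
  then show ?thesis using b2 by (simp add: chi_def)
next
  case False
  then have b: "\<bar>b\<bar> < 1" using assms by linarith
  have tb: "1 + t * b > 0" "1 - t * b > 0"
    using mult_abs_less_1[of t b] assms by auto
  \<comment> \<open>Up to normalization these are the probabilities of the four sign patterns of the
    observations a, b, t modulo a global flip. Every denominator on either side is a product of such
    factors with powers of 1 + t b and 1 - t b.\<close>
  define p1 p2 p3 p4 where p: "p1 = 1 + t*b + t*a + a*b" "p2 = 1 + t*b - t*a - a*b"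
    "p3 = 1 - t*b + t*a - a*b" "p4 = 1 - t*b - t*a + a*b"
  have tpb: "\<bar>t + b\<bar> < 1 + t * b" "\<bar>t - b\<bar> < 1 - t * b"
  proof -
    have "(1 - t) * (1 - b) > 0" "(1 + t) * (1 + b) > 0" "(1 - t) * (1 + b) > 0" "(1 + t) * (1 - b) > 0"
      using b assms by auto
    then show "\<bar>t + b\<bar> < 1 + t * b" "\<bar>t - b\<bar> < 1 - t * b"
      by (auto simp: algebra_simps abs_less_iff)
  qed
  have "\<bar>(t + b) * a\<bar> < 1 + t * b" "\<bar>(t - b) * a\<bar> < 1 - t * b"
    using tpb assms(1) mult_left_le[of "\<bar>a\<bar>" "\<bar>t + b\<bar>"] mult_left_le[of "\<bar>a\<bar>" "\<bar>t - b\<bar>"]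
    by (auto simp: abs_mult)
  then have pos: "p1 > 0" "p2 > 0" "p3 > 0" "p4 > 0"
    unfolding p by (auto simp: abs_less_iff algebra_simps)
  have e1: "(1 + a * b)\<^sup>2 - t\<^sup>2 * (a + b)\<^sup>2 = p1 * p4"
    unfolding p by algebra
  have e2: "(1 - a * b)\<^sup>2 - t\<^sup>2 * (a - b)\<^sup>2 = p2 * p3"
    unfolding p by algebra
  have c: "chi (u / v) a / v ^ 3 = a\<^sup>2 / (v * (v\<^sup>2 - u\<^sup>2 * a\<^sup>2))" if "v > 0" for u v
  proof -
    have "1 - (u / v)\<^sup>2 * a\<^sup>2 = (v\<^sup>2 - u\<^sup>2 * a\<^sup>2) / v\<^sup>2"
      using that by (simp add: field_simps)
    then show ?thesis using that by (simp add: chi_def power2_eq_square power3_eq_cube)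
  qed
  have e3: "(1 + t * b)\<^sup>2 - (t + b)\<^sup>2 * a\<^sup>2 = p1 * p2"
    unfolding p by algebra
  have e4: "(1 - t * b)\<^sup>2 - (t - b)\<^sup>2 * a\<^sup>2 = p3 * p4"
    unfolding p by algebra
  have L: "chi2 1 t a b = ((a + b)\<^sup>2 * (1 + a * b) / (p1 * p4) + (a - b)\<^sup>2 * (1 - a * b) / (p2 * p3)) / 2"
    using chi2_term[of a b t 1] chi2_term[of a "-b" t 1] assms
    by (simp add: chi2_def e1 e2)
  have R: "1 - t\<^sup>2 * b\<^sup>2 = (1 + t * b) * (1 - t * b)" by algebra
  have "((a + b)\<^sup>2 * (1 + a * b) / (p1 * p4) + (a - b)\<^sup>2 * (1 - a * b) / (p2 * p3)) / 2 =
     b\<^sup>2 / ((1 + t * b) * (1 - t * b)) + (1 - b\<^sup>2)\<^sup>2 / 2 *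
     (a\<^sup>2 / ((1 + t * b) * (p1 * p2)) + a\<^sup>2 / ((1 - t * b) * (p3 * p4)))"
    using pos tb by (simp add: divide_simps) (unfold p, algebra)
  then show ?thesis
    unfolding L c[OF tb(1)] c[OF tb(2)] e3 e4 by (simp add: chi_def R)
qed

lemma chi_diff:
  assumes "\<bar>t\<bar> < 1" "\<bar>m\<bar> \<le> 1" "0 \<le> s" "s \<le> s'" "s' \<le> 1"
  shows "chi t (s' * m) - chi t (s * m) =
    (s'\<^sup>2 - s\<^sup>2) * m\<^sup>2 / ((1 - t\<^sup>2 * (s' * m)\<^sup>2) * (1 - t\<^sup>2 * (s * m)\<^sup>2))"
proof -
  have "\<bar>s * m\<bar> \<le> 1" "\<bar>s' * m\<bar> \<le> 1"
    using assms by (auto simp: abs_mult intro!: mult_le_one)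
  then have "t\<^sup>2 * (s * m)\<^sup>2 < 1" "t\<^sup>2 * (s' * m)\<^sup>2 < 1"
    using mult_sq_less_1 assms(1) by blast+
  then show ?thesis
    unfolding chi_def by (simp add: diff_frac_eq) algebra
qed

text \<open>The price of raising s to s': both denominators in \<open>chi_diff\<close> are at least
  1 - r^2 s'^2. The bound is free of m, so it passes to means.\<close>

lemma chi_scale_diff_le:
  assumes "\<bar>t\<bar> \<le> r" "r < 1" "\<bar>m\<bar> \<le> 1" "0 \<le> s" "s \<le> s'" "s' \<le> 1"
  shows "chi t (s' * m) - chi t (s * m) \<le> (s'\<^sup>2 - s\<^sup>2) / (1 - r\<^sup>2 * s'\<^sup>2)\<^sup>2"
proof -
  have ss: "s\<^sup>2 \<le> s'\<^sup>2" "s'\<^sup>2 \<le> 1" "m\<^sup>2 \<le> 1" "t\<^sup>2 \<le> r\<^sup>2" "r\<^sup>2 < 1"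
    using assms by (auto simp: power_mono power_le_one abs_square_le_1 abs_square_less_1
        abs_le_square_iff[symmetric])
  have "v\<^sup>2 * m\<^sup>2 \<le> s'\<^sup>2" if "v\<^sup>2 \<le> s'\<^sup>2" for v
    using mult_mono[OF that ss(3)] by simp
  then have "t\<^sup>2 * (s' * m)\<^sup>2 \<le> r\<^sup>2 * s'\<^sup>2" "t\<^sup>2 * (s * m)\<^sup>2 \<le> r\<^sup>2 * s'\<^sup>2"
    unfolding power_mult_distrib using ss by (auto intro!: mult_mono)
  moreover have "r\<^sup>2 * s'\<^sup>2 < 1" using mult_sq_less_1[of r s'] assms by auto
  ultimately have "(s'\<^sup>2 - s\<^sup>2) * m\<^sup>2 / ((1 - t\<^sup>2 * (s' * m)\<^sup>2) * (1 - t\<^sup>2 * (s * m)\<^sup>2)) \<le>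
      (s'\<^sup>2 - s\<^sup>2) / ((1 - r\<^sup>2 * s'\<^sup>2) * (1 - r\<^sup>2 * s'\<^sup>2))"
    using ss by (intro frac_le mult_mono mult_left_le) auto
  then show ?thesis
    using chi_diff[of t m s s'] assms by (simp add: power2_eq_square)
qed

lemma chi_scale_diff_ge:
  assumes "\<bar>t\<bar> < 1" "\<bar>m\<bar> \<le> 1" "0 \<le> s" "s \<le> 1"
  shows "(1 - s\<^sup>2) * m\<^sup>2 \<le> chi t m - chi t (s * m)"
proof -
  have "\<bar>s * m\<bar> \<le> 1" using assms by (auto simp: abs_mult intro!: mult_le_one)
  then have "t\<^sup>2 * (s * m)\<^sup>2 < 1" "t\<^sup>2 * m\<^sup>2 < 1"
    using mult_sq_less_1 assms by auto
  moreover have "s\<^sup>2 \<le> 1" using assms by (simp add: power_le_one)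
  ultimately have "(1 - s\<^sup>2) * m\<^sup>2 / 1 \<le> (1 - s\<^sup>2) * m\<^sup>2 / ((1 - t\<^sup>2 * m\<^sup>2) * (1 - t\<^sup>2 * (s * m)\<^sup>2))"
    by (intro divide_left_mono mult_le_one mult_nonneg_nonneg mult_pos_pos) auto
  then show ?thesis using chi_diff[of t m s 1] assms by simp
qed

section \<open>Pointwise gain from a clean observation, and common versus independent noise\<close>

lemma tilt_bounds:
  fixes t b :: real
  assumes "\<bar>t\<bar> < 1" "\<bar>b\<bar> < 1"
  shows "0 < 1 + t * b" "0 < 1 - t * b"
    "\<bar>(t + b) / (1 + t * b)\<bar> < 1" "\<bar>(t - b) / (1 - t * b)\<bar> < 1"
proof -
  show tb: "0 < 1 + t * b" "0 < 1 - t * b"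
    using mult_abs_less_1[of t b] assms by auto
  have "(1 - t) * (1 - b) > 0" "(1 + t) * (1 + b) > 0" "(1 - t) * (1 + b) > 0" "(1 + t) * (1 - b) > 0"
    using assms by auto
  then have "\<bar>t + b\<bar> < 1 + t * b" "\<bar>t - b\<bar> < 1 - t * b"
    by (auto simp: algebra_simps abs_less_iff)
  then show "\<bar>(t + b) / (1 + t * b)\<bar> < 1" "\<bar>(t - b) / (1 - t * b)\<bar> < 1"
    using tb by (auto simp: abs_divide)
qed

text \<open>Expand with x as the fixed observation. The weight (1 - x^2)^2 supplies two factors 1 -
  s^2 and \<open>chi_scale_diff_ge\<close> the third. One of 1 + t x and 1 - t x is at most 1, so
  the inverse cubes sum to at least 1.\<close>

lemma chi2_gain:
  assumes "\<bar>t\<bar> < 1" "\<bar>b\<bar> \<le> 1" "0 \<le> s" "s < 1" "\<bar>x\<bar> \<le> s"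
  shows "(1 - s\<^sup>2) ^ 3 / 2 * b\<^sup>2 \<le> chi2 1 t x b - chi2 1 t x (s * b)"
proof -
  have x: "\<bar>x\<bar> < 1" "x\<^sup>2 \<le> s\<^sup>2" "s\<^sup>2 < 1" and sb: "\<bar>s * b\<bar> \<le> 1"
    using assms by (auto simp: abs_mult abs_square_less_1 intro!: mult_le_one)
      (metis abs_ge_zero power2_abs power_mono)
  note tilt = tilt_bounds[OF assms(1) x(1)]
  define g where "g \<tau> = chi \<tau> b - chi \<tau> (s * b)" for \<tau>
  define u v where "u = (t + x) / (1 + t * x)" and "v = (t - x) / (1 - t * x)"
  define c where "c = (1 - s\<^sup>2) * b\<^sup>2"
  have c0: "0 \<le> c" using x unfolding c_def by simp
  have "chi2 1 t x b - chi2 1 t x (s * b) =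
      (1 - x\<^sup>2)\<^sup>2 / 2 * (g u / (1 + t * x) ^ 3 + g v / (1 - t * x) ^ 3)"
    using chi2_expand[of b x t] chi2_expand[of "s * b" x t] assms x sb
    by (simp add: g_def u_def v_def chi2_swap[of 1 t x] algebra_simps diff_divide_distrib add_divide_distrib)
  moreover have "c \<le> g u" "c \<le> g v"
    unfolding g_def c_def using chi_scale_diff_ge tilt assms by (auto simp: u_def v_def)
  moreover have "c \<le> c / (1 + t * x) ^ 3 + c / (1 - t * x) ^ 3"
  proof (cases "t * x \<le> 0")
    case True
    then have "(1 + t * x) ^ 3 \<le> 1" using tilt by (intro power_le_one) auto
    then have "c \<le> c / (1 + t * x) ^ 3"
      using tilt c0 by (simp add: le_divide_eq mult_left_le)
    then show ?thesis using tilt c0 by (simp add: add_increasing2)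
  next
    case False
    then have "(1 - t * x) ^ 3 \<le> 1" using tilt by (intro power_le_one) auto
    then have "c \<le> c / (1 - t * x) ^ 3"
      using tilt c0 by (simp add: le_divide_eq mult_left_le)
    then show ?thesis using tilt c0 by (simp add: add_increasing)
  qed
  moreover have "c / (1 + t * x) ^ 3 \<le> g u / (1 + t * x) ^ 3" "c / (1 - t * x) ^ 3 \<le> g v / (1 - t * x) ^ 3"
    using calculation tilt by (auto intro!: divide_right_mono)
  ultimately have "(1 - x\<^sup>2)\<^sup>2 / 2 * c \<le> chi2 1 t x b - chi2 1 t x (s * b)"
    by (auto intro!: mult_left_mono)
  moreover have "(1 - s\<^sup>2)\<^sup>2 / 2 * c \<le> (1 - x\<^sup>2)\<^sup>2 / 2 * c"
    using c0 x by (intro mult_right_mono divide_right_mono power_mono) auto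
  ultimately show ?thesis by (simp add: c_def power3_eq_cube power2_eq_square mult_ac)
qed

text \<open>Dividing through by the powers of X and Y shows that the expression depends only on T
  and the ratios c / X and c / Y, and it increases in both ratios.\<close>

lemma weighted_term_mono:
  fixes c c' X X' Y Y' T :: real
  assumes "0 < X" "0 < Y" "0 < X'" "0 < Y'" "0 \<le> c'" "0 \<le> T"
    and cX: "c' * X \<le> c * X'" and cY: "c' * Y \<le> c * Y'"
    and "T * c\<^sup>2 < X\<^sup>2" "T * c\<^sup>2 < Y\<^sup>2"
  shows "c'\<^sup>2 * (X' * Y' + T * c'\<^sup>2) / ((X'\<^sup>2 - T * c'\<^sup>2) * (Y'\<^sup>2 - T * c'\<^sup>2))
       \<le> c\<^sup>2 * (X * Y + T * c\<^sup>2) / ((X\<^sup>2 - T * c\<^sup>2) * (Y\<^sup>2 - T * c\<^sup>2))"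
proof -
  have norm: "d\<^sup>2 * (A * B + T * d\<^sup>2) / ((A\<^sup>2 - T * d\<^sup>2) * (B\<^sup>2 - T * d\<^sup>2)) =
     ((d / A) * (d / B)) * (1 + T * ((d / A) * (d / B))) / ((1 - T * (d / A)\<^sup>2) * (1 - T * (d / B)\<^sup>2))"
    if "0 < A" "0 < B" for d A B
  proof -
    have "1 - T * (d / A)\<^sup>2 = (A\<^sup>2 - T * d\<^sup>2) / A\<^sup>2" "1 - T * (d / B)\<^sup>2 = (B\<^sup>2 - T * d\<^sup>2) / B\<^sup>2"
      "1 + T * ((d / A) * (d / B)) = (A * B + T * d\<^sup>2) / (A * B)"
      using that by (auto simp: field_simps power2_eq_square)
    then show ?thesis using that by (simp add: power2_eq_square mult_ac)
  qed
  have r: "c' / X' \<le> c / X" "c' / Y' \<le> c / Y" "0 \<le> c' / X'" "0 \<le> c' / Y'"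
    using assms by (auto simp: divide_simps mult.commute)
  have "T * (c / X)\<^sup>2 < 1" "T * (c / Y)\<^sup>2 < 1"
    using assms by (auto simp: power_divide divide_less_eq)
  moreover have "T * (c' / X')\<^sup>2 \<le> T * (c / X)\<^sup>2" "T * (c' / Y')\<^sup>2 \<le> T * (c / Y)\<^sup>2"
    using r assms by (auto intro!: mult_left_mono power_mono)
  moreover have "c' / X' * (c' / Y') \<le> c / X * (c / Y)" "0 \<le> c' / X' * (c' / Y')"
    using r by (intro mult_mono mult_nonneg_nonneg; simp)+
  moreover have "P * (1 + T * P) / ((1 - u') * (1 - v')) \<le> Q * (1 + T * Q) / ((1 - u) * (1 - v))"
    if "0 \<le> P" "P \<le> Q" "u' \<le> u" "v' \<le> v" "u < 1" "v < 1" for P Q u u' v v' :: real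
    using that \<open>0 \<le> T\<close>
    by (intro frac_le mult_mono mult_pos_pos mult_nonneg_nonneg add_nonneg_nonneg add_left_mono mult_left_mono)
       auto
  ultimately show ?thesis
    unfolding norm[OF assms(1,2)] norm[OF assms(3,4)] by blast
qed

text \<open>Both sides have the same numerators c^2 and c'^2; only the weights change, from Y, Y' to
  X, X'. Passing from left to right raises the term with a + b by (1 - s^2) a b D and lowers the
  term with a - b by (1 - s^2) a b D', so everything reduces to D' <= D.\<close>

lemma chi2_scale_le_nonneg:
  assumes ab: "0 \<le> a" "a \<le> 1" "0 \<le> b" "b \<le> 1" and t: "\<bar>t\<bar> < 1" and s: "0 \<le> s" "s \<le> 1"
  shows "chi2 s t a b \<le> chi2 1 t (s * a) (s * b)"
proof -
  define X X' Y Y' where XY: "X = 1 + s\<^sup>2 * (a * b)" "X' = 1 - s\<^sup>2 * (a * b)" "Y = 1 + a * b" "Y' = 1 - a * b"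
  define c c' T where cT: "c = s * (a + b)" "c' = s * \<bar>a - b\<bar>" "T = t\<^sup>2"
  have abs: "\<bar>a\<bar> \<le> 1" "\<bar>b\<bar> \<le> 1" "\<bar>s * a\<bar> \<le> 1" "\<bar>s * b\<bar> \<le> 1"
    using assms by (auto simp: abs_mult intro!: mult_le_one)
  have p: "0 \<le> a * b" "a * b \<le> 1" "s\<^sup>2 * (a * b) \<le> a * b" "s\<^sup>2 \<le> 1"
    using assms by (auto intro!: mult_le_one mult_left_le_one_le power_le_one)
  have l: "chi2 s t a b = (c\<^sup>2 * Y / (Y\<^sup>2 - T * c\<^sup>2) + c'\<^sup>2 * Y' / (Y'\<^sup>2 - T * c'\<^sup>2)) / 2"
    using chi2_term[of a b t s] chi2_term[of a "- b" t s] abs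
    by (simp add: chi2_def XY cT power_mult_distrib)
  have r: "chi2 1 t (s * a) (s * b) = (c\<^sup>2 * X / (X\<^sup>2 - T * c\<^sup>2) + c'\<^sup>2 * X' / (X'\<^sup>2 - T * c'\<^sup>2)) / 2"
  proof -
    have e: "s * a * (s * b) = s\<^sup>2 * (a * b)" "(s * a + s * b) = c" "(s * a - s * b)\<^sup>2 = c'\<^sup>2"
      by (auto simp: cT power2_eq_square algebra_simps abs_mult_self_eq)
    show ?thesis
      using chi2_term[of "s * a" "s * b" t 1] chi2_term[of "s * a" "- (s * b)" t 1] abs
      by (simp add: chi2_def XY e cT(3))
  qed
  have small: "T * v\<^sup>2 < w\<^sup>2" if "0 \<le> v" "v \<le> w" "0 < w" for v w
  proof (cases "v = 0")
    case False
    then have "T * v\<^sup>2 < v\<^sup>2" using t by (simp add: cT abs_square_less_1)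
    also have "\<dots> \<le> w\<^sup>2" using that by (intro power_mono) auto
    finally show ?thesis .
  qed (use that in simp)
  have "0 \<le> (1 - a) * (1 - b)" "0 \<le> (1 - s * a) * (1 - s * b)"
    using ab abs by (auto simp: abs_le_iff)
  then have cle: "c \<le> X" "a + b \<le> Y"
    by (auto simp: cT XY algebra_simps power2_eq_square)
  moreover have "c \<le> a + b" using s ab by (simp add: cT mult_left_le_one_le)
  moreover have pos: "0 < X" "0 < Y" "0 \<le> c" using p s ab by (auto simp: XY cT intro: add_pos_nonneg)
  ultimately have V: "T * c\<^sup>2 < X\<^sup>2" "T * c\<^sup>2 < Y\<^sup>2"
    by (auto intro!: small)
  have frac: "A / (A\<^sup>2 - v) - B / (B\<^sup>2 - v) = (B - A) * (A * B + v) / ((A\<^sup>2 - v) * (B\<^sup>2 - v))"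
    if "v < A\<^sup>2" "v < B\<^sup>2" for A B v :: real
    using that by (simp add: diff_frac_eq) algebra
  have T0: "0 \<le> T" and q: "0 \<le> (1 - s\<^sup>2) * (a * b)" and YX: "Y - X = (1 - s\<^sup>2) * (a * b)"
    "Y' - X' = - ((1 - s\<^sup>2) * (a * b))"
    using p by (auto simp: cT XY algebra_simps)
  define D where "D = c\<^sup>2 * (X * Y + T * c\<^sup>2) / ((X\<^sup>2 - T * c\<^sup>2) * (Y\<^sup>2 - T * c\<^sup>2))"
  have D: "c\<^sup>2 * X / (X\<^sup>2 - T * c\<^sup>2) - c\<^sup>2 * Y / (Y\<^sup>2 - T * c\<^sup>2) = (1 - s\<^sup>2) * (a * b) * D"
    using arg_cong[OF frac[OF V], of "\<lambda>z. c\<^sup>2 * z"] by (simp add: D_def YX right_diff_distrib mult_ac)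
  have halve: "(q + q') / 2 \<le> (p + p') / 2" if "p - q = x" "p' - q' = x'" "0 \<le> x + x'" for p q p' q' x x' :: real
    by (rule divide_right_mono) (use that in linarith, simp)
  have D0: "0 \<le> D" unfolding D_def using V pos T0 by simp
  show ?thesis
  \<comment> \<open>Treating the diagonal apart excludes a = b = 1, where Y' is 0. On the diagonal
    c' = 0, and only the terms with a + b remain.\<close>
  proof (cases "a = b")
    case True
    then have "c' = 0" by (simp add: cT)
    then show ?thesis using halve[OF D, of 0 0 0] D0 q unfolding l r by simp
  next
    case False
    have "a * b < 1"
    proof (rule ccontr)
      assume "\<not> a * b < 1"
      then have "1 \<le> a * b" by simp
      then have "a = 1" "b = 1"
        using ab mult_left_le[of b a] mult_left_le_one_le[of b a] by auto
      then show False using False by simp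
    qed
    then have pos': "0 < X'" "0 < Y'" using p by (auto simp: XY)
    have "0 \<le> (1 - a) * (1 + b)" "0 \<le> (1 + a) * (1 - b)" "0 \<le> (1 - s * a) * (1 + s * b)" "0 \<le> (1 + s * a) * (1 - s * b)"
      using ab abs s by (auto simp: abs_le_iff)
    then have "\<bar>a - b\<bar> \<le> Y'" "\<bar>s * a - s * b\<bar> \<le> X'"
      by (auto simp: XY algebra_simps power2_eq_square abs_le_iff)
    moreover have "c' = \<bar>s * a - s * b\<bar>" using s by (simp add: cT abs_mult flip: right_diff_distrib)
    moreover have "c' \<le> \<bar>a - b\<bar>" "0 \<le> c'" using s by (auto simp: cT mult_left_le_one_le)
    ultimately have V': "T * c'\<^sup>2 < X'\<^sup>2" "T * c'\<^sup>2 < Y'\<^sup>2" and c'0: "0 \<le> c'"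
      using pos' by (linarith | intro small)+
    \<comment> \<open>The two ratio comparisons at once: e = s^2 for X and X', e = 1 for Y and Y'.
      If a <= b it reduces to 0 <= s a (1 - e b^2), otherwise to 0 <= s b (1 - e a^2).\<close>
    have cmp: "c' * (1 + e * (a * b)) \<le> c * (1 - e * (a * b))" if "0 \<le> e" "e \<le> 1" for e
    proof -
      have "e * a\<^sup>2 \<le> 1" "e * b\<^sup>2 \<le> 1" using that ab by (auto intro!: mult_le_one power_le_one)
      then have "0 \<le> s * (b * (1 - e * a\<^sup>2))" "0 \<le> s * (a * (1 - e * b\<^sup>2))"
        using ab s by auto
      then show ?thesis
        by (cases "a \<le> b") (simp_all add: cT algebra_simps power2_eq_square)
    qed
    define D' where "D' = c'\<^sup>2 * (X' * Y' + T * c'\<^sup>2) / ((X'\<^sup>2 - T * c'\<^sup>2) * (Y'\<^sup>2 - T * c'\<^sup>2))"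
    have D': "c'\<^sup>2 * X' / (X'\<^sup>2 - T * c'\<^sup>2) - c'\<^sup>2 * Y' / (Y'\<^sup>2 - T * c'\<^sup>2) = - ((1 - s\<^sup>2) * (a * b)) * D'"
      using arg_cong[OF frac[OF V'], of "\<lambda>z. c'\<^sup>2 * z"] by (simp add: D'_def YX right_diff_distrib mult_ac)
    have "D' \<le> D"
      unfolding D_def D'_def using cmp[of "s\<^sup>2"] cmp[of 1] pos pos' c'0 T0 V p
      by (intro weighted_term_mono) (auto simp: XY)
    then have "0 \<le> (1 - s\<^sup>2) * (a * b) * (D - D')" using q by simp
    then show ?thesis
      unfolding l r by (intro halve[OF D D']) (simp add: algebra_simps)
  qed
qed

lemma chi2_scale_le:
  assumes "\<bar>a\<bar> \<le> 1" "\<bar>b\<bar> \<le> 1" "\<bar>t\<bar> < 1" "0 \<le> s" "s \<le> 1"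
  shows "chi2 s t a b \<le> chi2 1 t (s * a) (s * b)"
proof -
  have "chi2 s t a b = chi2 s t \<bar>a\<bar> \<bar>b\<bar>"
    by (simp add: abs_if chi2_minus chi2_minus_left)
  moreover have "chi2 1 t (s * a) (s * b) = chi2 1 t (s * \<bar>a\<bar>) (s * \<bar>b\<bar>)"
    by (simp add: abs_if chi2_minus chi2_minus_left)
  ultimately show ?thesis using chi2_scale_le_nonneg[of "\<bar>a\<bar>" "\<bar>b\<bar>" t s] assms by simp
qed

section \<open>Posterior bias and balanced distributions\<close>

function bias :: "ereal \<Rightarrow> real" where
  "bias (ereal x) = (exp x - 1) / (exp x + 1)"
| "bias \<infinity> = 1"
| "bias (-\<infinity>) = -1"
proof goal_cases
  case (1 P x)
  then show P by (cases x) auto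
qed simp_all
termination by lexicographic_order

lemma bias_zero [simp]: "bias 0 = 0"
  by (simp add: zero_ereal_def)

lemma exp_plus_1_pos [simp]: "0 < exp x + 1" "exp x + 1 \<noteq> (0::real)" "1 + exp x \<noteq> (0::real)"
  using exp_gt_zero[of x] by linarith+

lemma abs_bias_less_1: "\<bar>bias (ereal x)\<bar> < 1"
  by (simp add: abs_less_iff divide_less_eq less_divide_eq)

lemma abs_bias_le_1: "\<bar>bias x\<bar> \<le> 1"
  using abs_bias_less_1 by (cases x) (auto simp: less_imp_le simp del: bias.simps(1))

lemma bias_bounds: "- 1 \<le> bias x" "bias x \<le> 1"
  using abs_bias_le_1[of x] by auto

lemma bias_uminus [simp]: "bias (- x) = - bias x"
proof (cases x)
  case (real r)
  then show ?thesis by (simp add: exp_minus divide_simps)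
qed simp_all

text \<open>The addition theorem of tanh. It is confined to finite arguments because the denominator
  is 0 for opposite infinite ones.\<close>

lemma bias_add:
  "bias (ereal x + ereal y) =
    (bias (ereal x) + bias (ereal y)) / (1 + bias (ereal x) * bias (ereal y))"
proof -
  have "1 + bias (ereal x) * bias (ereal y) > 0"
    using mult_abs_less_1[OF abs_bias_less_1 less_imp_le[OF abs_bias_less_1], of x y] by linarith
  moreover define p q where "p = exp x" "q = exp y"
  moreover have "1 + (p - 1) / (p + 1) * ((q - 1) / (q + 1)) = 2 * (p * q + 1) / ((p + 1) * (q + 1))"
    "(p - 1) / (p + 1) + (q - 1) / (q + 1) = 2 * (p * q - 1) / ((p + 1) * (q + 1))"
    "p * q + 1 > 0"
    unfolding p_q_def by (simp_all add: divide_simps add_pos_pos) (simp_all add: algebra_simps)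
  moreover have "(2 * z - 2) / (2 * z + 2) = (z - 1) / (z + 1)" if "z > 0" for z :: real
  proof -
    have "2 * z - 2 = 2 * (z - 1)" "2 * z + 2 = 2 * (z + 1)" by simp_all
    then show ?thesis by (simp only: mult_divide_mult_cancel_left_if) simp
  qed
  from this[of "p * q"] have "(2 * (p * q) - 2) / (2 * (p * q) + 2) = (p * q - 1) / (p * q + 1)"
    by (simp add: p_q_def)
  ultimately show ?thesis by (simp add: exp_add)
qed

lemma F_BSC_uminus:
  assumes "0 \<le> \<delta>" "\<delta> \<le> 1"
  shows "F_BSC \<delta> (- x) = - F_BSC \<delta> x"
proof (cases x)
  case (real r)
  define p where "p = exp r"
  have p: "p > 0" "exp (- r) = 1 / p" by (auto simp: p_def exp_minus field_simps)
  have pos: "(1 - \<delta>) * p + \<delta> > 0" "\<delta> * p + 1 - \<delta> > 0"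
    using assms p by (cases "\<delta> = 0"; cases "\<delta> = 1"; simp add: add_pos_nonneg add_pos_pos add_diff_eq[symmetric])+
  have "(1 - \<delta>) * (1 / p) + \<delta> = (\<delta> * p + 1 - \<delta>) / p"
    "\<delta> * (1 / p) + 1 - \<delta> = ((1 - \<delta>) * p + \<delta>) / p"
    using p(1) by (simp_all add: field_simps)
  then have "((1 - \<delta>) * (1 / p) + \<delta>) / (\<delta> * (1 / p) + 1 - \<delta>) = (\<delta> * p + 1 - \<delta>) / ((1 - \<delta>) * p + \<delta>)"
    using p(1) by simp
  moreover have "ln (v / u) = - ln (u / v)" if "u > 0" "v > 0" for u v :: real
    using that by (simp add: ln_div)
  note this[OF pos]
  ultimately show ?thesis using real p by (simp add: p_def)
qed simp_all

text \<open>In the bias coordinate the channel is linear, so an edge acts on the test functions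
  merely by rescaling t.\<close>

lemma bias_F_BSC:
  assumes "0 \<le> \<delta>" "\<delta> \<le> 1"
  shows "bias (F_BSC \<delta> x) = (1 - 2 * \<delta>) * bias x"
proof -
  have PInf: "bias (F_BSC \<delta> \<infinity>) = 1 - 2 * \<delta>"
    using assms by (auto simp: divide_simps)
  show ?thesis
  proof (cases x)
    case (real r)
    define p where "p = exp r"
    have p: "p > 0" by (auto simp: p_def)
    have pos: "(1 - \<delta>) * p + \<delta> > 0" "\<delta> * p + 1 - \<delta> > 0"
      using assms p by (cases "\<delta> = 0"; cases "\<delta> = 1"; simp add: add_pos_nonneg add_pos_pos add_diff_eq[symmetric])+
    define q where "q = ((1 - \<delta>) * p + \<delta>) / (\<delta> * p + 1 - \<delta>)"
    have "q > 0" using pos by (simp add: q_def)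
    have "(u / v - 1) / (u / v + 1) = (u - v) / (u + v)" if "v > 0" "u > 0" for u v :: real
    proof -
      have "u / v - 1 = (u - v) / v" "u / v + 1 = (u + v) / v" using that by (simp_all add: field_simps)
      then show ?thesis using that by simp
    qed
    from this[OF pos(2,1)] have "(q - 1) / (q + 1) = ((1 - 2 * \<delta>) * (p - 1)) / (p + 1)"
      by (simp add: q_def algebra_simps)
    then show ?thesis using real \<open>q > 0\<close> by (simp add: p_def q_def)
  next
    case MInf
    then show ?thesis using PInf F_BSC_uminus[OF assms, of \<infinity>] by simp
  qed (use PInf in simp)
qed

lemma borel_measurable_bias [measurable]: "bias \<in> borel_measurable borel"
proof -
  have "bias = (\<lambda>x. if x = \<infinity> then 1 else if x = -\<infinity> then -1
      else (exp (real_of_ereal x) - 1) / (exp (real_of_ereal x) + 1))"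
  proof
    fix x show "bias x = (if x = \<infinity> then 1 else if x = -\<infinity> then -1
      else (exp (real_of_ereal x) - 1) / (exp (real_of_ereal x) + 1))"
      by (cases x) simp_all
  qed
  also have "\<dots> \<in> borel_measurable borel" by measurable
  finally show ?thesis .
qed

section \<open>Bounded measurable functions and iterated integrals\<close>

definition bmeas :: "'a measure \<Rightarrow> ('a \<Rightarrow> real) \<Rightarrow> bool" where
  "bmeas M f \<longleftrightarrow> f \<in> borel_measurable M \<and> (\<exists>B. \<forall>x. \<bar>f x\<bar> \<le> B)"

lemma bmeasI: "f \<in> borel_measurable M \<Longrightarrow> (\<And>x. \<bar>f x\<bar> \<le> B) \<Longrightarrow> bmeas M f"
  by (auto simp: bmeas_def)

lemma bmeas_measurable: "bmeas M f \<Longrightarrow> f \<in> borel_measurable M"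
  by (auto simp: bmeas_def)

lemma bmeas_cong_sets: "sets M = sets N \<Longrightarrow> bmeas M f = bmeas N f"
  by (simp add: bmeas_def cong: measurable_cong_sets)

lemma bmeas_integrable:
  assumes "prob_space M" "bmeas M f"
  shows "integrable M f"
proof -
  interpret prob_space M by fact
  from assms(2) obtain B where "\<And>x. \<bar>f x\<bar> \<le> B" by (auto simp: bmeas_def)
  then show ?thesis
    using bmeas_measurable[OF assms(2)] by (intro integrable_const_bound[where B = B]) auto
qed

lemma bmeas_compose: "bmeas N f \<Longrightarrow> g \<in> measurable M N \<Longrightarrow> bmeas M (\<lambda>x. f (g x))"
  by (auto simp: bmeas_def)

lemma bmeas_const: "bmeas M (\<lambda>x. c)"
  by (auto simp: bmeas_def)

lemma bmeas_add:
  assumes "bmeas M f" "bmeas M g"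
  shows "bmeas M (\<lambda>x. f x + g x)"
proof -
  from assms obtain B C where "\<And>x. \<bar>f x\<bar> \<le> B" "\<And>x. \<bar>g x\<bar> \<le> C" by (auto simp: bmeas_def)
  then have "\<bar>f x + g x\<bar> \<le> B + C" for x
    by (intro order_trans[OF abs_triangle_ineq] add_mono)
  then show ?thesis using assms by (intro bmeasI) (auto simp: bmeas_def)
qed

lemma bmeas_mult:
  assumes "bmeas M f" "bmeas M g"
  shows "bmeas M (\<lambda>x. f x * g x)"
proof -
  from assms obtain B C where B: "\<And>x. \<bar>f x\<bar> \<le> B" "\<And>x. \<bar>g x\<bar> \<le> C" by (auto simp: bmeas_def)
  then have "\<bar>f x * g x\<bar> \<le> B * C" for x
    unfolding abs_mult by (intro mult_mono) (auto intro: order_trans[OF abs_ge_zero])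
  then show ?thesis using assms by (intro bmeasI) (auto simp: bmeas_def)
qed

lemma bmeas_diff: "bmeas M f \<Longrightarrow> bmeas M g \<Longrightarrow> bmeas M (\<lambda>x. f x - g x)"
  using bmeas_add[of M f "\<lambda>x. -1 * g x"] bmeas_mult[OF bmeas_const, of M g "-1"] by simp

lemma bmeas_divide: "bmeas M f \<Longrightarrow> bmeas M (\<lambda>x. f x / c)"
  using bmeas_mult[OF _ bmeas_const, of M f "1 / c"] by simp

lemma bmeas_bias: "g \<in> borel_measurable M \<Longrightarrow> bmeas M (\<lambda>x. bias (g x))"
  by (rule bmeasI[where B = 1]) (auto simp: abs_bias_le_1)

lemmas bmeas_intros = bmeas_const bmeas_add bmeas_mult bmeas_diff bmeas_divide bmeas_bias

lemma bmeas_integral: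
  assumes N: "prob_space N" and h: "bmeas (M \<Otimes>\<^sub>M N) h"
  shows "bmeas M (\<lambda>x. \<integral>y. h (x, y) \<partial>N)"
proof -
  interpret N: prob_space N by fact
  from h obtain B where B: "\<And>z. \<bar>h z\<bar> \<le> B" and [measurable]: "h \<in> borel_measurable (M \<Otimes>\<^sub>M N)"
    by (auto simp: bmeas_def)
  have "\<bar>\<integral>y. h (x, y) \<partial>N\<bar> \<le> B" if x: "x \<in> space M" for x
  proof -
    have "bmeas N (\<lambda>y. h (x, y))" using x B by (intro bmeasI[where B = B]) auto
    then have "integrable N (\<lambda>y. h (x, y))" by (rule bmeas_integrable[OF N])
    then have "\<bar>\<integral>y. h (x, y) \<partial>N\<bar> \<le> (\<integral>y. \<bar>h (x, y)\<bar> \<partial>N)" by simp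
    also have "\<dots> \<le> (\<integral>y. B \<partial>N)"
      using B \<open>integrable N _\<close> by (intro integral_mono) auto
    finally show ?thesis by (simp add: N.prob_space)
  qed
  moreover have "\<bar>\<integral>y. h (x, y) \<partial>N\<bar> \<le> B" for x
  proof -
    have "\<bar>\<integral>y. h (x, y) \<partial>N\<bar> \<le> (\<integral>y. B \<partial>N)"
    proof (cases "integrable N (\<lambda>y. h (x, y))")
      case True
      then show ?thesis using B
        by (intro order_trans[OF integral_abs_bound] integral_mono) auto
    next
      \<comment> \<open>For x outside the space of M the section may fail to be measurable. Its
        integral is then 0 by convention, which still obeys the bound.\<close>
      case False
      then show ?thesis using B[of "(x, undefined)"]
        by (simp add: not_integrable_integral_eq N.prob_space)
    qed
    then show ?thesis by (simp add: N.prob_space)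
  qed
  ultimately show ?thesis by (intro bmeasI) auto
qed

lemma integral_pair:
  assumes "prob_space M" "prob_space N" "bmeas (M \<Otimes>\<^sub>M N) h"
  shows "(\<integral>z. h z \<partial>(M \<Otimes>\<^sub>M N)) = (\<integral>x. \<integral>y. h (x, y) \<partial>N \<partial>M)"
proof -
  interpret M: prob_space M by fact
  interpret N: prob_space N by fact
  interpret pair_prob_space M N ..
  have "integrable (M \<Otimes>\<^sub>M N) h"
    using prob_space_pair[OF assms(1,2)] assms(3) by (rule bmeas_integrable)
  then show ?thesis by (rule integral_fst'[symmetric])
qed

text \<open>Given \<open>\<bar>r\<bar>\<close>, a symmetric law assigns the signs of \<open>r\<close> the conditional probabilities
  \<open>(1 \<plusminus> m) / 2\<close>.  Unlike the density form of symmetry, this form also covers the atom at \<open>\<infinity>\<close>.\<close>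

definition symz :: "(ereal \<Rightarrow> real) \<Rightarrow> ereal \<Rightarrow> real" where
  "symz f x = (1 + bias x) / 2 * f x + (1 - bias x) / 2 * f (- x)"

definition balanced :: "ereal measure \<Rightarrow> bool" where
  "balanced \<mu> \<longleftrightarrow> prob_space \<mu> \<and> sets \<mu> = sets borel \<and>
     (\<forall>f. bmeas borel f \<longrightarrow> (\<integral>x. f x \<partial>\<mu>) = (\<integral>x. symz f x \<partial>\<mu>))"

lemma symz_even: "symz f (- x) = symz f x"
  by (simp add: symz_def)

lemma symz_PInf [simp]: "symz f \<infinity> = f \<infinity>"
  by (simp add: symz_def)

text \<open>Both infinite ends receive the value at \<infinity>. Hence a balanced law gives no mass
  to -\<infinity> (test with its indicator), and \<infinity> + (-\<infinity>) = \<infinity> is the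
  right convention in symmetrized sums.\<close>

lemma symz_MInf [simp]: "symz f (-\<infinity>) = f \<infinity>"
  by (simp add: symz_def)

lemma symz_of_even: "(\<And>x. f (- x) = f x) \<Longrightarrow> symz f x = f x"
  by (simp add: symz_def field_simps)

lemma bmeas_symz:
  assumes f: "bmeas borel f"
  shows "bmeas borel (symz f)"
  unfolding symz_def by (intro bmeas_intros f bmeas_compose[OF f]) auto

lemma balancedD:
  assumes "balanced \<mu>"
  shows "prob_space \<mu>" "sets \<mu> = sets borel" "space \<mu> = UNIV"
    "bmeas borel f \<Longrightarrow> (\<integral>x. f x \<partial>\<mu>) = (\<integral>x. symz f x \<partial>\<mu>)"
  using assms sets_eq_imp_space_eq[of \<mu> borel] by (auto simp: balanced_def)

lemma balanced_integrable: "balanced \<mu> \<Longrightarrow> bmeas borel f \<Longrightarrow> integrable \<mu> f"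
  using bmeas_integrable[of \<mu> f] bmeas_cong_sets[of \<mu> borel f] balancedD(1,2)[of \<mu>] by blast

section \<open>Convolutions and noisy edges\<close>

definition llr_conv :: "ereal measure \<Rightarrow> ereal measure \<Rightarrow> ereal measure" where
  "llr_conv \<alpha> \<beta> = distr (\<alpha> \<Otimes>\<^sub>M \<beta>) borel (\<lambda>(x, y). x + y)"

definition edge :: "real \<Rightarrow> ereal measure \<Rightarrow> ereal measure" where
  "edge \<delta> \<mu> = distr (\<mu> \<Otimes>\<^sub>M measure_pmf (sign_pmf \<delta>)) borel (\<lambda>(x, z). z * F_BSC \<delta> x)"

lemma measurable_sign_F_BSC[measurable]: "(\<lambda>(x, z). z * F_BSC \<delta> x) \<in> borel_measurable (borel \<Otimes>\<^sub>M measure_pmf (sign_pmf \<delta>))"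
proof -
  have [measurable]: "(\<lambda>z. z) \<in> borel_measurable (measure_pmf (sign_pmf \<delta>))" by simp
  have [measurable]: "snd \<in> borel_measurable (borel \<Otimes>\<^sub>M measure_pmf (sign_pmf \<delta>))" 
    by (rule measurable_compose[OF measurable_snd]) measurable
  have [measurable]: "fst \<in> borel_measurable (borel \<Otimes>\<^sub>M measure_pmf (sign_pmf \<delta>))" 
    by (rule measurable_fst)
  show ?thesis unfolding case_prod_beta by measurable
qed

lemma measurable_llr_conv [measurable]:
  assumes [measurable_cong]: "sets \<alpha> = sets borel" "sets \<beta> = sets borel"
  shows "(\<lambda>(x, y). x + y :: ereal) \<in> borel_measurable (\<alpha> \<Otimes>\<^sub>M \<beta>)"
  by measurable

lemma integral_llr_conv:
  assumes "prob_space \<alpha>" "prob_space \<beta>"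
    and [measurable_cong]: "sets \<alpha> = sets borel" "sets \<beta> = sets borel" and f: "bmeas borel f"
  shows "(\<integral>x. f x \<partial>llr_conv \<alpha> \<beta>) = (\<integral>x. \<integral>y. f (x + y) \<partial>\<beta> \<partial>\<alpha>)"
proof -
  have "bmeas (\<alpha> \<Otimes>\<^sub>M \<beta>) (\<lambda>z. f ((\<lambda>(x, y). x + y) z))"
    by (rule bmeas_compose[OF f]) measurable
  from integral_pair[OF assms(1,2) this] show ?thesis
    unfolding llr_conv_def using bmeas_measurable[OF f] by (subst integral_distr) (simp_all add: case_prod_beta)
qed

lemma bmeas_symz2:
  assumes h: "bmeas (borel \<Otimes>\<^sub>M borel) h"
  shows "bmeas (borel \<Otimes>\<^sub>M borel) (\<lambda>z. symz (\<lambda>y. h (fst z, y)) (snd z))"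
    "bmeas (borel \<Otimes>\<^sub>M borel) (\<lambda>z. symz (\<lambda>x. h (x, snd z)) (fst z))"
proof -
  have [measurable]: "h \<in> borel_measurable (borel \<Otimes>\<^sub>M borel)" using h by (rule bmeas_measurable)
  have *: "bmeas (borel \<Otimes>\<^sub>M borel) (\<lambda>z. h (f z, g z))"
    if [measurable]: "f \<in> measurable (borel \<Otimes>\<^sub>M borel) borel" "g \<in> measurable (borel \<Otimes>\<^sub>M borel) borel"
    for f g :: "ereal \<times> ereal \<Rightarrow> ereal"
    by (rule bmeas_compose[OF h]) measurable
  show "bmeas (borel \<Otimes>\<^sub>M borel) (\<lambda>z. symz (\<lambda>y. h (fst z, y)) (snd z))"
    "bmeas (borel \<Otimes>\<^sub>M borel) (\<lambda>z. symz (\<lambda>x. h (x, snd z)) (fst z))"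
    unfolding symz_def by (intro bmeas_intros *; measurable)+
qed

lemma bmeas_section:
  assumes h: "bmeas (borel \<Otimes>\<^sub>M borel) h"
  shows "bmeas borel (\<lambda>y. h (x, y))" "bmeas borel (\<lambda>x. h (x, y))"
  using h by (auto intro!: bmeas_compose[OF h])

lemma bmeas_integral_balanced:
  assumes "balanced \<beta>" and h: "bmeas (borel \<Otimes>\<^sub>M borel) h"
  shows "bmeas borel (\<lambda>x. \<integral>y. h (x, y) \<partial>\<beta>)"
proof -
  have "bmeas (borel \<Otimes>\<^sub>M \<beta>) h"
    using h balancedD(2)[OF assms(1)] by (subst bmeas_cong_sets[of _ "borel \<Otimes>\<^sub>M borel"]) (auto intro: sets_pair_measure_cong)
  then show ?thesis by (rule bmeas_integral[OF balancedD(1)[OF assms(1)]])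
qed

text \<open>Reduces equality of double integrals under balanced laws to pointwise identities between
  symmetrized integrands.\<close>

lemma balanced_integral2:
  assumes \<alpha>: "balanced \<alpha>" and \<beta>: "balanced \<beta>" and h: "bmeas (borel \<Otimes>\<^sub>M borel) h"
  shows "(\<integral>x. \<integral>y. h (x, y) \<partial>\<beta> \<partial>\<alpha>) = (\<integral>x. \<integral>y. symz (\<lambda>x. symz (\<lambda>y. h (x, y)) y) x \<partial>\<beta> \<partial>\<alpha>)"
proof -
  define g where "g z = symz (\<lambda>y. h (fst z, y)) (snd z)" for z
  have g: "bmeas (borel \<Otimes>\<^sub>M borel) g" unfolding g_def by (rule bmeas_symz2(1)[OF h])
  have int: "integrable \<beta> (\<lambda>y. g (x, y))" for x
    by (rule balanced_integrable[OF \<beta> bmeas_section(1)[OF g]])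
  have "(\<integral>x. \<integral>y. h (x, y) \<partial>\<beta> \<partial>\<alpha>) = (\<integral>x. \<integral>y. g (x, y) \<partial>\<beta> \<partial>\<alpha>)"
    using balancedD(4)[OF \<beta> bmeas_section(1)[OF h]] by (simp add: g_def)
  also have "\<dots> = (\<integral>x. symz (\<lambda>x. \<integral>y. g (x, y) \<partial>\<beta>) x \<partial>\<alpha>)"
    by (rule balancedD(4)[OF \<alpha> bmeas_integral_balanced[OF \<beta> g]])
  also have "\<dots> = (\<integral>x. \<integral>y. symz (\<lambda>x. g (x, y)) x \<partial>\<beta> \<partial>\<alpha>)"
    unfolding symz_def using int by simp
  finally show ?thesis by (simp add: g_def)
qed

lemma bmeas_plus:
  fixes f :: "ereal \<Rightarrow> real"
  assumes "bmeas borel f"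
  shows "bmeas (borel \<Otimes>\<^sub>M borel) (\<lambda>z. f (fst z + snd z))"
  by (rule bmeas_compose[OF assms]) measurable

text \<open>Once the signs of x and y carry their conditional weights, the sign of the sum already
  has its correct conditional law, so a further symmetrization changes nothing. The computation
  rests on (1 + a b) * \<open>bias (x + y)\<close> = a + b, which is free of denominators.\<close>

lemma symz_symz_add:
  fixes x y :: ereal and f :: "ereal \<Rightarrow> real"
  shows
  "symz (\<lambda>x. symz (\<lambda>y. symz f (x + y)) y) x = symz (\<lambda>x. symz (\<lambda>y. f (x + y)) y) x"
proof -
  have split4: "(((1 + a * b + (a + b)) / 2 * P + (1 + a * b - (a + b)) / 2 * P') +
      ((1 - a * b + (a - b)) / 2 * M + (1 - a * b - (a - b)) / 2 * M')) / 2 =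
      (1 + a) / 2 * ((1 + b) / 2 * P + (1 - b) / 2 * M) + (1 - a) / 2 * ((1 + b) / 2 * M' + (1 - b) / 2 * P')"
    for a b P P' M M' :: real
    unfolding divide_inverse by (simp only: ring_distribs) algebra
  have split2: "(1 + a) / 2 * ((1 + b) / 2 * P + (1 - b) / 2 * M) + (1 - a) / 2 * ((1 + b) / 2 * M + (1 - b) / 2 * P) =
      ((1 + a * b) * P + (1 - a * b) * M) / 2" for a b P M :: real
    by (simp add: algebra_simps add_divide_distrib diff_divide_distrib)
  have weight: "k * ((1 + d) / 2 * P + (1 - d) / 2 * P') = (k + k * d) / 2 * P + (k - k * d) / 2 * P'"
    for k d P P' :: real
    by (simp add: algebra_simps add_divide_distrib diff_divide_distrib)
  have l: "symz g x = g \<infinity>" if "x = \<infinity> \<or> x = -\<infinity>" for g x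
    using that by auto
  show ?thesis
  proof (cases "(x = \<infinity> \<or> x = -\<infinity>) \<or> (y = \<infinity> \<or> y = -\<infinity>)")
    case True
    then show ?thesis
    proof
      assume "x = \<infinity> \<or> x = -\<infinity>"
      then show ?thesis by (simp add: l)
    next
      assume "y = \<infinity> \<or> y = -\<infinity>"
      then show ?thesis by (simp add: l[of y])
    qed
  next
    case False
    then obtain r q where rq: "x = ereal r" "y = ereal q" by (metis ereal_cases uminus_ereal.simps(2))
    define a b where "a = bias x" "b = bias y"
    have ab: "\<bar>a\<bar> < 1" "\<bar>b\<bar> < 1" using abs_bias_less_1 by (auto simp: a_b_def rq simp del: bias.simps)
    have pos: "1 + a * b > 0" "1 - a * b > 0"
      using mult_abs_less_1[of a b] ab by auto
    define p m where "p = ereal (r + q)" and "m = ereal (r - q)"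
    have pm: "x + y = p" "- x + - y = - p" "x + - y = m" "- x + y = - m"
      by (auto simp: rq p_def m_def)
    have "bias p = (a + b) / (1 + a * b)"
      using bias_add[of r q] by (simp add: p_def a_b_def rq del: bias.simps)
    moreover have "bias m = (a - b) / (1 - a * b)"
      using bias_add[of r "- q"] bias_uminus[of "ereal q"] by (simp add: m_def a_b_def rq del: bias.simps bias_uminus)
    ultimately have bp: "(1 + a * b) * bias p = a + b" "(1 - a * b) * bias m = a - b"
      using pos by auto
    have sp: "symz f (- p) = symz f p" "symz f (- m) = symz f m" by (simp_all add: symz_even)
    have "((1 + a * b) * symz f p + (1 - a * b) * symz f m) / 2 =
       (1 + a) / 2 * ((1 + b) / 2 * f p + (1 - b) / 2 * f m) +
       (1 - a) / 2 * ((1 + b) / 2 * f (- m) + (1 - b) / 2 * f (- p))"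
    proof -
      have "(1 + a * b) * symz f p = ((1 + a * b) + (1 + a * b) * bias p) / 2 * f p +
         ((1 + a * b) - (1 + a * b) * bias p) / 2 * f (- p)"
        "(1 - a * b) * symz f m = ((1 - a * b) + (1 - a * b) * bias m) / 2 * f m +
         ((1 - a * b) - (1 - a * b) * bias m) / 2 * f (- m)"
        unfolding symz_def by (rule weight)+
      then show ?thesis unfolding bp by (simp only: split4)
    qed
    moreover have "symz (\<lambda>x. symz (\<lambda>y. g (x + y)) y) x =
       (1 + a) / 2 * ((1 + b) / 2 * g p + (1 - b) / 2 * g m) +
       (1 - a) / 2 * ((1 + b) / 2 * g (- m) + (1 - b) / 2 * g (- p))" for g
      unfolding symz_def pm a_b_def[symmetric] by simp
    ultimately show ?thesis by (simp only: sp split2)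
  qed
qed

lemma balanced_llr_conv:
  assumes \<alpha>: "balanced \<alpha>" and \<beta>: "balanced \<beta>"
  shows "balanced (llr_conv \<alpha> \<beta>)"
proof -
  note D = balancedD[OF \<alpha>] balancedD[OF \<beta>]
  have "prob_space (llr_conv \<alpha> \<beta>)"
    unfolding llr_conv_def
    by (intro prob_space.prob_space_distr prob_space_pair D measurable_llr_conv)
  moreover have "(\<integral>x. f x \<partial>llr_conv \<alpha> \<beta>) = (\<integral>x. symz f x \<partial>llr_conv \<alpha> \<beta>)" if f: "bmeas borel f" for f
    using balanced_integral2[OF \<alpha> \<beta> bmeas_plus[OF f]]
      balanced_integral2[OF \<alpha> \<beta> bmeas_plus[OF bmeas_symz[OF f]]]
    by (simp add: integral_llr_conv[OF D(1,5,2,6)] f bmeas_symz symz_symz_add)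
  ultimately show ?thesis by (simp add: balanced_def llr_conv_def)
qed

lemma integral_edge:
  assumes "0 \<le> \<delta>" "\<delta> \<le> 1" "prob_space \<mu>" and [measurable_cong]: "sets \<mu> = sets borel" and f: "bmeas borel f"
  shows "(\<integral>x. f x \<partial>edge \<delta> \<mu>) = (\<integral>x. (1 - \<delta>) * f (F_BSC \<delta> x) + \<delta> * f (- F_BSC \<delta> x) \<partial>\<mu>)"
proof -
  have [measurable]: "(\<lambda>(x, z). z * F_BSC \<delta> x) \<in> borel_measurable (\<mu> \<Otimes>\<^sub>M measure_pmf (sign_pmf \<delta>))"
    by measurable
  have "bmeas (\<mu> \<Otimes>\<^sub>M measure_pmf (sign_pmf \<delta>)) (\<lambda>z. f ((\<lambda>(x, z). z * F_BSC \<delta> x) z))"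
    by (rule bmeas_compose[OF f]) measurable
  from integral_pair[OF assms(3) measure_pmf.prob_space_axioms this]
  have "(\<integral>x. f x \<partial>edge \<delta> \<mu>) = (\<integral>x. \<integral>z. f (z * F_BSC \<delta> x) \<partial>measure_pmf (sign_pmf \<delta>) \<partial>\<mu>)"
    unfolding edge_def using bmeas_measurable[OF f] by (subst integral_distr) (simp_all add: case_prod_beta)
  then show ?thesis using assms(1,2)
    by (simp add: sign_pmf_def add.commute mult.commute)
qed

text \<open>A flip with probability \<delta> turns the sign weights (1 +- m) / 2 into (1 +- (1 - 2
  \<delta>) m) / 2, and these are exactly the weights belonging to
  \<open>F_BSC \<delta> x\<close>.\<close>

lemma balanced_edge:
  assumes \<delta>: "0 \<le> \<delta>" "\<delta> \<le> 1" and \<mu>: "balanced \<mu>"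
  shows "balanced (edge \<delta> \<mu>)"
proof -
  note D = balancedD[OF \<mu>]
  have [measurable_cong]: "sets \<mu> = sets borel" by (rule D)
  have "(\<lambda>(x, z). z * F_BSC \<delta> x) \<in> borel_measurable (\<mu> \<Otimes>\<^sub>M measure_pmf (sign_pmf \<delta>))"
    by measurable
  then have "prob_space (edge \<delta> \<mu>)"
    unfolding edge_def
    by (intro prob_space.prob_space_distr prob_space_pair D measure_pmf.prob_space_axioms)
  moreover have "(\<integral>x. f x \<partial>edge \<delta> \<mu>) = (\<integral>x. symz f x \<partial>edge \<delta> \<mu>)" if f: "bmeas borel f" for f
  proof -
    have "bmeas borel (\<lambda>x. (1 - \<delta>) * f (F_BSC \<delta> x) + \<delta> * f (- F_BSC \<delta> x))"
      by (intro bmeas_intros bmeas_compose[OF f]) measurable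
    from D(4)[OF this] have "(\<integral>x. f x \<partial>edge \<delta> \<mu>) =
        (\<integral>x. symz (\<lambda>x. (1 - \<delta>) * f (F_BSC \<delta> x) + \<delta> * f (- F_BSC \<delta> x)) x \<partial>\<mu>)"
      by (simp add: integral_edge \<delta> D f)
    also have "\<dots> = (\<integral>x. (1 - \<delta>) * symz f (F_BSC \<delta> x) + \<delta> * symz f (- F_BSC \<delta> x) \<partial>\<mu>)"
    proof (rule Bochner_Integration.integral_cong[OF refl])
      fix x
      have "(1 - \<delta>) * symz f (F_BSC \<delta> x) + \<delta> * symz f (- F_BSC \<delta> x) = symz f (F_BSC \<delta> x)"
        by (simp add: symz_even algebra_simps)
      moreover have "symz (\<lambda>x. (1 - \<delta>) * f (F_BSC \<delta> x) + \<delta> * f (- F_BSC \<delta> x)) x = symz f (F_BSC \<delta> x)"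
        using \<delta> by (simp add: symz_def bias_F_BSC F_BSC_uminus) (simp add: field_simps)
      ultimately show "symz (\<lambda>x. (1 - \<delta>) * f (F_BSC \<delta> x) + \<delta> * f (- F_BSC \<delta> x)) x =
         (1 - \<delta>) * symz f (F_BSC \<delta> x) + \<delta> * symz f (- F_BSC \<delta> x)" by simp
    qed
    also have "\<dots> = (\<integral>x. symz f x \<partial>edge \<delta> \<mu>)"
      by (simp add: integral_edge \<delta> D f bmeas_symz)
    finally show ?thesis .
  qed
  ultimately show ?thesis by (simp add: balanced_def edge_def)
qed

lemma balanced_return:
  assumes "x = 0 \<or> x = \<infinity>"
  shows "balanced (return borel x)"
  using assms
  by (auto simp: balanced_def prob_space_return integral_return bmeas_measurable bmeas_symz)
     (auto simp: symz_def)

text \<open>On finite values, symmetry says that the law is the image under negation of its own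
  exp(-r)-weighted version. As exp(-r) (1 + m) = 1 - m, this exchanges f(x) and f(-x) under the
  weight (1 - m) / 2.\<close>

lemma balanced_of_symmetric:
  assumes sym: "symmetric_distribution \<mu>"
  shows "balanced \<mu>"
proof -
  from sym have P: "prob_space \<mu>" and S [measurable_cong]: "sets \<mu> = sets borel"
    and N: "emeasure \<mu> {-\<infinity>} = 0"
    and E: "\<And>E. E \<in> sets borel \<Longrightarrow> E \<subseteq> {-\<infinity><..<\<infinity>} \<Longrightarrow>
      emeasure \<mu> E = (\<integral>\<^sup>+ r. ennreal (exp (- real_of_ereal r)) * indicator E (- r) \<partial>\<mu>)"
    by (auto simp: symmetric_distribution_def llr_distribution_def)
  interpret prob_space \<mu> by fact
  have sp: "space \<mu> = UNIV" using sets_eq_imp_space_eq[OF S] by simp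
  let ?R = "{-\<infinity><..<\<infinity>} :: ereal set"
  \<comment> \<open>\<open>real_of_ereal\<close> is 0 at both infinities, so without the indicator
    the weight would be 1 there.\<close>
  define w where "w r = exp (- real_of_ereal r) * indicator ?R r" for r
  have [measurable]: "w \<in> borel_measurable borel" unfolding w_def by measurable
  have w0: "0 \<le> w r" for r by (simp add: w_def)
  have "density \<mu> (indicator ?R) = distr (density \<mu> w) borel uminus"
  proof (rule measure_eqI)
    fix A assume "A \<in> sets (density \<mu> (indicator ?R))"
    then have A [measurable]: "A \<in> sets borel" using S by simp
    have "emeasure (density \<mu> (indicator ?R)) A = emeasure \<mu> (A \<inter> ?R)"
      using A by (subst emeasure_density) (auto simp: S nn_integral_indicator[symmetric] indicator_inter_arith mult.commute simp del: nn_integral_indicator)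
    also have "\<dots> = (\<integral>\<^sup>+ r. ennreal (exp (- real_of_ereal r)) * indicator (A \<inter> ?R) (- r) \<partial>\<mu>)"
      using A by (intro E) auto
    also have "\<dots> = (\<integral>\<^sup>+ r. ennreal (w r) * indicator (uminus -` A \<inter> space \<mu>) r \<partial>\<mu>)"
    proof (intro nn_integral_cong)
      fix r show "ennreal (exp (- real_of_ereal r)) * indicator (A \<inter> ?R) (- r) =
          ennreal (w r) * indicator (uminus -` A \<inter> space \<mu>) r"
        by (cases r) (auto simp: w_def sp split: split_indicator)
    qed
    also have "\<dots> = emeasure (distr (density \<mu> w) borel uminus) A"
      using A by (simp add: emeasure_distr emeasure_density measurable_sets[where A = borel])
    finally show "emeasure (density \<mu> (indicator ?R)) A = emeasure (distr (density \<mu> w) borel uminus) A" .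
  qed (simp add: S)
  then have swap: "(\<integral>x. indicator ?R x * f x \<partial>\<mu>) = (\<integral>x. w x * f (- x) \<partial>\<mu>)"
    if [measurable]: "f \<in> borel_measurable borel" for f :: "ereal \<Rightarrow> real"
  proof -
    have "(\<integral>x. f x \<partial>density \<mu> (indicator ?R)) = (\<integral>x. indicator ?R x * f x \<partial>\<mu>)"
      using integral_density[of f \<mu> "indicator ?R"]
      by (simp add: ennreal_indicator)
    moreover have "(\<integral>x. f x \<partial>distr (density \<mu> w) borel uminus) = (\<integral>x. w x * f (- x) \<partial>\<mu>)"
      by (subst integral_distr) (simp_all add: integral_density w0)
    ultimately show ?thesis using \<open>density \<mu> (indicator ?R) = _\<close> by simp
  qed
  have "(\<integral>x. f x \<partial>\<mu>) = (\<integral>x. symz f x \<partial>\<mu>)" if f: "bmeas borel f" for f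
  proof -
    have f' [measurable]: "f \<in> borel_measurable borel" using f by (rule bmeas_measurable)
    note int = bmeas_integrable[OF P, unfolded bmeas_cong_sets[OF S]]
    \<comment> \<open>The weight (1 - m) / 2 vanishes at \<infinity>, so an atom there contributes
      nothing, and -\<infinity> is a null set. This allows the restriction to finite values to be
      dropped.\<close>
    define g where "g x = f x * ((1 - bias x) / 2)" for x
    have g: "bmeas borel g" unfolding g_def by (intro bmeas_intros f) auto
    have "w x * g (- x) = indicator ?R x * (f (- x) * ((1 - bias x) / 2))" for x
    proof (cases x)
      case (real r)
      have "exp (- r) * (1 + (exp r - 1) / (exp r + 1)) = 1 - (exp r - 1) / (exp r + 1)"
        by (simp add: exp_minus divide_simps)
      then have e: "exp (- r) * (1 + bias x) = 1 - bias x" by (simp add: real)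
      have "w x = exp (- r)" "indicator ?R x = (1::real)" by (simp_all add: w_def real)
      moreover have "g (- x) = f (- x) * ((1 + bias x) / 2)" unfolding g_def bias_uminus by simp
      moreover have "exp (- r) * (f (- x) * ((1 + bias x) / 2)) = f (- x) * ((1 - bias x) / 2)"
        using e by (metis mult.left_commute times_divide_eq_right)
      ultimately show ?thesis by (simp only: mult_1)
    qed (simp_all add: w_def)
    then have step: "(\<integral>x. indicator ?R x * g x \<partial>\<mu>) = (\<integral>x. indicator ?R x * (f (- x) * ((1 - bias x) / 2)) \<partial>\<mu>)"
      using swap[OF bmeas_measurable[OF g]] by (simp only:)
    have AE: "AE x in \<mu>. x \<noteq> -\<infinity>"
      using N by (intro AE_I[where N = "{-\<infinity>}"]) (auto simp: S)
    have drop: "(\<integral>x. indicator ?R x * h x \<partial>\<mu>) = (\<integral>x. h x \<partial>\<mu>)"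
      if [measurable]: "h \<in> borel_measurable borel" and "h \<infinity> = 0" for h :: "ereal \<Rightarrow> real"
    proof (rule integral_cong_AE)
      show "AE x in \<mu>. indicator ?R x * h x = h x"
        using AE by eventually_elim (use that in \<open>auto split: split_indicator\<close>)
    qed measurable
    have "(\<integral>x. indicator ?R x * g x \<partial>\<mu>) = (\<integral>x. g x \<partial>\<mu>)"
      by (rule drop) (auto simp: g_def)
    moreover have "(\<integral>x. indicator ?R x * (f (- x) * ((1 - bias x) / 2)) \<partial>\<mu>) =
        (\<integral>x. f (- x) * ((1 - bias x) / 2) \<partial>\<mu>)"
      by (rule drop) auto
    ultimately have eq: "(\<integral>x. f x * ((1 - bias x) / 2) \<partial>\<mu>) = (\<integral>x. f (- x) * ((1 - bias x) / 2) \<partial>\<mu>)"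
      using step by (simp only: g_def)
    have i1: "integrable \<mu> (\<lambda>x. f x * ((1 + bias x) / 2))" "integrable \<mu> (\<lambda>x. f x * ((1 - bias x) / 2))"
      "integrable \<mu> (\<lambda>x. f (- x) * ((1 - bias x) / 2))"
      by (intro int bmeas_intros f bmeas_compose[OF f]; simp)+
    have "(\<integral>x. f x \<partial>\<mu>) = (\<integral>x. f x * ((1 + bias x) / 2) + f x * ((1 - bias x) / 2) \<partial>\<mu>)"
      by (intro Bochner_Integration.integral_cong) (auto simp: field_simps)
    also have "\<dots> = (\<integral>x. f x * ((1 + bias x) / 2) + f (- x) * ((1 - bias x) / 2) \<partial>\<mu>)"
      unfolding Bochner_Integration.integral_add[OF i1(1,2)] Bochner_Integration.integral_add[OF i1(1,3)] eq ..
    finally show ?thesis by (simp add: symz_def mult.commute)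
  qed
  then show ?thesis by (simp add: balanced_def P S)
qed

section \<open>The order defined by chi-square means\<close>

definition chi_mean :: "ereal measure \<Rightarrow> real \<Rightarrow> real" where
  "chi_mean \<mu> t = (\<integral>x. chi t (bias x) \<partial>\<mu>)"

lemma borel_measurable_chi [measurable]:
  assumes [measurable]: "f \<in> borel_measurable M"
  shows "(\<lambda>x. chi t (f x)) \<in> borel_measurable M"
  unfolding chi_def by measurable

lemma borel_measurable_chi2 [measurable]:
  assumes [measurable]: "f \<in> borel_measurable M" "g \<in> borel_measurable M"
  shows "(\<lambda>x. chi2 s t (f x) (g x)) \<in> borel_measurable M"
  unfolding chi2_def by measurable

lemma abs_bias_scale_le_1: "\<bar>s\<bar> \<le> 1 \<Longrightarrow> \<bar>s * bias x\<bar> \<le> 1"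
  by (simp add: abs_mult abs_bias_le_1 mult_le_one)

lemma abs_chi_le: "\<bar>t\<bar> < 1 \<Longrightarrow> \<bar>a\<bar> \<le> 1 \<Longrightarrow> \<bar>chi t a\<bar> \<le> 1 / (1 - t\<^sup>2)"
  using chi_le chi_nonneg by (simp add: abs_of_nonneg)

lemma bmeas_chi:
  assumes "\<bar>t\<bar> < 1" "\<bar>s\<bar> \<le> 1"
  shows "bmeas borel (\<lambda>x. chi t (s * bias x))"
  by (rule bmeasI[where B = "1 / (1 - t\<^sup>2)"]) (auto intro!: abs_chi_le assms abs_bias_scale_le_1)

lemmas bmeas_chi1 = bmeas_chi[where s = 1, simplified]

lemma abs_add_div_le_1:
  fixes a b :: real
  assumes "\<bar>a\<bar> \<le> 1" "\<bar>b\<bar> \<le> 1"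
  shows "\<bar>(a + b) / (1 + a * b)\<bar> \<le> 1"
proof -
  have "0 \<le> (1 - a) * (1 - b)" "0 \<le> (1 + a) * (1 + b)" using assms by auto
  then have "\<bar>a + b\<bar> \<le> \<bar>1 + a * b\<bar>" by (auto simp: algebra_simps abs_if)
  then show ?thesis by (simp add: divide_le_eq_1)
qed

lemma abs_chi2_le:
  assumes "\<bar>a\<bar> \<le> 1" "\<bar>b\<bar> \<le> 1" "\<bar>t\<bar> < 1" "\<bar>s\<bar> \<le> 1"
  shows "\<bar>chi2 s t a b\<bar> \<le> 1 / (1 - t\<^sup>2)"
proof -
  have ab: "\<bar>a * b\<bar> \<le> 1" using assms by (simp add: abs_mult mult_le_one)
  have *: "\<bar>chi t (s * ((a + b) / (1 + a * b)))\<bar> \<le> 1 / (1 - t\<^sup>2)" if "\<bar>b\<bar> \<le> 1" for b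
    using abs_add_div_le_1[OF assms(1) that] assms
    by (intro abs_chi_le) (auto simp: abs_mult mult_le_one simp del: times_divide_eq_right)
  define K where "K = 1 / (1 - t\<^sup>2)"
  have "\<bar>p * c\<bar> \<le> p * K" if "0 \<le> p" "\<bar>c\<bar> \<le> K" for p c
    using that by (simp add: abs_mult mult_left_mono)
  then have "\<bar>(1 + a * b) * chi t (s * ((a + b) / (1 + a * b)))\<bar> \<le> (1 + a * b) * K"
    "\<bar>(1 - a * b) * chi t (s * ((a - b) / (1 - a * b)))\<bar> \<le> (1 - a * b) * K"
    using *[of b] *[of "- b"] ab assms unfolding K_def[symmetric] by (auto simp: abs_le_iff)
  moreover have "\<bar>(u + v) / 2\<bar> \<le> K" if "\<bar>u\<bar> \<le> (1 + p) * K" "\<bar>v\<bar> \<le> (1 - p) * K" for u v p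
    using that by (auto simp: abs_le_iff algebra_simps)
  ultimately show ?thesis
    unfolding chi2_def K_def[symmetric] by blast
qed

lemma bmeas_chi2:
  assumes "\<bar>t\<bar> < 1" "\<bar>r\<bar> \<le> 1" "\<bar>u\<bar> \<le> 1" "\<bar>v\<bar> \<le> 1"
  shows "bmeas (borel \<Otimes>\<^sub>M borel) (\<lambda>z. chi2 r t (u * bias (fst z)) (v * bias (snd z)))"
  by (rule bmeasI[where B = "1 / (1 - t\<^sup>2)"]) (auto intro!: abs_chi2_le assms abs_bias_scale_le_1)

text \<open>An even function does not distinguish x + y from its negative, so the four sign choices
  merge into two, with weights (1 + a b) / 2 and (1 - a b) / 2.\<close>

lemma symz_chi_add:
  fixes x y :: ereal
  shows "symz (\<lambda>x. symz (\<lambda>y. chi t (s * bias (x + y))) y) x = chi2 s t (bias x) (bias y)"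
proof -
  let ?f = "\<lambda>x. chi t (s * bias x)"
  \<comment> \<open>With one perfect observation the combined bias is +-1 before scaling by s. A
    quotient 0 / 0 can occur, but only with weight 0.\<close>
  have edge: "chi2 s t a b = chi t s" if "a = 1 \<or> a = -1" for a b
  proof -
    have "((1 + b) * k + (1 - b) * k) / 2 = k" for k by (simp add: field_simps)
    moreover have "(1 + b) * chi t (s * ((1 + b) / (1 + b))) = (1 + b) * chi t s"
      "(1 - b) * chi t (s * ((1 - b) / (1 - b))) = (1 - b) * chi t s"
      by (cases "1 + b = 0"; simp) (cases "1 - b = 0"; simp)
    moreover have "chi2 s t a b = chi2 s t 1 b"
      using that by (auto simp: chi2_minus_left)
    ultimately show ?thesis by (simp only: chi2_def mult_1)
  qed
  have l: "symz g x = g \<infinity>" if "x = \<infinity> \<or> x = -\<infinity>" for g x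
    using that by auto
  have const: "symz (\<lambda>_. c) x = c" for c x by (rule symz_of_even) simp
  show ?thesis
  proof (cases "(x = \<infinity> \<or> x = -\<infinity>) \<or> (y = \<infinity> \<or> y = -\<infinity>)")
    case True
    then show ?thesis
    proof
      assume x: "x = \<infinity> \<or> x = -\<infinity>"
      then have "chi2 s t (bias x) (bias y) = chi t s" by (intro edge) auto
      then show ?thesis using x by (simp add: l const)
    next
      assume y: "y = \<infinity> \<or> y = -\<infinity>"
      then have "chi2 s t (bias x) (bias y) = chi t s" by (subst chi2_swap, intro edge) auto
      then show ?thesis using y by (simp add: l[of y] const)
    qed
  next
    case False
    then obtain r q where rq: "x = ereal r" "y = ereal q" by (metis ereal_cases)
    define a b where "a = bias x" "b = bias y"
    define p m where "p = ereal (r + q)" and "m = ereal (r - q)"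
    have pm: "x + y = p" "- x + - y = - p" "x + - y = m" "- x + y = - m"
      by (auto simp: rq p_def m_def)
    have split2: "(1 + a) / 2 * ((1 + b) / 2 * P + (1 - b) / 2 * M) + (1 - a) / 2 * ((1 + b) / 2 * M + (1 - b) / 2 * P) =
        ((1 + a * b) * P + (1 - a * b) * M) / 2" for a b P M :: real
      by (simp add: algebra_simps add_divide_distrib diff_divide_distrib)
    have bp: "bias p = (a + b) / (1 + a * b)"
      using bias_add[of r q] by (simp add: p_def a_b_def rq del: bias.simps)
    have bm: "bias m = (a - b) / (1 - a * b)"
      using bias_add[of r "- q"] bias_uminus[of "ereal q"] by (simp add: m_def a_b_def rq del: bias.simps bias_uminus)
    have ev: "?f (- z) = ?f z" for z by simp
    have "symz (\<lambda>x. symz (\<lambda>y. ?f (x + y)) y) x =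
       (1 + a) / 2 * ((1 + b) / 2 * ?f p + (1 - b) / 2 * ?f m) +
       (1 - a) / 2 * ((1 + b) / 2 * ?f (- m) + (1 - b) / 2 * ?f (- p))"
      unfolding symz_def pm a_b_def[symmetric] by simp
    also have "\<dots> = ((1 + a * b) * ?f p + (1 - a * b) * ?f m) / 2"
      unfolding ev by (rule split2)
    also have "\<dots> = chi2 s t a b" unfolding chi2_def bp bm ..
    finally show ?thesis by (simp only: a_b_def)
  qed
qed

lemma integral_chi_llr_conv:
  assumes \<alpha>: "balanced \<alpha>" and \<beta>: "balanced \<beta>" and t: "\<bar>t\<bar> < 1" and s: "\<bar>s\<bar> \<le> 1"
  shows "(\<integral>x. chi t (s * bias x) \<partial>llr_conv \<alpha> \<beta>) = (\<integral>x. \<integral>y. chi2 s t (bias x) (bias y) \<partial>\<beta> \<partial>\<alpha>)"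
  using balanced_integral2[OF \<alpha> \<beta> bmeas_plus[OF bmeas_chi[OF t s]]]
  by (simp add: integral_llr_conv[OF balancedD(1)[OF \<alpha>] balancedD(1)[OF \<beta>] balancedD(2)[OF \<alpha>] balancedD(2)[OF \<beta>]]
      bmeas_chi t s symz_chi_add)

lemmas chi_mean_llr_conv = integral_chi_llr_conv[where s = 1, simplified, folded chi_mean_def]

lemma integral_edge_even:
  assumes "0 \<le> \<delta>" "\<delta> \<le> 1" "balanced \<mu>" "bmeas borel (\<lambda>x. h (bias x))" "\<And>a. h (- a) = h a"
  shows "(\<integral>x. h (bias x) \<partial>edge \<delta> \<mu>) = (\<integral>x. h ((1 - 2 * \<delta>) * bias x) \<partial>\<mu>)"
proof -
  have "(1 - \<delta>) * k + \<delta> * k = k" for k by (simp add: algebra_simps)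
  then show ?thesis
    using integral_edge[OF assms(1,2) balancedD(1,2)[OF assms(3)] assms(4)] assms(5)
    by (simp add: bias_F_BSC[OF assms(1,2)])
qed

lemma chi_mean_edge_eq_integral:
  assumes "0 \<le> \<delta>" "\<delta> \<le> 1" "balanced \<mu>" "\<bar>t\<bar> < 1"
  shows "chi_mean (edge \<delta> \<mu>) t = (\<integral>x. chi t ((1 - 2 * \<delta>) * bias x) \<partial>\<mu>)"
  unfolding chi_mean_def by (rule integral_edge_even) (simp_all add: assms bmeas_chi1)

lemma chi_mean_edge:
  assumes "0 \<le> \<delta>" "\<delta> \<le> 1" "balanced \<mu>" "\<bar>t\<bar> < 1"
  shows "chi_mean (edge \<delta> \<mu>) t = (1 - 2 * \<delta>)\<^sup>2 * chi_mean \<mu> ((1 - 2 * \<delta>) * t)"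
  unfolding chi_mean_edge_eq_integral[OF assms] by (simp add: chi_scale chi_mean_def)

lemma integral2_swap:
  assumes \<alpha>: "balanced \<alpha>" and \<beta>: "balanced \<beta>" and h: "bmeas (borel \<Otimes>\<^sub>M borel) h"
  shows "(\<integral>x. \<integral>y. h (x, y) \<partial>\<beta> \<partial>\<alpha>) = (\<integral>y. \<integral>x. h (x, y) \<partial>\<alpha> \<partial>\<beta>)"
proof -
  interpret A: prob_space \<alpha> by (rule balancedD(1)[OF \<alpha>])
  interpret B: prob_space \<beta> by (rule balancedD(1)[OF \<beta>])
  interpret pair_prob_space \<alpha> \<beta> ..
  have "bmeas (\<alpha> \<Otimes>\<^sub>M \<beta>) h"
    using h balancedD(2)[OF \<alpha>] balancedD(2)[OF \<beta>]
    by (subst bmeas_cong_sets[of _ "borel \<Otimes>\<^sub>M borel"]) (auto intro: sets_pair_measure_cong)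
  then have "integrable (\<alpha> \<Otimes>\<^sub>M \<beta>) (\<lambda>(x, y). h (x, y))"
    using bmeas_integrable[OF prob_space_pair[OF balancedD(1)[OF \<alpha>] balancedD(1)[OF \<beta>]]] by simp
  from Fubini_integral[OF this] show ?thesis by simp
qed

lemma chi_mean_llr_conv_commute:
  assumes "balanced \<alpha>" "balanced \<beta>" "\<bar>t\<bar> < 1"
  shows "chi_mean (llr_conv \<alpha> \<beta>) t = chi_mean (llr_conv \<beta> \<alpha>) t"
proof -
  have "(\<integral>y. \<integral>x. chi2 1 t (bias x) (bias y) \<partial>\<alpha> \<partial>\<beta>) = (\<integral>y. \<integral>x. chi2 1 t (bias y) (bias x) \<partial>\<alpha> \<partial>\<beta>)"
    by (intro Bochner_Integration.integral_cong refl chi2_swap)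
  then show ?thesis
    using integral2_swap[OF assms(1,2) bmeas_chi2[OF assms(3), of 1 1 1]]
    by (simp add: chi_mean_llr_conv assms)
qed

lemma balanced_integral_mono2:
  assumes \<alpha>: "balanced \<alpha>" and \<beta>: "balanced \<beta>"
    and h: "bmeas (borel \<Otimes>\<^sub>M borel) h" and g: "bmeas (borel \<Otimes>\<^sub>M borel) g"
    and le: "\<And>x y. h (x, y) \<le> g (x, y)"
  shows "(\<integral>x. \<integral>y. h (x, y) \<partial>\<beta> \<partial>\<alpha>) \<le> (\<integral>x. \<integral>y. g (x, y) \<partial>\<beta> \<partial>\<alpha>)"
  by (intro integral_mono balanced_integrable[OF \<alpha>] balanced_integrable[OF \<beta>] bmeas_section
      bmeas_integral_balanced \<beta> h g le)

lemma integral_chi2_left: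
  assumes \<alpha>: "balanced \<alpha>" and t: "\<bar>t\<bar> < 1" and b: "\<bar>b\<bar> \<le> 1"
  shows "(\<integral>x. chi2 1 t (bias x) b \<partial>\<alpha>) = chi t b + (1 - b\<^sup>2)\<^sup>2 / 2 *
     (chi_mean \<alpha> ((t + b) / (1 + t * b)) / (1 + t * b) ^ 3 +
      chi_mean \<alpha> ((t - b) / (1 - t * b)) / (1 - t * b) ^ 3)"
proof -
  interpret prob_space \<alpha> by (rule balancedD(1)[OF \<alpha>])
  note expand = chi2_expand[OF abs_bias_le_1 b t]
  show ?thesis
  proof (cases "\<bar>b\<bar> = 1")
    \<comment> \<open>Here the tilted parameters have modulus 1, where integrability could fail.
      They are multiplied by 0, so no integral has to be split.\<close>
    case True
    then have "b\<^sup>2 = 1" by (metis power2_abs power_one)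
    then show ?thesis by (simp add: expand prob_space)
  next
    case False
    then have "\<bar>b\<bar> < 1" using b by simp
    note tilt = tilt_bounds[OF t this]
    have "integrable \<alpha> (\<lambda>x. chi ((t + b) / (1 + t * b)) (bias x))"
      "integrable \<alpha> (\<lambda>x. chi ((t - b) / (1 - t * b)) (bias x))"
      by (intro balanced_integrable[OF \<alpha>] bmeas_chi1 tilt)+
    then show ?thesis by (simp add: expand prob_space chi_mean_def)
  qed
qed

text \<open>With the second observation fixed, the mean over the first is a constant plus
  nonnegative multiples of \<open>chi_mean\<close> at tilted parameters. The tilt explains why the
  hypothesis is required for all |t| < 1 even if the conclusion is wanted for a single t.\<close>

lemma chi_mean_llr_conv_mono_left:
  assumes "balanced \<alpha>" "balanced \<beta>" "balanced \<gamma>" "\<bar>t\<bar> < 1"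
    and le: "\<And>t. \<bar>t\<bar> < 1 \<Longrightarrow> chi_mean \<alpha> t \<le> chi_mean \<beta> t"
  shows "chi_mean (llr_conv \<alpha> \<gamma>) t \<le> chi_mean (llr_conv \<beta> \<gamma>) t"
proof -
  have h: "bmeas (borel \<Otimes>\<^sub>M borel) (\<lambda>z. chi2 1 t (bias (snd z)) (bias (fst z)))"
    by (rule bmeasI[where B = "1 / (1 - t\<^sup>2)"]) (auto intro!: abs_chi2_le assms abs_bias_le_1)
  have e: "chi_mean (llr_conv \<nu> \<gamma>) t = (\<integral>y. \<integral>x. chi2 1 t (bias x) (bias y) \<partial>\<nu> \<partial>\<gamma>)"
    if "balanced \<nu>" for \<nu>
    using integral2_swap[OF that assms(3) bmeas_chi2[OF assms(4), of 1 1 1]]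
    by (simp add: chi_mean_llr_conv that assms)
  have int: "integrable \<gamma> (\<lambda>y. \<integral>x. chi2 1 t (bias x) (bias y) \<partial>\<nu>)" if "balanced \<nu>" for \<nu>
    using bmeas_integral_balanced[OF that h] by (intro balanced_integrable assms) simp
  have "(\<integral>x. chi2 1 t (bias x) (bias y) \<partial>\<alpha>) \<le> (\<integral>x. chi2 1 t (bias x) (bias y) \<partial>\<beta>)" for y
  proof (cases "\<bar>bias y\<bar> = 1")
    case True
    then have "(bias y)\<^sup>2 = 1" by (metis power2_abs power_one)
    then show ?thesis by (simp add: integral_chi2_left assms abs_bias_le_1)
  next
    case False
    then have "\<bar>bias y\<bar> < 1" using abs_bias_le_1[of y] by simp
    note tilt = tilt_bounds[OF assms(4) this]
    show ?thesis
      unfolding integral_chi2_left[OF assms(1,4) abs_bias_le_1] integral_chi2_left[OF assms(2,4) abs_bias_le_1]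
      using tilt by (intro add_left_mono mult_left_mono add_mono divide_right_mono le) auto
  qed
  then show ?thesis using assms int by (simp add: e integral_mono)
qed

lemma chi_mean_llr_conv_mono:
  assumes bal: "balanced \<alpha>" "balanced \<beta>" "balanced \<alpha>'" "balanced \<beta>'" and t: "\<bar>t\<bar> < 1"
    and le: "\<And>t. \<bar>t\<bar> < 1 \<Longrightarrow> chi_mean \<alpha> t \<le> chi_mean \<beta> t" "\<And>t. \<bar>t\<bar> < 1 \<Longrightarrow> chi_mean \<alpha>' t \<le> chi_mean \<beta>' t"
  shows "chi_mean (llr_conv \<alpha> \<alpha>') t \<le> chi_mean (llr_conv \<beta> \<beta>') t"
proof -
  have "chi_mean (llr_conv \<alpha> \<alpha>') t \<le> chi_mean (llr_conv \<beta> \<alpha>') t"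
    by (intro chi_mean_llr_conv_mono_left bal t le)
  also have "\<dots> = chi_mean (llr_conv \<alpha>' \<beta>) t" by (intro chi_mean_llr_conv_commute bal t)
  also have "\<dots> \<le> chi_mean (llr_conv \<beta>' \<beta>) t" by (intro chi_mean_llr_conv_mono_left bal t le)
  also have "\<dots> = chi_mean (llr_conv \<beta> \<beta>') t" by (intro chi_mean_llr_conv_commute bal t)
  finally show ?thesis .
qed

lemma chi_mean_edge_mono:
  assumes "0 \<le> \<delta>" "\<delta> \<le> 1" "balanced \<alpha>" "balanced \<beta>" and t: "\<bar>t\<bar> < 1"
    and le: "\<And>t. \<bar>t\<bar> < 1 \<Longrightarrow> chi_mean \<alpha> t \<le> chi_mean \<beta> t"
  shows "chi_mean (edge \<delta> \<alpha>) t \<le> chi_mean (edge \<delta> \<beta>) t"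
proof -
  have "\<bar>(1 - 2 * \<delta>) * t\<bar> < 1"
    using mult_abs_less_1[OF t, of "1 - 2 * \<delta>"] assms(1,2) by (simp add: mult.commute abs_le_iff)
  then show ?thesis using le by (simp add: chi_mean_edge assms mult_left_mono)
qed

section \<open>Degraded laws and the gain from a clean survey\<close>

definition degrade :: "real \<Rightarrow> ereal measure \<Rightarrow> ereal measure" where
  "degrade s \<mu> = edge ((1 - s) / 2) \<mu>"

lemma balanced_degrade: "0 \<le> s \<Longrightarrow> s \<le> 1 \<Longrightarrow> balanced \<mu> \<Longrightarrow> balanced (degrade s \<mu>)"
  unfolding degrade_def by (rule balanced_edge) auto

lemma chi_mean_degrade:
  assumes "0 \<le> s" "s \<le> 1" "balanced \<mu>" "\<bar>t\<bar> < 1"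
  shows "chi_mean (degrade s \<mu>) t = s\<^sup>2 * chi_mean \<mu> (s * t)"
    "chi_mean (degrade s \<mu>) t = (\<integral>x. chi t (s * bias x) \<partial>\<mu>)"
  unfolding degrade_def
  using chi_mean_edge[of "(1 - s) / 2" \<mu> t] chi_mean_edge_eq_integral[of "(1 - s) / 2" \<mu> t] assms
  by (simp_all add: field_simps)

lemma integral_degrade_even:
  assumes "0 \<le> s" "s \<le> 1" "balanced \<mu>" "bmeas borel (\<lambda>x. h (bias x))" "\<And>a. h (- a) = h a"
  shows "(\<integral>x. h (bias x) \<partial>degrade s \<mu>) = (\<integral>x. h (s * bias x) \<partial>\<mu>)"
proof -
  have "1 - 2 * ((1 - s) / 2) = s" by (simp add: field_simps)
  then show ?thesis
    unfolding degrade_def using integral_edge_even[of "(1 - s) / 2" \<mu> h] assms by simp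
qed

text \<open>Both channels only rescale the bias, so they commute as far as these means can
  see.\<close>

lemma chi_mean_degrade_edge:
  assumes "0 \<le> s" "s \<le> 1" "0 \<le> \<delta>" "\<delta> \<le> 1" "balanced \<mu>" "\<bar>t\<bar> < 1"
  shows "chi_mean (degrade s (edge \<delta> \<mu>)) t = chi_mean (edge \<delta> (degrade s \<mu>)) t"
proof -
  have "\<bar>s * t\<bar> < 1" "\<bar>(1 - 2 * \<delta>) * t\<bar> < 1"
    using mult_abs_less_1[OF assms(6), of "1 - 2 * \<delta>"] mult_abs_less_1[OF assms(6), of s] assms
    by (auto simp: mult.commute abs_le_iff)
  then show ?thesis
    using assms by (simp add: chi_mean_degrade(1) chi_mean_edge balanced_degrade balanced_edge mult_ac)
qed

lemma chi_mean_llr_conv_degrade_left: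
  assumes s: "0 \<le> s" "s \<le> 1" and \<alpha>: "balanced \<alpha>" and \<beta>: "balanced \<beta>" and t: "\<bar>t\<bar> < 1"
  shows "chi_mean (llr_conv (degrade s \<alpha>) \<beta>) t = (\<integral>x. \<integral>y. chi2 1 t (s * bias x) (bias y) \<partial>\<beta> \<partial>\<alpha>)"
proof -
  have "bmeas (borel \<Otimes>\<^sub>M borel) (\<lambda>z. chi2 1 t (bias (fst z)) (bias (snd z)))"
    using bmeas_chi2[OF t, of 1 1 1] by simp
  from bmeas_integral_balanced[OF \<beta> this]
  have "bmeas borel (\<lambda>x. \<integral>y. chi2 1 t (bias x) (bias y) \<partial>\<beta>)" by simp
  from integral_degrade_even[OF s \<alpha> this] show ?thesis
    by (simp add: chi_mean_llr_conv balanced_degrade s \<alpha> \<beta> t chi2_minus_left)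
qed

lemma chi_mean_llr_conv_degrade:
  assumes s: "0 \<le> s" "s \<le> 1" and \<alpha>: "balanced \<alpha>" and \<beta>: "balanced \<beta>" and t: "\<bar>t\<bar> < 1"
  shows "chi_mean (llr_conv (degrade s \<alpha>) (degrade s \<beta>)) t =
    (\<integral>x. \<integral>y. chi2 1 t (s * bias x) (s * bias y) \<partial>\<beta> \<partial>\<alpha>)"
proof -
  have "(\<integral>y. chi2 1 t (s * bias x) (bias y) \<partial>degrade s \<beta>) = (\<integral>y. chi2 1 t (s * bias x) (s * bias y) \<partial>\<beta>)" for x
  proof (rule integral_degrade_even[OF s \<beta>])
    show "bmeas borel (\<lambda>y. chi2 1 t (s * bias x) (bias y))"
      using bmeas_section(1)[OF bmeas_chi2[OF t, of 1 s 1], of x] s by simp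
  qed (simp add: chi2_minus)
  then show ?thesis
    by (simp add: chi_mean_llr_conv_degrade_left s \<alpha> \<beta> t balanced_degrade)
qed

lemma chi_mean_degrade_llr_conv_le:
  assumes s: "0 \<le> s" "s \<le> 1" and \<alpha>: "balanced \<alpha>" and \<beta>: "balanced \<beta>" and t: "\<bar>t\<bar> < 1"
  shows "chi_mean (degrade s (llr_conv \<alpha> \<beta>)) t \<le> chi_mean (llr_conv (degrade s \<alpha>) (degrade s \<beta>)) t"
  using balanced_integral_mono2[OF \<alpha> \<beta> bmeas_chi2[OF t, of s 1 1] bmeas_chi2[OF t, of 1 s s]]
  by (simp add: chi_mean_degrade(2) balanced_llr_conv integral_chi_llr_conv chi_mean_llr_conv_degrade
      s \<alpha> \<beta> t chi2_scale_le abs_bias_le_1)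

text \<open>The bridge is the law with noise on both observations: splitting the common noise into
  independent noises does not lower the mean (\<open>chi2_scale_le\<close>), and cleaning the survey
  then yields \<open>chi2_gain\<close>. The gain is uniform in the first bias, so only the mean
  square of the survey remains.\<close>

lemma chi_mean_degrade_survey:
  assumes s: "0 \<le> s" "s < 1" and \<alpha>: "balanced \<alpha>" and \<beta>: "balanced \<beta>" and t: "\<bar>t\<bar> < 1"
  shows "chi_mean (degrade s (llr_conv \<alpha> \<beta>)) t + (1 - s\<^sup>2) ^ 3 / 2 * (\<integral>y. (bias y)\<^sup>2 \<partial>\<beta>)
    \<le> chi_mean (llr_conv (degrade s \<alpha>) \<beta>) t"
proof -
  interpret A: prob_space \<alpha> by (rule balancedD(1)[OF \<alpha>])
  let ?c = "(1 - s\<^sup>2) ^ 3 / 2"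
  have b2: "bmeas borel (\<lambda>y. ?c * (bias y)\<^sup>2)"
    unfolding power2_eq_square[of "bias _"] by (intro bmeas_intros) auto
  have b2': "bmeas (borel \<Otimes>\<^sub>M borel) (\<lambda>z :: ereal \<times> ereal. ?c * (bias (snd z))\<^sup>2)"
    using bmeas_compose[OF b2 measurable_snd] by simp
  have h: "bmeas (borel \<Otimes>\<^sub>M borel) (\<lambda>z. chi2 s t (bias (fst z)) (bias (snd z)))"
    using bmeas_chi2[OF t, of s 1 1] s by simp
  have g: "bmeas (borel \<Otimes>\<^sub>M borel) (\<lambda>z. chi2 1 t (s * bias (fst z)) (bias (snd z)))"
    using bmeas_chi2[OF t, of 1 s 1] s by simp
  have int: "integrable \<beta> (\<lambda>y. chi2 s t (bias x) (bias y))" for x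
    using balanced_integrable[OF \<beta> bmeas_section(1)[OF h, of x]] by simp
  have int': "integrable \<alpha> (\<lambda>x. \<integral>y. chi2 s t (bias x) (bias y) \<partial>\<beta>)"
    using balanced_integrable[OF \<alpha> bmeas_integral_balanced[OF \<beta> h]] by simp
  have pw: "chi2 s t (bias x) (bias y) + ?c * (bias y)\<^sup>2 \<le> chi2 1 t (s * bias x) (bias y)" for x y
  proof -
    have "\<bar>s * bias x\<bar> \<le> s" using s abs_bias_le_1[of x] by (simp add: abs_mult mult_left_le)
    then show ?thesis
      using chi2_scale_le[of "bias x" "bias y" t s] chi2_gain[of t "bias y" s "s * bias x"] s t
      by (simp add: abs_bias_le_1)
  qed
  have "chi_mean (degrade s (llr_conv \<alpha> \<beta>)) t + ?c * (\<integral>y. (bias y)\<^sup>2 \<partial>\<beta>) =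
      (\<integral>x. \<integral>y. chi2 s t (bias x) (bias y) + ?c * (bias y)\<^sup>2 \<partial>\<beta> \<partial>\<alpha>)"
    using s int int' balanced_integrable[OF \<beta> b2]
    by (simp add: chi_mean_degrade(2) balanced_llr_conv integral_chi_llr_conv \<alpha> \<beta> t A.prob_space)
  also have "\<dots> \<le> chi_mean (llr_conv (degrade s \<alpha>) \<beta>) t"
    using balanced_integral_mono2[OF \<alpha> \<beta> bmeas_add[OF h b2'] g] pw s
    by (simp add: chi_mean_llr_conv_degrade_left \<alpha> \<beta> t)
  finally show ?thesis .
qed

lemma chi_mean_degrade_diff_le:
  assumes "0 \<le> s" "s \<le> s'" "s' \<le> 1" and \<mu>: "balanced \<mu>" and "\<bar>t\<bar> \<le> r" "r < 1"
  shows "chi_mean (degrade s' \<mu>) t - chi_mean (degrade s \<mu>) t \<le> (s'\<^sup>2 - s\<^sup>2) / (1 - r\<^sup>2 * s'\<^sup>2)\<^sup>2"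
proof -
  interpret prob_space \<mu> by (rule balancedD(1)[OF \<mu>])
  have t: "\<bar>t\<bar> < 1" using assms by simp
  have int: "integrable \<mu> (\<lambda>x. chi t (s' * bias x))" "integrable \<mu> (\<lambda>x. chi t (s * bias x))"
    using assms by (auto intro!: balanced_integrable[OF \<mu>] bmeas_chi t)
  have "(\<integral>x. chi t (s' * bias x) - chi t (s * bias x) \<partial>\<mu>) \<le> (\<integral>x. (s'\<^sup>2 - s\<^sup>2) / (1 - r\<^sup>2 * s'\<^sup>2)\<^sup>2 \<partial>\<mu>)"
    using int assms by (intro integral_mono chi_scale_diff_le abs_bias_le_1) auto
  then show ?thesis using int assms t by (simp add: chi_mean_degrade(2) prob_space)
qed

text \<open>The exponent 5 collects the factor \<open>(1 - s\<^sup>2)\<^sup>3\<close> gained from the survey and the factor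
  \<open>(1 - s'\<^sup>2)\<^sup>2\<close> lost when \<open>s\<close> is increased to \<open>s'\<close>.\<close>

lemma chi_mean_degrade_improve:
  assumes s: "0 \<le> s" "s < 1" "0 \<le> s'" and s': "s'\<^sup>2 = s\<^sup>2 + (\<integral>y. (bias y)\<^sup>2 \<partial>\<beta>) / 8 * (1 - s\<^sup>2) ^ 5"
    and \<alpha>: "balanced \<alpha>" and \<beta>: "balanced \<beta>" and t: "\<bar>t\<bar> < 1"
  shows "s \<le> s'" "s' < 1"
    "chi_mean (degrade s' (llr_conv \<alpha> \<beta>)) t \<le> chi_mean (llr_conv (degrade s \<alpha>) \<beta>) t"
proof -
  interpret B: prob_space \<beta> by (rule balancedD(1)[OF \<beta>])
  define b where "b = (\<integral>y. (bias y)\<^sup>2 \<partial>\<beta>)"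
  have b: "0 \<le> b" "b \<le> 1"
  proof -
    have "bmeas borel (\<lambda>y. (bias y)\<^sup>2)" unfolding power2_eq_square by (intro bmeas_intros) auto
    then have int: "integrable \<beta> (\<lambda>y. (bias y)\<^sup>2)" by (rule balanced_integrable[OF \<beta>])
    show "0 \<le> b" by (simp add: b_def)
    have "b \<le> (\<integral>y. 1 \<partial>\<beta>)"
      unfolding b_def using int by (intro integral_mono) (auto simp: abs_square_le_1 abs_bias_le_1)
    then show "b \<le> 1" by (simp add: B.prob_space)
  qed
  define e where "e = 1 - s\<^sup>2"
  have e: "0 < e" "e \<le> 1" using s by (auto simp: e_def abs_square_less_1)
  have e5: "b / 8 * e ^ 5 \<le> e / 8" "0 \<le> b / 8 * e ^ 5"
  proof -
    have "e ^ 5 \<le> e ^ 1" using e by (intro power_decreasing) auto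
    then have "b * e ^ 5 \<le> 1 * e" using b e by (intro mult_mono) auto
    then show "b / 8 * e ^ 5 \<le> e / 8" by simp
  qed (use b e in simp)
  have sq: "s'\<^sup>2 = s\<^sup>2 + b / 8 * e ^ 5" using s' by (simp add: b_def e_def)
  \<comment> \<open>Raising s uses up at most half of 1 - s^2, hence the denominator (e / 2)^2
    below. The constant 8 = 2 * 4 makes the resulting loss equal to the gain e^3 / 2 * b.\<close>
  have e': "e / 2 \<le> 1 - s'\<^sup>2" using sq e5 e by (simp add: e_def)
  show ss: "s \<le> s'" using sq e5 s by (intro power2_le_imp_le[of s s']) auto
  have "s'\<^sup>2 < 1" using e' e by linarith
  then show s1: "s' < 1" using s by (simp add: abs_square_less_1)
  have bal: "balanced (llr_conv \<alpha> \<beta>)" by (intro balanced_llr_conv \<alpha> \<beta>)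
  have "(s'\<^sup>2 - s\<^sup>2) / (1 - t\<^sup>2 * s'\<^sup>2)\<^sup>2 \<le> (b / 8 * e ^ 5) / (e / 2)\<^sup>2"
  proof (rule frac_le)
    have "t\<^sup>2 * s'\<^sup>2 \<le> s'\<^sup>2" using t by (simp add: mult_left_le_one_le abs_square_le_1)
    then show "(e / 2)\<^sup>2 \<le> (1 - t\<^sup>2 * s'\<^sup>2)\<^sup>2" using e' e by (intro power_mono) auto
  qed (use e e5 sq in auto)
  also have "\<dots> = e ^ 3 / 2 * b" using e by (simp add: power_divide field_simps eval_nat_numeral)
  finally have "(s'\<^sup>2 - s\<^sup>2) / (1 - t\<^sup>2 * s'\<^sup>2)\<^sup>2 \<le> e ^ 3 / 2 * b" .
  then have "chi_mean (degrade s' (llr_conv \<alpha> \<beta>)) t - chi_mean (degrade s (llr_conv \<alpha> \<beta>)) t \<le> e ^ 3 / 2 * b"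
    using chi_mean_degrade_diff_le[OF s(1) ss less_imp_le[OF s1] bal order_refl t, unfolded power2_abs]
    by (rule order_trans[rotated])
  moreover have "chi_mean (degrade s (llr_conv \<alpha> \<beta>)) t + e ^ 3 / 2 * b \<le> chi_mean (llr_conv (degrade s \<alpha>) \<beta>) t"
    unfolding e_def b_def by (rule chi_mean_degrade_survey) (use s \<alpha> \<beta> t in auto)
  ultimately show "chi_mean (degrade s' (llr_conv \<alpha> \<beta>)) t \<le> chi_mean (llr_conv (degrade s \<alpha>) \<beta>) t"
    by linarith
qed

section \<open>The law of the BP sum\<close>

primrec conv_pow :: "ereal measure \<Rightarrow> nat \<Rightarrow> ereal measure" where
  "conv_pow \<kappa> 0 = return borel 0"
| "conv_pow \<kappa> (Suc d) = llr_conv (conv_pow \<kappa> d) \<kappa>"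

lemma balanced_conv_pow: "balanced \<kappa> \<Longrightarrow> balanced (conv_pow \<kappa> d)"
  by (induction d) (auto intro: balanced_return balanced_llr_conv)

text \<open>Overwriting one coordinate of an i.i.d. sequence by a fresh independent draw does not
  change the law of the sequence. This isolates a single summand without reindexing.\<close>

lemma nn_integral_PiM_upd:
  fixes n :: nat
  assumes M: "prob_space M" and [measurable]: "g \<in> borel_measurable (\<Pi>\<^sub>M u\<in>UNIV. M)"
  shows "(\<integral>\<^sup>+w. g w \<partial>(\<Pi>\<^sub>M u\<in>UNIV. M)) = (\<integral>\<^sup>+y. (\<integral>\<^sup>+w. g (w(n := y)) \<partial>(\<Pi>\<^sub>M u\<in>UNIV. M)) \<partial>M)"
proof -
  interpret M: prob_space M by fact
  interpret P: product_prob_space "\<lambda>_::nat. M" UNIV by unfold_locales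
  let ?P = "\<Pi>\<^sub>M u\<in>(UNIV::nat set). M"
  have eq: "distr (M \<Otimes>\<^sub>M ?P) ?P (\<lambda>(x, X). X(n := x)) = ?P"
    using distr_pair_PiM_eq_PiM[of UNIV "\<lambda>_. M" n] M by simp
  have [measurable]: "(\<lambda>(x, X). X(n := x)) \<in> measurable (M \<Otimes>\<^sub>M ?P) ?P"
    unfolding case_prod_beta by (rule measurable_fun_upd[where J = UNIV]) (auto simp: insert_absorb)
  have "(\<integral>\<^sup>+w. g w \<partial>?P) = (\<integral>\<^sup>+w. g ((\<lambda>(x, X). X(n := x)) w) \<partial>(M \<Otimes>\<^sub>M ?P))"
    by (subst eq[symmetric], subst nn_integral_distr) auto
  also have "\<dots> = (\<integral>\<^sup>+y. (\<integral>\<^sup>+w. g (w(n := y)) \<partial>?P) \<partial>M)"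
    by (subst P.nn_integral_fst[symmetric]) (auto simp: case_prod_beta)
  finally show ?thesis .
qed

text \<open>\<open>measure_pmf\<close> carries the discrete sigma-algebra, which is finer than the
  Borel one.\<close>

lemma measurable_pmf_borel:
  "h \<in> measurable M (measure_pmf p) \<Longrightarrow> h \<in> borel_measurable M"
  by (rule measurable_compose[where N = "measure_pmf p" and g = "\<lambda>x. x"]) auto

lemma measurable_BP_partial_sum:
  fixes d :: nat
  assumes g: "g \<in> measurable M (\<Pi>\<^sub>M u\<in>UNIV. borel)" and h: "h \<in> measurable M (\<Pi>\<^sub>M u\<in>UNIV. measure_pmf p)"
  shows "(\<lambda>w. \<Sum>u=1..d. h w u * F_BSC \<delta> (g w u)) \<in> borel_measurable M"
proof -
  have [measurable]: "(\<lambda>w. h w u) \<in> borel_measurable M" for u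
    by (rule measurable_pmf_borel, rule measurable_compose[OF h]) measurable
  have [measurable]: "(\<lambda>w. g w u) \<in> borel_measurable M" for u
    by (rule measurable_compose[OF g]) measurable
  show ?thesis by measurable
qed

lemma nn_integral_llr_conv:
  assumes "prob_space \<beta>" and [measurable_cong]: "sets \<alpha> = sets borel" "sets \<beta> = sets borel"
    and [measurable]: "f \<in> borel_measurable borel"
  shows "(\<integral>\<^sup>+x. f x \<partial>llr_conv \<alpha> \<beta>) = (\<integral>\<^sup>+x. \<integral>\<^sup>+y. f (x + y) \<partial>\<beta> \<partial>\<alpha>)"
proof -
  interpret prob_space \<beta> by fact
  show ?thesis
    unfolding llr_conv_def
    by (subst nn_integral_distr, measurable) (subst nn_integral_fst[symmetric], auto simp: case_prod_beta)
qed

lemma nn_integral_edge: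
  assumes "prob_space \<mu>" and [measurable_cong]: "sets \<mu> = sets borel"
    and [measurable]: "f \<in> borel_measurable borel"
  shows "(\<integral>\<^sup>+x. f x \<partial>edge \<delta> \<mu>) = (\<integral>\<^sup>+x. \<integral>\<^sup>+z. f (z * F_BSC \<delta> x) \<partial>measure_pmf (sign_pmf \<delta>) \<partial>\<mu>)"
proof -
  have [measurable]: "(\<lambda>(x, z). z * F_BSC \<delta> x) \<in> borel_measurable (\<mu> \<Otimes>\<^sub>M measure_pmf (sign_pmf \<delta>))"
    by measurable
  show ?thesis
    unfolding edge_def
    by (subst nn_integral_distr, measurable) (subst measure_pmf.nn_integral_fst[symmetric], auto simp: case_prod_beta)
qed

text \<open>Coordinate d + 1 of both sequences is redrawn; the first d summands do not see it, and
  the new one acts as a shift. The induction is therefore over arbitrary f. Nonnegative integrals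
  allow the changes of order without integrability conditions.\<close>

lemma nn_integral_conv_pow:
  assumes \<delta>: "0 \<le> \<delta>" "\<delta> \<le> 1" and \<mu>: "balanced \<mu>" and f: "f \<in> borel_measurable borel"
  shows "(\<integral>\<^sup>+R. \<integral>\<^sup>+Z. f (\<Sum>u=1..d. Z u * F_BSC \<delta> (R u))
      \<partial>(\<Pi>\<^sub>M u\<in>UNIV. measure_pmf (sign_pmf \<delta>)) \<partial>(\<Pi>\<^sub>M u\<in>UNIV. \<mu>)) =
    (\<integral>\<^sup>+x. f x \<partial>conv_pow (edge \<delta> \<mu>) d)"
  using f
proof (induction d arbitrary: f)
  let ?s = "measure_pmf (sign_pmf \<delta>)"
  let ?R = "\<Pi>\<^sub>M u\<in>(UNIV::nat set). \<mu>" and ?Z = "\<Pi>\<^sub>M u\<in>(UNIV::nat set). ?s"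
  interpret m: prob_space \<mu> by (rule balancedD(1)[OF \<mu>])
  interpret PR: product_prob_space "\<lambda>_::nat. \<mu>" UNIV by unfold_locales
  interpret PZ: product_prob_space "\<lambda>_::nat. ?s" UNIV
    by (intro product_prob_spaceI measure_pmf.prob_space_axioms)
  have [measurable_cong]: "sets \<mu> = sets borel" by (rule balancedD(2)[OF \<mu>])
  have setsR: "sets ?R = sets (\<Pi>\<^sub>M u\<in>(UNIV::nat set). borel)"
    by (rule sets_PiM_cong[OF refl]) (rule balancedD(2)[OF \<mu>])
  {
    case 0
    then show ?case
      by (simp add: PR.emeasure_space_1 PZ.emeasure_space_1 nn_integral_return)
  next
    case (Suc d)
    note [measurable] = Suc.prems
    let ?X = "\<lambda>R Z. \<Sum>u=1..d. Z u * F_BSC \<delta> (R u)"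
    let ?n = "Suc d"
    have bal: "balanced (edge \<delta> \<mu>)" by (rule balanced_edge[OF \<delta> \<mu>])
    have balC: "balanced (conv_pow (edge \<delta> \<mu>) d)" by (rule balanced_conv_pow[OF bal])
    interpret C: prob_space "conv_pow (edge \<delta> \<mu>) d" by (rule balancedD(1)[OF balC])
    interpret E: prob_space "edge \<delta> \<mu>" by (rule balancedD(1)[OF bal])
    interpret CE: pair_sigma_finite "conv_pow (edge \<delta> \<mu>) d" "edge \<delta> \<mu>" ..
    have [measurable_cong]: "sets (conv_pow (edge \<delta> \<mu>) d) = sets borel" "sets (edge \<delta> \<mu>) = sets borel"
      using balancedD(2)[OF bal] balancedD(2)[OF balC] by auto
    have X: "(\<lambda>w. \<Sum>u=1..k. h w u * F_BSC \<delta> (g w u)) \<in> borel_measurable M"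
      if "g \<in> measurable M ?R" "h \<in> measurable M ?Z" for g h M and k :: nat
      using that by (intro measurable_BP_partial_sum) (auto cong: measurable_cong_sets[OF refl setsR])
    have 1: "(\<lambda>R. \<integral>\<^sup>+Z. f (\<Sum>u=1..?n. Z u * F_BSC \<delta> (R u)) \<partial>?Z) \<in> borel_measurable ?R"
    proof -
      have [measurable]: "(\<lambda>w. \<Sum>u=1..?n. snd w u * F_BSC \<delta> (fst w u)) \<in> borel_measurable (?R \<Otimes>\<^sub>M ?Z)"
        by (rule X) measurable
      have "(\<lambda>w. f (\<Sum>u=1..?n. snd w u * F_BSC \<delta> (fst w u))) \<in> borel_measurable (?R \<Otimes>\<^sub>M ?Z)"
        by measurable
      from PZ.borel_measurable_nn_integral_fst[OF this] show ?thesis by simp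
    qed
    have 2: "(\<lambda>Z. f (\<Sum>u=1..?n. Z u * F_BSC \<delta> ((R(?n := r)) u))) \<in> borel_measurable ?Z" for R r
    proof -
      have [measurable]: "(\<lambda>Z. Z u) \<in> borel_measurable ?Z" for u
        by (rule measurable_pmf_borel) measurable
      show ?thesis by measurable
    qed
    have 3: "(\<lambda>(R, z). \<integral>\<^sup>+Z. f (?X R Z + z * F_BSC \<delta> r) \<partial>?Z) \<in> borel_measurable (?R \<Otimes>\<^sub>M ?s)" for r
    proof -
      have [measurable]: "(\<lambda>w. ?X (fst (fst w)) (snd w)) \<in> borel_measurable ((?R \<Otimes>\<^sub>M ?s) \<Otimes>\<^sub>M ?Z)"
        by (rule X) measurable
      have [measurable]: "(\<lambda>w. snd (fst w)) \<in> borel_measurable ((?R \<Otimes>\<^sub>M ?s) \<Otimes>\<^sub>M ?Z)"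
        by (rule measurable_pmf_borel) measurable
      have "(\<lambda>w. f (?X (fst (fst w)) (snd w) + snd (fst w) * F_BSC \<delta> r)) \<in> borel_measurable ((?R \<Otimes>\<^sub>M ?s) \<Otimes>\<^sub>M ?Z)"
        by measurable
      from PZ.borel_measurable_nn_integral_fst[OF this] show ?thesis by (simp add: case_prod_beta)
    qed
    interpret RS: pair_sigma_finite ?R ?s ..
    have split: "(\<Sum>u=1..?n. (Z(?n := z)) u * F_BSC \<delta> ((R(?n := r)) u)) = ?X R Z + z * F_BSC \<delta> r" for R Z r z
    proof -
      have "(\<Sum>u=1..d. (Z(?n := z)) u * F_BSC \<delta> ((R(?n := r)) u)) = ?X R Z"
        by (intro sum.cong) auto
      then show ?thesis by simp
    qed
    have "(\<integral>\<^sup>+R. \<integral>\<^sup>+Z. f (\<Sum>u=1..?n. Z u * F_BSC \<delta> (R u)) \<partial>?Z \<partial>?R) =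
        (\<integral>\<^sup>+r. \<integral>\<^sup>+R. \<integral>\<^sup>+Z. f (\<Sum>u=1..?n. Z u * F_BSC \<delta> ((R(?n := r)) u)) \<partial>?Z \<partial>?R \<partial>\<mu>)"
      by (rule nn_integral_PiM_upd[OF m.prob_space_axioms 1])
    also have "\<dots> = (\<integral>\<^sup>+r. \<integral>\<^sup>+R. \<integral>\<^sup>+z. \<integral>\<^sup>+Z. f (?X R Z + z * F_BSC \<delta> r) \<partial>?Z \<partial>?s \<partial>?R \<partial>\<mu>)"
      by (intro nn_integral_cong)
        (subst nn_integral_PiM_upd[OF measure_pmf.prob_space_axioms 2, of _ _ ?n], simp only: split)
    also have "\<dots> = (\<integral>\<^sup>+r. \<integral>\<^sup>+z. \<integral>\<^sup>+R. \<integral>\<^sup>+Z. f (?X R Z + z * F_BSC \<delta> r) \<partial>?Z \<partial>?R \<partial>?s \<partial>\<mu>)"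
      by (intro nn_integral_cong RS.Fubini'[symmetric] 3)
    also have "\<dots> = (\<integral>\<^sup>+r. \<integral>\<^sup>+z. \<integral>\<^sup>+x. f (x + z * F_BSC \<delta> r) \<partial>conv_pow (edge \<delta> \<mu>) d \<partial>?s \<partial>\<mu>)"
      by (intro nn_integral_cong Suc.IH) measurable
    also have "\<dots> = (\<integral>\<^sup>+y. \<integral>\<^sup>+x. f (x + y) \<partial>conv_pow (edge \<delta> \<mu>) d \<partial>edge \<delta> \<mu>)"
      by (subst nn_integral_edge[OF m.prob_space_axioms balancedD(2)[OF \<mu>]]) auto
    also have "\<dots> = (\<integral>\<^sup>+x. \<integral>\<^sup>+y. f (x + y) \<partial>edge \<delta> \<mu> \<partial>conv_pow (edge \<delta> \<mu>) d)"
      by (rule CE.Fubini') measurable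
    also have "\<dots> = (\<integral>\<^sup>+x. f x \<partial>conv_pow (edge \<delta> \<mu>) (Suc d))"
      by (simp add: nn_integral_llr_conv[OF E.prob_space_axioms balancedD(2)[OF balC] balancedD(2)[OF bal]])
    finally show ?case .
  }
qed

lemma nn_integral_BP_operator:
  assumes \<delta>: "0 \<le> \<delta>" "\<delta> \<le> 1" and \<mu>: "balanced \<mu>" and S: "balanced \<mu>\<^sub>s"
    and f: "f \<in> borel_measurable borel"
  shows "(\<integral>\<^sup>+x. f x \<partial>BP_operator P \<delta> \<mu>\<^sub>s \<mu>) =
    (\<integral>\<^sup>+d. \<integral>\<^sup>+x. f x \<partial>llr_conv (conv_pow (edge \<delta> \<mu>) d) \<mu>\<^sub>s \<partial>measure_pmf P)"
proof -
  let ?s = "measure_pmf (sign_pmf \<delta>)"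
  let ?R = "\<Pi>\<^sub>M u\<in>(UNIV::nat set). \<mu>" and ?Z = "\<Pi>\<^sub>M u\<in>(UNIV::nat set). ?s"
  interpret m: prob_space \<mu> by (rule balancedD(1)[OF \<mu>])
  interpret S: prob_space \<mu>\<^sub>s by (rule balancedD(1)[OF S])
  interpret PR: product_prob_space "\<lambda>_::nat. \<mu>" UNIV by unfold_locales
  interpret PZ: product_prob_space "\<lambda>_::nat. ?s" UNIV
    by (intro product_prob_spaceI measure_pmf.prob_space_axioms)
  interpret ZS: pair_prob_space ?Z \<mu>\<^sub>s ..
  interpret RZS: pair_prob_space ?R "?Z \<Otimes>\<^sub>M \<mu>\<^sub>s" ..
  note bal = balanced_conv_pow[OF balanced_edge[OF \<delta> \<mu>]]
  have setsS [measurable_cong]: "sets \<mu>\<^sub>s = sets borel" by (rule balancedD(2)[OF S])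
  note [measurable] = f
  define G where "G w = f ((\<lambda>(d, R, Z, S). (\<Sum>u=1..d. Z u * F_BSC \<delta> (R u)) + S) w)"
    for w :: "nat \<times> (nat \<Rightarrow> ereal) \<times> (nat \<Rightarrow> ereal) \<times> ereal"
  have G: "G \<in> borel_measurable (measure_pmf P \<Otimes>\<^sub>M ?R \<Otimes>\<^sub>M ?Z \<Otimes>\<^sub>M \<mu>\<^sub>s)"
    unfolding G_def
    by (rule measurable_compose[OF measurable_BP_sum[OF setsS balancedD(2)[OF \<mu>], unfolded BP_space_def] f])
  have G1: "(\<lambda>w. G (d, w)) \<in> borel_measurable (?R \<Otimes>\<^sub>M ?Z \<Otimes>\<^sub>M \<mu>\<^sub>s)" for d
    by (rule measurable_Pair2[OF G]) simp
  have G2: "(\<lambda>w. G (d, R, w)) \<in> borel_measurable (?Z \<Otimes>\<^sub>M \<mu>\<^sub>s)" if "R \<in> space ?R" for d R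
    by (rule measurable_Pair2[OF G1 that])
  have "(\<integral>\<^sup>+x. f x \<partial>BP_operator P \<delta> \<mu>\<^sub>s \<mu>) = (\<integral>\<^sup>+w. G w \<partial>(measure_pmf P \<Otimes>\<^sub>M ?R \<Otimes>\<^sub>M ?Z \<Otimes>\<^sub>M \<mu>\<^sub>s))"
    unfolding BP_operator_def G_def
    by (subst nn_integral_distr[OF measurable_BP_sum[OF setsS balancedD(2)[OF \<mu>]]]) (simp_all add: BP_space_def)
  also have "\<dots> = (\<integral>\<^sup>+d. \<integral>\<^sup>+R. \<integral>\<^sup>+Z. \<integral>\<^sup>+s. G (d, R, Z, s) \<partial>\<mu>\<^sub>s \<partial>?Z \<partial>?R \<partial>measure_pmf P)"
    by (subst RZS.nn_integral_fst[OF G, symmetric], subst ZS.nn_integral_fst[OF G1, symmetric])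
      (intro nn_integral_cong S.nn_integral_fst[symmetric] G2, assumption)
  also have "\<dots> = (\<integral>\<^sup>+d. \<integral>\<^sup>+x. \<integral>\<^sup>+s. f (x + s) \<partial>\<mu>\<^sub>s \<partial>conv_pow (edge \<delta> \<mu>) d \<partial>measure_pmf P)"
    unfolding G_def by (simp add: nn_integral_conv_pow[OF \<delta> \<mu>, symmetric])
  also have "\<dots> = (\<integral>\<^sup>+d. \<integral>\<^sup>+x. f x \<partial>llr_conv (conv_pow (edge \<delta> \<mu>) d) \<mu>\<^sub>s \<partial>measure_pmf P)"
    by (simp add: nn_integral_llr_conv[OF S.prob_space_axioms balancedD(2)[OF bal] setsS f])
  finally show ?thesis .
qed

lemma integral_BP_operator:
  assumes \<delta>: "0 \<le> \<delta>" "\<delta> \<le> 1" and \<mu>: "balanced \<mu>" and S: "balanced \<mu>\<^sub>s" and f: "bmeas borel f"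
  shows "prob_space (BP_operator P \<delta> \<mu>\<^sub>s \<mu>)"
    and "(\<integral>x. f x \<partial>BP_operator P \<delta> \<mu>\<^sub>s \<mu>) =
      (\<integral>d. \<integral>x. f x \<partial>llr_conv (conv_pow (edge \<delta> \<mu>) d) \<mu>\<^sub>s \<partial>measure_pmf P)"
    and "bmeas (measure_pmf P) (\<lambda>d. \<integral>x. f x \<partial>llr_conv (conv_pow (edge \<delta> \<mu>) d) \<mu>\<^sub>s)"
proof -
  let ?Q = "BP_operator P \<delta> \<mu>\<^sub>s \<mu>" and ?C = "\<lambda>d. llr_conv (conv_pow (edge \<delta> \<mu>) d) \<mu>\<^sub>s"
  have bal: "balanced (?C d)" for d
    by (intro balanced_llr_conv balanced_conv_pow balanced_edge \<delta> \<mu> S)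
  interpret C: prob_space "?C d" for d by (rule balancedD(1)[OF bal])
  have setsQ: "sets ?Q = sets borel" by (simp add: BP_operator_def)
  show Q: "prob_space ?Q"
  proof
    have "emeasure ?Q (space ?Q) = (\<integral>\<^sup>+x. 1 \<partial>?Q)" by simp
    also have "\<dots> = 1"
      by (subst nn_integral_BP_operator[OF \<delta> \<mu> S]) (simp_all add: C.emeasure_space_1 measure_pmf.emeasure_space_1[simplified])
    finally show "emeasure ?Q (space ?Q) = 1" .
  qed
  interpret Q: prob_space ?Q by fact
  from f obtain B where B: "\<And>x. \<bar>f x\<bar> \<le> B" and [measurable]: "f \<in> borel_measurable borel"
    by (auto simp: bmeas_def)
  \<comment> \<open>The shift by B makes the function nonnegative, so that the formula for
    nonnegative integrals applies; it is undone at the end because all laws involved have mass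
    1.\<close>
  define g where "g x = f x + B" for x
  have g0: "0 \<le> g x" "g x \<le> 2 * B" for x using B[of x] by (auto simp: g_def abs_le_iff)
  have g: "bmeas borel g" unfolding g_def by (intro bmeas_intros f)
  have intC: "integrable (?C d) g" "integrable (?C d) f" for d
    by (rule balanced_integrable[OF bal g], rule balanced_integrable[OF bal f])
  have intQ: "integrable ?Q f"
    using bmeas_integrable[OF Q] f bmeas_cong_sets[OF setsQ] by blast
  have B0: "0 \<le> B" using B[of 0] by (meson abs_ge_zero order_trans)
  have fC: "\<bar>\<integral>x. f x \<partial>?C d\<bar> \<le> B" for d
  proof -
    have "\<bar>\<integral>x. f x \<partial>?C d\<bar> \<le> (\<integral>x. \<bar>f x\<bar> \<partial>?C d)" by (rule integral_abs_bound)
    also have "\<dots> \<le> (\<integral>x. B \<partial>?C d)" using B intC by (intro integral_mono) auto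
    finally show ?thesis by (simp add: C.prob_space)
  qed
  then show bm: "bmeas (measure_pmf P) (\<lambda>d. \<integral>x. f x \<partial>?C d)"
    by (intro bmeasI) auto
  then have intP: "integrable (measure_pmf P) (\<lambda>d. \<integral>x. f x \<partial>?C d)"
    by (rule bmeas_integrable[OF measure_pmf.prob_space_axioms])
  have gC: "(\<integral>x. g x \<partial>?C d) = (\<integral>x. f x \<partial>?C d) + B" for d
    using intC(2)[of d] by (simp add: g_def C.prob_space)
  have "(\<integral>x. g x \<partial>?Q) = enn2real (\<integral>\<^sup>+x. ennreal (g x) \<partial>?Q)"
    using g0 bmeas_measurable[OF g] by (intro integral_eq_nn_integral) (auto simp: measurable_cong_sets[OF setsQ refl])
  also have "\<dots> = enn2real (\<integral>\<^sup>+d. \<integral>\<^sup>+x. ennreal (g x) \<partial>?C d \<partial>measure_pmf P)"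
    using bmeas_measurable[OF g] by (subst nn_integral_BP_operator[OF \<delta> \<mu> S]) auto
  also have "\<dots> = enn2real (\<integral>\<^sup>+d. ennreal (\<integral>x. g x \<partial>?C d) \<partial>measure_pmf P)"
    using g0 intC by (simp add: nn_integral_eq_integral)
  also have "\<dots> = (\<integral>d. \<integral>x. g x \<partial>?C d \<partial>measure_pmf P)"
    using g0 by (intro integral_eq_nn_integral[symmetric]) (auto intro!: integral_nonneg_AE)
  also have "\<dots> = (\<integral>d. \<integral>x. f x \<partial>?C d \<partial>measure_pmf P) + B"
    unfolding gC using intP by simp
  finally show "(\<integral>x. f x \<partial>?Q) = (\<integral>d. \<integral>x. f x \<partial>?C d \<partial>measure_pmf P)"
    using intQ by (simp add: g_def Q.prob_space)
qed

lemma balanced_BP_operator: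
  assumes \<delta>: "0 \<le> \<delta>" "\<delta> \<le> 1" and S: "balanced \<mu>\<^sub>s" and \<mu>: "balanced \<mu>"
  shows "balanced (BP_operator P \<delta> \<mu>\<^sub>s \<mu>)"
  unfolding balanced_def
proof (intro conjI allI impI)
  have bal: "balanced (llr_conv (conv_pow (edge \<delta> \<mu>) d) \<mu>\<^sub>s)" for d
    by (intro balanced_llr_conv balanced_conv_pow balanced_edge \<delta> \<mu> S)
  show "prob_space (BP_operator P \<delta> \<mu>\<^sub>s \<mu>)"
    by (rule integral_BP_operator(1)[OF \<delta> \<mu> S bmeas_const])
  fix f :: "ereal \<Rightarrow> real" assume f: "bmeas borel f"
  show "(\<integral>x. f x \<partial>BP_operator P \<delta> \<mu>\<^sub>s \<mu>) = (\<integral>x. symz f x \<partial>BP_operator P \<delta> \<mu>\<^sub>s \<mu>)"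
    using balancedD(4)[OF bal f]
    by (simp add: integral_BP_operator(2)[OF \<delta> \<mu> S f] integral_BP_operator(2)[OF \<delta> \<mu> S bmeas_symz[OF f]])
qed (simp add: BP_operator_def)

section \<open>Comparison of laws under one step of the BP operator\<close>

lemma chi_mean_nonneg: "\<bar>t\<bar> < 1 \<Longrightarrow> 0 \<le> chi_mean \<mu> t"
  unfolding chi_mean_def by (intro integral_nonneg_AE) (simp add: chi_nonneg abs_bias_le_1)

lemma chi_mean_le:
  assumes "balanced \<mu>" "\<bar>t\<bar> < 1"
  shows "chi_mean \<mu> t \<le> 1 / (1 - t\<^sup>2)"
proof -
  interpret prob_space \<mu> by (rule balancedD(1)[OF assms(1)])
  have "chi_mean \<mu> t \<le> (\<integral>x. 1 / (1 - t\<^sup>2) \<partial>\<mu>)"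
    unfolding chi_mean_def using assms
    by (intro integral_mono balanced_integrable[OF assms(1)] bmeas_chi1 bmeas_const chi_le abs_bias_le_1) auto
  then show ?thesis by (simp add: prob_space)
qed

text \<open>The operator is a mixture over d, and means are linear in the law, so comparisons valid
  for each d carry over to it. With s = 1 this also serves the law without degradation.\<close>

lemma chi_mean_BP_operator:
  assumes "0 \<le> \<delta>" "\<delta> \<le> 1" "balanced \<mu>" "balanced \<mu>\<^sub>s" "\<bar>t\<bar> < 1" "0 \<le> s" "s \<le> 1"
  shows "chi_mean (degrade s (BP_operator P \<delta> \<mu>\<^sub>s \<mu>)) t =
      (\<integral>d. chi_mean (degrade s (llr_conv (conv_pow (edge \<delta> \<mu>) d) \<mu>\<^sub>s)) t \<partial>measure_pmf P)"
    and "integrable (measure_pmf P) (\<lambda>d. chi_mean (degrade s (llr_conv (conv_pow (edge \<delta> \<mu>) d) \<mu>\<^sub>s)) t)"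
proof -
  have bal: "balanced (llr_conv (conv_pow (edge \<delta> \<mu>) d) \<mu>\<^sub>s)" for d
    by (intro balanced_llr_conv balanced_conv_pow balanced_edge assms)
  have f: "bmeas borel (\<lambda>x. chi t (s * bias x))" using assms by (intro bmeas_chi) auto
  note I = integral_BP_operator[OF assms(1-4) f, of P]
  show "chi_mean (degrade s (BP_operator P \<delta> \<mu>\<^sub>s \<mu>)) t =
      (\<integral>d. chi_mean (degrade s (llr_conv (conv_pow (edge \<delta> \<mu>) d) \<mu>\<^sub>s)) t \<partial>measure_pmf P)"
    using I(2) by (simp add: chi_mean_degrade(2) bal balanced_BP_operator assms)
  show "integrable (measure_pmf P) (\<lambda>d. chi_mean (degrade s (llr_conv (conv_pow (edge \<delta> \<mu>) d) \<mu>\<^sub>s)) t)"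
    using bmeas_integrable[OF measure_pmf.prob_space_axioms I(3)] by (simp add: chi_mean_degrade(2) bal assms)
qed

lemma chi_mean_degrade_1: "balanced \<mu> \<Longrightarrow> \<bar>t\<bar> < 1 \<Longrightarrow> chi_mean (degrade 1 \<mu>) t = chi_mean \<mu> t"
  by (simp add: chi_mean_degrade(1))

text \<open>Noise on the sum is moved to the individual branches, one at a time, and then through
  each edge down to its subtree, where the hypothesis applies. For s = 1 this is plain
  monotonicity.\<close>

lemma chi_mean_conv_pow_degrade:
  assumes \<delta>: "0 \<le> \<delta>" "\<delta> \<le> 1" and s: "0 \<le> s" "s \<le> 1" and \<alpha>: "balanced \<alpha>" and \<beta>: "balanced \<beta>"
    and le: "\<And>t. \<bar>t\<bar> < 1 \<Longrightarrow> chi_mean (degrade s \<beta>) t \<le> chi_mean \<alpha> t"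
  shows "\<bar>t\<bar> < 1 \<Longrightarrow> chi_mean (degrade s (conv_pow (edge \<delta> \<beta>) d)) t \<le> chi_mean (conv_pow (edge \<delta> \<alpha>) d) t"
proof (induction d arbitrary: t)
  case 0
  then show ?case
    by (simp add: chi_mean_degrade(2) s balanced_return) (simp add: chi_mean_def integral_return)
next
  case (Suc d)
  note bal = balanced_edge[OF \<delta> \<alpha>] balanced_edge[OF \<delta> \<beta>] balanced_conv_pow balanced_degrade[OF s]
  have "chi_mean (degrade s (conv_pow (edge \<delta> \<beta>) (Suc d))) t \<le>
      chi_mean (llr_conv (degrade s (conv_pow (edge \<delta> \<beta>) d)) (degrade s (edge \<delta> \<beta>))) t"
    using chi_mean_degrade_llr_conv_le[OF s _ _ Suc.prems] by (simp add: bal)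
  also have "\<dots> \<le> chi_mean (llr_conv (conv_pow (edge \<delta> \<alpha>) d) (edge \<delta> \<alpha>)) t"
  proof (rule chi_mean_llr_conv_mono)
    fix t :: real assume t: "\<bar>t\<bar> < 1"
    show "chi_mean (degrade s (edge \<delta> \<beta>)) t \<le> chi_mean (edge \<delta> \<alpha>) t"
      unfolding chi_mean_degrade_edge[OF s \<delta> \<beta> t]
      by (intro chi_mean_edge_mono \<delta> \<alpha> bal \<beta> t le)
  qed (auto simp: bal Suc)
  finally show ?case by simp
qed

lemma chi_mean_BP_mono:
  assumes \<delta>: "0 \<le> \<delta>" "\<delta> \<le> 1" and \<alpha>: "balanced \<alpha>" and \<beta>: "balanced \<beta>" and S: "balanced \<mu>\<^sub>s"
    and le: "\<And>t. \<bar>t\<bar> < 1 \<Longrightarrow> chi_mean \<beta> t \<le> chi_mean \<alpha> t" and t: "\<bar>t\<bar> < 1"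
  shows "chi_mean (BP_operator P \<delta> \<mu>\<^sub>s \<beta>) t \<le> chi_mean (BP_operator P \<delta> \<mu>\<^sub>s \<alpha>) t"
proof -
  note bal = balanced_conv_pow[OF balanced_edge[OF \<delta> \<alpha>]] balanced_conv_pow[OF balanced_edge[OF \<delta> \<beta>]]
  have "chi_mean (conv_pow (edge \<delta> \<beta>) d) t \<le> chi_mean (conv_pow (edge \<delta> \<alpha>) d) t" if "\<bar>t\<bar> < 1" for d t
    using chi_mean_conv_pow_degrade[OF \<delta> _ _ \<alpha> \<beta>, of 1 t d] le that
    by (simp add: chi_mean_degrade_1 bal \<beta>)
  then have "chi_mean (degrade 1 (BP_operator P \<delta> \<mu>\<^sub>s \<beta>)) t \<le> chi_mean (degrade 1 (BP_operator P \<delta> \<mu>\<^sub>s \<alpha>)) t"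
    using chi_mean_BP_operator(2)[OF \<delta> \<alpha> S t, of 1 P] chi_mean_BP_operator(2)[OF \<delta> \<beta> S t, of 1 P] t
    by (simp add: chi_mean_BP_operator(1) \<delta> \<alpha> \<beta> S)
      (intro integral_mono, auto simp: chi_mean_degrade_1 balanced_llr_conv bal S intro!: chi_mean_llr_conv_mono_left)
  then show ?thesis by (simp add: chi_mean_degrade_1 balanced_BP_operator \<delta> \<alpha> \<beta> S t)
qed

text \<open>The branches preserve the scale s, and the clean survey raises it to s'. As s' does not
  depend on the number d of branches, the inequality can be averaged over an arbitrary degree
  law.\<close>

lemma chi_mean_BP_degrade:
  assumes \<delta>: "0 \<le> \<delta>" "\<delta> \<le> 1" and \<alpha>: "balanced \<alpha>" and \<beta>: "balanced \<beta>" and S: "balanced \<mu>\<^sub>s"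
    and s: "0 \<le> s" "s < 1" "0 \<le> s'" "s'\<^sup>2 = s\<^sup>2 + (\<integral>y. (bias y)\<^sup>2 \<partial>\<mu>\<^sub>s) / 8 * (1 - s\<^sup>2) ^ 5"
    and le: "\<And>t. \<bar>t\<bar> < 1 \<Longrightarrow> chi_mean (degrade s \<beta>) t \<le> chi_mean \<alpha> t" and t: "\<bar>t\<bar> < 1"
  shows "chi_mean (degrade s' (BP_operator P \<delta> \<mu>\<^sub>s \<beta>)) t \<le> chi_mean (BP_operator P \<delta> \<mu>\<^sub>s \<alpha>) t"
proof -
  let ?A = "\<lambda>d. conv_pow (edge \<delta> \<alpha>) d" and ?B = "\<lambda>d. conv_pow (edge \<delta> \<beta>) d"
  have s1: "s \<le> 1" using s by simp
  have bal: "balanced (?A d)" "balanced (?B d)" "balanced (degrade s (?B d))" for d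
    by (intro balanced_degrade balanced_conv_pow balanced_edge \<delta> \<alpha> \<beta> s s1)+
  have s'1: "s' \<le> 1" using chi_mean_degrade_improve(2)[OF s bal(2) S t] by simp
  have step: "chi_mean (degrade s' (llr_conv (?B d) \<mu>\<^sub>s)) t \<le> chi_mean (degrade 1 (llr_conv (?A d) \<mu>\<^sub>s)) t" for d
  proof -
    have "chi_mean (degrade s' (llr_conv (?B d) \<mu>\<^sub>s)) t \<le> chi_mean (llr_conv (degrade s (?B d)) \<mu>\<^sub>s) t"
      by (rule chi_mean_degrade_improve[OF s bal(2) S t])
    also have "\<dots> \<le> chi_mean (llr_conv (?A d) \<mu>\<^sub>s) t"
      by (intro chi_mean_llr_conv_mono_left bal S t chi_mean_conv_pow_degrade \<delta> \<alpha> \<beta> s s1 le)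
    finally show ?thesis by (simp add: chi_mean_degrade_1 balanced_llr_conv bal S t)
  qed
  have "chi_mean (degrade s' (BP_operator P \<delta> \<mu>\<^sub>s \<beta>)) t \<le> chi_mean (degrade 1 (BP_operator P \<delta> \<mu>\<^sub>s \<alpha>)) t"
    unfolding chi_mean_BP_operator(1)[OF \<delta> \<beta> S t s(3) s'1]
      chi_mean_BP_operator(1)[OF \<delta> \<alpha> S t zero_le_one order_refl]
    by (intro integral_mono chi_mean_BP_operator(2) \<delta> \<alpha> \<beta> S t s(3) s'1 step) auto
  then show ?thesis by (simp add: chi_mean_degrade_1 balanced_BP_operator \<delta> \<alpha> S t)
qed

section \<open>Convergence of laws on the extended line\<close>

text \<open>The inverse of \<open>bias\<close>, continued by constants outside [-1, 1]. Being
  continuous on the whole line, it transports limit laws on the reals to the extended line.\<close>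

definition llr :: "real \<Rightarrow> ereal" where
  "llr y = (if 1 \<le> y then \<infinity> else if y \<le> -1 then -\<infinity> else ereal (ln ((1 + y) / (1 - y))))"

definition clamp1 :: "real \<Rightarrow> real" where
  "clamp1 y = max (- 1) (min 1 y)"

lemma clamp1_bias [simp]: "clamp1 (bias x) = bias x"
  using bias_bounds[of x] by (simp add: clamp1_def)

lemma abs_clamp1: "\<bar>clamp1 y\<bar> \<le> 1"
  by (simp add: clamp1_def)

lemma llr_bias [simp]: "llr (bias x) = x"
proof (cases x)
  case (real r)
  define b where "b = bias (ereal r)"
  have "\<bar>b\<bar> < 1" unfolding b_def by (rule abs_bias_less_1)
  then have "llr b = ereal (ln ((1 + b) / (1 - b)))" by (auto simp: llr_def abs_less_iff)
  moreover have "(1 + b) / (1 - b) = exp r"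
  proof -
    have "1 + b = exp r * (2 / (exp r + 1))" "1 - b = 2 / (exp r + 1)"
      by (simp_all add: b_def divide_simps)
    then show ?thesis by simp
  qed
  ultimately show ?thesis unfolding real by (simp add: b_def[symmetric] del: bias.simps)
qed (simp_all add: llr_def)

lemma bias_llr: "bias (llr y) = clamp1 y"
proof (cases "\<bar>y\<bar> < 1")
  case True
  then have "0 < (1 + y) / (1 - y)" by (simp add: abs_less_iff)
  moreover have "(u / v - 1) / (u / v + 1) = (u - v) / (u + v)" if "v > 0" "u > 0" for u v :: real
  proof -
    have "u / v - 1 = (u - v) / v" "u / v + 1 = (u + v) / v" using that by (simp_all add: field_simps)
    then show ?thesis using that by simp
  qed
  from this[of "1 - y" "1 + y"] True have "((1 + y) / (1 - y) - 1) / ((1 + y) / (1 - y) + 1) = y"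
    by (simp add: abs_less_iff)
  ultimately show ?thesis using True by (simp add: llr_def clamp1_def abs_less_iff)
qed (auto simp: llr_def clamp1_def)

lemma llr_minus: "llr (- y) = - llr y"
proof (cases "\<bar>y\<bar> < 1")
  case True
  then have "ln ((1 - y) / (1 + y)) = - ln ((1 + y) / (1 - y))" by (simp add: ln_div abs_less_iff)
  then show ?thesis using True by (simp add: llr_def abs_less_iff)
qed (auto simp: llr_def)

lemma llr_mono: "x \<le> y \<Longrightarrow> llr x \<le> llr y"
proof -
  assume "x \<le> y"
  moreover have "ln ((1 + x) / (1 - x)) \<le> ln ((1 + y) / (1 - y))" if "\<bar>x\<bar> < 1" "\<bar>y\<bar> < 1" "x \<le> y"
    using that by (subst ln_le_cancel_iff) (auto simp: abs_less_iff intro!: frac_le)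
  ultimately show ?thesis by (auto simp: llr_def abs_less_iff)
qed

lemma continuous_llr: "continuous_on UNIV llr"
proof (rule continuous_onI_mono)
  have "x \<in> range llr" for x using llr_bias[of x] by (metis rangeI)
  then show "open (range llr)" by (metis UNIV_eq_I open_UNIV)
qed (auto intro: llr_mono)

lemma borel_measurable_llr [measurable]: "llr \<in> borel_measurable borel"
  using continuous_llr by (rule borel_measurable_continuous_onI)

lemma continuous_clamp1: "continuous_on UNIV clamp1"
  unfolding clamp1_def by (intro continuous_intros)

lemma borel_measurable_clamp1 [measurable]: "clamp1 \<in> borel_measurable borel"
  unfolding clamp1_def by measurable

text \<open>Extended by \<open>0\<close> at \<open>-\<infinity>\<close>, a test function need not be continuous there, but its symmetrization
  takes the value \<open>f \<infinity>\<close> at both ends.\<close>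

lemma continuous_symz_llr:
  assumes cont: "continuous_on {-\<infinity><..} f" and B: "\<And>x. \<bar>f x\<bar> \<le> B" and f0: "f (-\<infinity>) = 0"
  shows "continuous_on UNIV (\<lambda>y. symz f (llr y))"
proof -
  have even: "symz f (llr (- y)) = symz f (llr y)" for y
    by (simp add: llr_minus symz_even)
  have top: "isCont (\<lambda>y. symz f (llr y)) y" if "y > - 1" for y
  proof -
    have llrc: "isCont llr y" for y using continuous_llr by (simp add: continuous_on_eq_continuous_at)
    have clc: "isCont clamp1 y" for y using continuous_clamp1 by (simp add: continuous_on_eq_continuous_at)
    have fc: "isCont f x" if "x \<noteq> -\<infinity>" for x
      using cont that by (simp add: continuous_on_eq_continuous_at)
    have ne: "llr y \<noteq> -\<infinity>" using that by (simp add: llr_def)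
    have c1: "isCont (\<lambda>y. (1 + clamp1 y) / 2 * f (llr y)) y"
      by (intro continuous_intros clc continuous_at_compose[OF llrc fc[OF ne], unfolded o_def]) simp_all
    have c2: "isCont (\<lambda>y. (1 - clamp1 y) / 2 * f (llr (- y))) y"
    proof (cases "y < 1")
      case True
      then have "llr (- y) \<noteq> -\<infinity>" by (simp add: llr_def)
      then have "isCont (\<lambda>y. f (llr (- y))) y"
        using isCont_o2[OF isCont_o2[OF isCont_minus[OF continuous_ident] llrc] fc] by simp
      then show ?thesis by (intro continuous_intros clc) simp_all
    next
      \<comment> \<open>At y >= 1 the factor \<open>f (llr (- y))\<close> may jump, since its
        argument reaches -\<infinity>. It is bounded, however, and its weight tends to 0.\<close>
      case False
      then have z: "(1 - clamp1 y) / 2 = 0" by (simp add: clamp1_def)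
      have "isCont (\<lambda>y. (1 - clamp1 y) / 2) y" by (intro continuous_intros clc) simp_all
      then have "((\<lambda>y. (1 - clamp1 y) / 2) \<longlongrightarrow> 0) (at y)"
        unfolding isCont_def z .
      then have "((\<lambda>y. (1 - clamp1 y) / 2 * f (llr (- y))) \<longlongrightarrow> 0) (at y)"
      proof (rule Lim_null_comparison[rotated, OF tendsto_mult_left_zero[OF tendsto_rabs_zero, where c = B]])
        show "\<forall>\<^sub>F x in at y. norm ((1 - clamp1 x) / 2 * f (llr (- x))) \<le> \<bar>(1 - clamp1 x) / 2\<bar> * B"
          using B by (intro always_eventually allI) (simp add: abs_mult mult_left_mono)
      qed
      then show ?thesis unfolding isCont_def z mult_zero_left .
    qed
    have "symz f (llr y) = (1 + clamp1 y) / 2 * f (llr y) + (1 - clamp1 y) / 2 * f (llr (- y))" for y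
      by (simp add: symz_def bias_llr llr_minus)
    then show ?thesis using continuous_add[OF c1 c2] by simp
  qed
  have "isCont (\<lambda>y. symz f (llr y)) y" for y
  proof (cases "y > -1")
    case False
    then have "isCont (\<lambda>y. symz f (llr y)) (- y)" by (intro top) auto
    from isCont_o2[OF isCont_minus[OF continuous_ident] this]
    have "isCont (\<lambda>y. symz f (llr (- y))) y" by simp
    then show ?thesis by (simp only: even)
  qed (rule top)
  then show ?thesis by (simp add: continuous_on_eq_continuous_at)
qed

text \<open>As a power series, \<open>r k T\<close> is the sum of T^j times the moment of index k +
  j. Its distance from the leading moment \<open>c k\<close> is at most T / (1 - T), uniformly in n,
  so convergence for small T makes \<open>c k\<close> Cauchy. Subtracting that moment and dividing
  by T gives the next r; the induction starts from \<open>r 1 T\<close>, which is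
  \<open>chi_mean\<close> at sqrt T.\<close>

lemma moments_convergent:
  fixes M :: "nat \<Rightarrow> ereal measure"
  assumes bal: "\<And>n. balanced (M n)"
    and conv: "\<And>t. \<bar>t\<bar> < 1 \<Longrightarrow> convergent (\<lambda>n. chi_mean (M n) t)"
  shows "convergent (\<lambda>n. \<integral>x. (bias x)\<^sup>2 ^ k \<partial>M n)"
proof -
  interpret prob_space "M n" for n by (rule balancedD(1)[OF bal])
  define b where "b x = (bias x)\<^sup>2" for x
  have [measurable]: "b \<in> borel_measurable borel" unfolding b_def by measurable
  define r where "r k T n = (\<integral>x. b x ^ k / (1 - T * b x) \<partial>M n)" for k T n
  define c where "c k n = (\<integral>x. b x ^ k \<partial>M n)" for k n
  have b2: "0 \<le> b x" "b x \<le> 1" for x using abs_bias_le_1[of x] by (auto simp: b_def abs_square_le_1)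
  have bk: "0 \<le> b x ^ k" "b x ^ k \<le> 1" for x k
    using b2 by (auto intro: power_le_one)
  have den: "1 - T \<le> 1 - T * b x" if "0 \<le> T" for T x
    using b2[of x] that by (auto simp: mult_left_le)
  have bd: "\<bar>b x ^ k / (1 - T * b x)\<bar> \<le> 1 / (1 - T)" if "0 \<le> T" "T < 1" for k T x
    using bk[of x k] den[of T x] that by (auto simp: abs_divide intro!: frac_le)
  have int: "integrable (M n) (\<lambda>x. b x ^ k / (1 - T * b x))" if "0 \<le> T" "T < 1" for k T n
    by (rule balanced_integrable[OF bal bmeasI]) (use bd that in auto)
  have intc: "integrable (M n) (\<lambda>x. b x ^ k)" for k n
    using int[of 0 n k] by simp
  have rec: "r (Suc k) T n = (r k T n - c k n) / T" if "0 < T" "T < 1" for k T n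
  proof -
    have "T * (b x ^ Suc k / (1 - T * b x)) = b x ^ k / (1 - T * b x) - b x ^ k" for x
    proof -
      have "0 < 1 - T * b x" using den[of T x] that by linarith
      then show ?thesis by (simp add: divide_simps) (simp add: algebra_simps)
    qed
    then have "(\<integral>x. T * (b x ^ Suc k / (1 - T * b x)) \<partial>M n) = r k T n - c k n"
      using int[of T n k] intc[of n k] that by (simp add: r_def c_def)
    then have "T * r (Suc k) T n = r k T n - c k n"
      by (simp only: r_def integral_mult_right_zero)
    then show ?thesis using that by (simp add: field_simps)
  qed
  have r_le: "\<bar>r k T n\<bar> \<le> 1 / (1 - T)" if "0 < T" "T < 1" for k T n
  proof -
    have "\<bar>r k T n\<bar> \<le> (\<integral>x. \<bar>b x ^ k / (1 - T * b x)\<bar> \<partial>M n)"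
      unfolding r_def by (rule integral_abs_bound)
    also have "\<dots> \<le> (\<integral>x. 1 / (1 - T) \<partial>M n)"
      using that by (intro integral_mono integrable_abs int bd) auto
    finally show ?thesis by (simp add: prob_space)
  qed
  have c_conv: "convergent (c k)" if "\<And>T. 0 < T \<Longrightarrow> T < 1 \<Longrightarrow> convergent (r k T)" for k
    unfolding Cauchy_convergent_iff[symmetric]
  proof (rule metric_CauchyI)
    fix e :: real assume e: "0 < e"
    \<comment> \<open>Chosen so that T / (1 - T) = e / 4.\<close>
    define T where "T = e / (4 + e)"
    have T: "0 < T" "T < 1" "T / (1 - T) = e / 4"
      using e by (auto simp: T_def field_simps)
    have close: "\<bar>r k T n - c k n\<bar> \<le> e / 4" for n
    proof -
      have "r k T n - c k n = T * r (Suc k) T n" using rec[OF T(1,2), of k n] T by simp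
      moreover have "T * \<bar>r (Suc k) T n\<bar> \<le> T * (1 / (1 - T))"
        using T by (intro mult_left_mono r_le) auto
      ultimately have "\<bar>r k T n - c k n\<bar> \<le> T * (1 / (1 - T))"
        using T by (simp only: abs_mult abs_of_pos)
      then show ?thesis using T by simp
    qed
    have "Cauchy (r k T)" using that[OF T(1,2)] by (simp add: Cauchy_convergent_iff)
    then obtain N where N: "\<And>m n. m \<ge> N \<Longrightarrow> n \<ge> N \<Longrightarrow> dist (r k T m) (r k T n) < e / 4"
      using e by (metis metric_CauchyD zero_less_divide_iff zero_less_numeral)
    have "dist (c k m) (c k n) < e" if "m \<ge> N" "n \<ge> N" for m n
      using N[OF that] close[of m] close[of n] e unfolding dist_real_def by (auto simp: abs_if split: if_splits)
    then show "\<exists>N. \<forall>m\<ge>N. \<forall>n\<ge>N. dist (c k m) (c k n) < e" by blast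
  qed
  have r_conv: "convergent (r (Suc k) T)" if "0 < T" "T < 1" for k T
    using that
  proof (induction k arbitrary: T)
    case 0
    have "r (Suc 0) T = (\<lambda>n. chi_mean (M n) (sqrt T))"
      using 0 by (simp add: r_def chi_mean_def chi_def b_def fun_eq_iff)
    then show ?case using conv[of "sqrt T"] 0 by simp
  next
    case (Suc k)
    have "convergent (\<lambda>n. (r (Suc k) T n - c (Suc k) n) * inverse T)"
      using Suc.IH[OF Suc.prems] c_conv[OF Suc.IH]
      by (intro convergent_mult convergent_diff convergent_const) auto
    then show ?case using rec[OF Suc.prems, of "Suc k"] by (simp add: field_class.field_divide_inverse)
  qed
  have "convergent (c k)"
  proof (cases k)
    case 0
    have "c 0 = (\<lambda>_. 1)" by (simp add: c_def prob_space fun_eq_iff)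
    then show ?thesis using 0 by (simp add: convergent_const)
  qed (use c_conv r_conv in blast)
  then show ?thesis by (simp add: c_def[abs_def] b_def)
qed

text \<open>An even continuous function on [-1, 1] is a continuous function of m^2, hence a uniform
  limit of polynomials in m^2, whose integrals converge by the moments.\<close>

lemma even_integrals_convergent:
  fixes M :: "nat \<Rightarrow> ereal measure"
  assumes bal: "\<And>n. balanced (M n)"
    and conv: "\<And>t. \<bar>t\<bar> < 1 \<Longrightarrow> convergent (\<lambda>n. chi_mean (M n) t)"
    and h: "continuous_on UNIV h" and even: "\<And>y. h (- y) = (h y :: real)"
  shows "convergent (\<lambda>n. \<integral>x. h (bias x) \<partial>M n)"
proof -
  interpret prob_space "M n" for n by (rule balancedD(1)[OF bal])
  have hb: "h (bias x) = h (sqrt ((bias x)\<^sup>2))" for x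
    by (simp add: abs_if even)
  have b2: "(bias x)\<^sup>2 \<in> {0..1}" for x using abs_bias_le_1[of x] by (auto simp: abs_square_le_1)
  have hmeas [measurable]: "h \<in> borel_measurable borel" using h by (rule borel_measurable_continuous_onI)
  have "compact (h ` {-1..1})"
    using continuous_on_subset[OF h] by (intro compact_continuous_image) auto
  from compact_imp_bounded[OF this] obtain B where B: "\<And>y. y \<in> {-1..1} \<Longrightarrow> \<bar>h y\<bar> \<le> B"
    unfolding bounded_iff real_norm_def by (metis imageI)
  have int: "integrable (M n) (\<lambda>x. h (bias x))" for n
    using B bias_bounds by (intro balanced_integrable[OF bal] bmeasI[where B = B]) auto
  show ?thesis
    unfolding Cauchy_convergent_iff[symmetric]
  proof (rule metric_CauchyI)
    fix e :: real assume e: "0 < e"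
    have "continuous_on {0..1} (\<lambda>v. h (sqrt v))"
      using continuous_on_subset[OF h] by (intro continuous_on_compose2[OF h] continuous_intros) auto
    from Stone_Weierstrass_real_polynomial_function[OF compact_Icc this, of "e / 4"] e
    obtain g where g: "real_polynomial_function g" "\<And>v. v \<in> {0..1} \<Longrightarrow> \<bar>h (sqrt v) - g v\<bar> < e / 4"
      by auto
    from g(1) obtain a and N :: nat where ga: "g = (\<lambda>v. \<Sum>i\<le>N. a i * v ^ i)"
      by (auto simp: real_polynomial_function_iff_sum)
    define p where "p n = (\<Sum>i\<le>N. a i * (\<integral>x. (bias x)\<^sup>2 ^ i \<partial>M n))" for n
    have intp: "integrable (M n) (\<lambda>x. (bias x)\<^sup>2 ^ i)" for n i
      using b2 by (intro balanced_integrable[OF bal] bmeasI[where B = 1]) (auto simp: power_le_one simp del: power_mult)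
    have pg: "p n = (\<integral>x. g ((bias x)\<^sup>2) \<partial>M n)" and intg: "integrable (M n) (\<lambda>x. g ((bias x)\<^sup>2))" for n
      using intp by (simp_all add: p_def ga del: power_mult)
    have close: "\<bar>(\<integral>x. h (bias x) \<partial>M n) - p n\<bar> \<le> e / 4" for n
    proof -
      have "\<bar>(\<integral>x. h (bias x) \<partial>M n) - p n\<bar> = \<bar>\<integral>x. h (bias x) - g ((bias x)\<^sup>2) \<partial>M n\<bar>"
        using int intg by (simp add: pg)
      also have "\<dots> \<le> (\<integral>x. \<bar>h (bias x) - g ((bias x)\<^sup>2)\<bar> \<partial>M n)" by (rule integral_abs_bound)
      also have "\<dots> \<le> (\<integral>x. e / 4 \<partial>M n)"
        using int intg less_imp_le[OF g(2)[OF b2]] hb by (intro integral_mono) auto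
      finally show ?thesis by (simp add: prob_space)
    qed
    have "convergent p"
      unfolding p_def[abs_def] by (intro convergent_sum convergent_mult convergent_const moments_convergent bal conv)
    then have "Cauchy p" by (simp add: Cauchy_convergent_iff)
    then obtain N where N: "\<And>m n. m \<ge> N \<Longrightarrow> n \<ge> N \<Longrightarrow> dist (p m) (p n) < e / 4"
      using e by (metis metric_CauchyD zero_less_divide_iff zero_less_numeral)
    have "dist (\<integral>x. h (bias x) \<partial>M m) (\<integral>x. h (bias x) \<partial>M n) < e" if "m \<ge> N" "n \<ge> N" for m n
      using N[OF that] close[of m] close[of n] e unfolding dist_real_def by (auto simp: abs_if split: if_splits)
    then show "\<exists>N. \<forall>m\<ge>N. \<forall>n\<ge>N. dist (\<integral>x. h (bias x) \<partial>M m) (\<integral>x. h (bias x) \<partial>M n) < e" by blast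
  qed
qed

text \<open>The measure on \<open>(-\<infinity>, \<infinity>]\<close> obtained from a law \<open>L\<close> of \<open>bias\<close> by choosing the sign of the
  log-likelihood ratio anew.  This makes it unnecessary to know that \<open>L\<close> inherits the symmetry.\<close>

definition resign :: "real measure \<Rightarrow> ereal measure" where
  "resign L = distr (density (L \<Otimes>\<^sub>M measure_pmf (bernoulli_pmf (1/2)))
     (\<lambda>p. ennreal (if snd p then 1 + clamp1 (fst p) else 1 - clamp1 (fst p)))) borel
     (\<lambda>(y, b). if b then llr y else - llr y)"

lemma integral_resign:
  assumes "real_distribution L" and f: "bmeas borel f"
  shows "(\<integral>x. f x \<partial>resign L) = (\<integral>y. symz f (llr y) \<partial>L)"
proof -
  interpret L: real_distribution L by fact
  let ?B = "measure_pmf (bernoulli_pmf (1/2))"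
  have [measurable]: "(\<lambda>w. snd w) \<in> measurable (L \<Otimes>\<^sub>M ?B) (count_space UNIV)"
    by (rule measurable_compose[OF measurable_snd]) simp
  have [measurable]: "fst \<in> borel_measurable (L \<Otimes>\<^sub>M ?B)"
    using measurable_fst[of L ?B] by (simp cong: measurable_cong_sets)
  note [measurable] = bmeas_measurable[OF f]
  have sgn: "(\<lambda>(y, b). if b then llr y else - llr y) \<in> borel_measurable (L \<Otimes>\<^sub>M ?B)"
    unfolding case_prod_beta by measurable
  define w where "w p = (if snd p then 1 + clamp1 (fst p) else 1 - clamp1 (fst p))" for p :: "real \<times> bool"
  have w [measurable]: "w \<in> borel_measurable (L \<Otimes>\<^sub>M ?B)" unfolding w_def by measurable
  have w0: "0 \<le> w p" "w p \<le> 2" for p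
    using abs_clamp1[of "fst p"] by (auto simp: w_def abs_le_iff)
  have bm: "bmeas (L \<Otimes>\<^sub>M ?B) (\<lambda>p. w p * f ((\<lambda>(y, b). if b then llr y else - llr y) p))"
    using w0 by (intro bmeas_mult bmeas_compose[OF f sgn] bmeasI[OF w, of 2]) (simp add: abs_of_nonneg)
  have dens: "resign L = distr (density (L \<Otimes>\<^sub>M ?B) (\<lambda>p. ennreal (w p))) borel (\<lambda>(y, b). if b then llr y else - llr y)"
    by (simp add: resign_def w_def)
  have "(\<integral>x. f x \<partial>resign L) = (\<integral>p. w p * f ((\<lambda>(y, b). if b then llr y else - llr y) p) \<partial>(L \<Otimes>\<^sub>M ?B))"
    unfolding dens using sgn w0 measurable_compose[OF sgn bmeas_measurable[OF f]]
    by (subst integral_distr) (simp_all add: integral_density)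
  also have "\<dots> = (\<integral>y. \<integral>b. w (y, b) * f (if b then llr y else - llr y) \<partial>?B \<partial>L)"
    using integral_pair[OF L.prob_space_axioms measure_pmf.prob_space_axioms bm] by simp
  also have "\<dots> = (\<integral>y. symz f (llr y) \<partial>L)"
    by (simp add: w_def symz_def bias_llr mult.commute)
  finally show ?thesis .
qed

lemma llr_distribution_resign:
  assumes "real_distribution L"
  shows "llr_distribution (resign L)"
proof -
  interpret L: real_distribution L by fact
  let ?B = "measure_pmf (bernoulli_pmf (1/2))"
  have [measurable]: "(\<lambda>w. snd w) \<in> measurable (L \<Otimes>\<^sub>M ?B) (count_space UNIV)"
    by (rule measurable_compose[OF measurable_snd]) simp
  have [measurable]: "fst \<in> borel_measurable (L \<Otimes>\<^sub>M ?B)"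
    using measurable_fst[of L ?B] by (simp cong: measurable_cong_sets)
  have [measurable]: "(\<lambda>(y, b). if b then llr y else - llr y) \<in> borel_measurable (L \<Otimes>\<^sub>M ?B)"
    unfolding case_prod_beta by measurable
  have w [measurable]: "(\<lambda>p. ennreal (if snd p then 1 + clamp1 (fst p) else 1 - clamp1 (fst p))) \<in> borel_measurable (L \<Otimes>\<^sub>M ?B)"
    by measurable
  have sets: "sets (resign L) = sets borel" by (simp add: resign_def)
  have P: "prob_space (resign L)"
    unfolding resign_def
  proof (rule prob_space.prob_space_distr)
    show "prob_space (density (L \<Otimes>\<^sub>M ?B) (\<lambda>p. ennreal (if snd p then 1 + clamp1 (fst p) else 1 - clamp1 (fst p))))" (is "prob_space ?D")
    proof
      have "emeasure ?D (space ?D) = (\<integral>\<^sup>+y. \<integral>\<^sup>+b. ennreal (if b then 1 + clamp1 y else 1 - clamp1 y) \<partial>?B \<partial>L)"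
        using measure_pmf.nn_integral_fst[OF w] by (simp add: emeasure_density cong: nn_integral_cong)
      also have "\<dots> = (\<integral>\<^sup>+y. 1 \<partial>L)"
      proof (intro nn_integral_cong)
        fix y
        have "0 \<le> 1 + clamp1 y" "0 \<le> 1 - clamp1 y" using abs_clamp1[of y] by (auto simp: abs_le_iff)
        then have "(\<integral>\<^sup>+b. ennreal (if b then 1 + clamp1 y else 1 - clamp1 y) \<partial>?B) =
            ennreal (\<integral>b. (if b then 1 + clamp1 y else 1 - clamp1 y) \<partial>?B)"
          by (intro nn_integral_eq_integral integrable_measure_pmf_finite) auto
        also have "\<dots> = 1" by (simp add: field_simps)
        finally show "(\<integral>\<^sup>+b. ennreal (if b then 1 + clamp1 y else 1 - clamp1 y) \<partial>?B) = 1" .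
      qed
      finally show "emeasure ?D (space ?D) = 1" using L.emeasure_space_1 by simp
    qed
  qed (simp add: case_prod_beta)
  interpret P: prob_space "resign L" by fact
  \<comment> \<open>The negative sign of an infinite value is chosen with weight 0, so -\<infinity>
    is never reached.\<close>
  have z: "symz (indicator {-\<infinity>}) x = 0" for x
    by (cases x) (auto simp: symz_def indicator_def)
  have "measure (resign L) {-\<infinity>} = (\<integral>x. indicator {-\<infinity>} x \<partial>resign L)"
    using sets by simp
  also have "\<dots> = (\<integral>y. symz (indicator {-\<infinity>}) (llr y) \<partial>L)"
    by (intro integral_resign assms bmeasI[where B = 1]) (auto simp: indicator_def)
  finally have "measure (resign L) {-\<infinity>} = 0" by (simp add: z)
  then show ?thesis
    using P sets by (simp add: llr_distribution_def P.emeasure_eq_measure)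
qed

text \<open>The half-line is not compact at -\<infinity>, so compactness is used for the laws of the
  bias instead, which live on [-1, 1]. A subsequence yields a candidate limit; the integrals
  converge along the whole sequence, so the subsequence determines their limits.\<close>

lemma weak_limit_exists:
  fixes M :: "nat \<Rightarrow> ereal measure"
  assumes bal: "\<And>n. balanced (M n)"
    and conv: "\<And>t. \<bar>t\<bar> < 1 \<Longrightarrow> convergent (\<lambda>n. chi_mean (M n) t)"
  shows "\<exists>\<nu>. llr_distribution \<nu> \<and> weak_conv_llr M \<nu>"
proof -
  define N where "N n = distr (M n) borel bias" for n
  have meas: "bias \<in> borel_measurable (M n)" for n
    using balancedD(2)[OF bal] by (simp cong: measurable_cong_sets)
  have rd: "real_distribution (N n)" for n
    unfolding N_def
    by (intro real_distribution.intro prob_space.prob_space_distr balancedD(1)[OF bal] meas)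
      (simp add: real_distribution_axioms_def)
  have "tight N"
    unfolding tight_def
  proof (intro conjI allI impI rd)
    fix e :: real assume "0 < e"
    \<comment> \<open>Tightness is stated with half-open intervals, so the left end must lie
      strictly below -1.\<close>
    have "measure (N n) {-2<..1} = 1" for n
    proof -
      interpret real_distribution "N n" by (rule rd)
      interpret M: prob_space "M n" by (rule balancedD(1)[OF bal])
      have "bias -` {-2<..1} \<inter> space (M n) = space (M n)"
      proof -
        have "-2 < bias x" for x using bias_bounds(1)[of x] by linarith
        then show ?thesis using bias_bounds(2) by auto
      qed
      then show ?thesis using meas by (simp add: N_def measure_distr M.prob_space)
    qed
    then show "\<exists>a b. a < b \<and> (\<forall>n. 1 - e < measure (N n) {a<..b})"
      using \<open>0 < e\<close> by (intro exI[of _ "-2"] exI[of _ 1]) auto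
  qed
  from tight_imp_convergent_subsubsequence[OF this strict_mono_id]
  obtain r L where r: "strict_mono r" and L: "real_distribution L" and wc: "weak_conv_m (N \<circ> id \<circ> r) L"
    by (auto simp: id_def)
  have "weak_conv_llr M (resign L)"
    unfolding weak_conv_llr_def
  proof (intro allI impI, elim conjE)
    fix f :: "ereal \<Rightarrow> real"
    assume cont: "continuous_on {-\<infinity><..} f" and "bounded (f ` {-\<infinity><..})"
    then obtain B where B: "\<And>x. x > -\<infinity> \<Longrightarrow> \<bar>f x\<bar> \<le> B"
      unfolding bounded_iff real_norm_def by (metis greaterThan_iff imageI)
    define g where "g x = indicator {-\<infinity><..} x *\<^sub>R f x" for x
    have gB: "\<bar>g x\<bar> \<le> \<bar>B\<bar>" for x
      using B[of x] by (auto simp: g_def indicator_def)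
    have g_meas: "g \<in> borel_measurable borel"
      unfolding g_def using borel_measurable_continuous_on_indicator[OF _ cont] by simp
    have g: "bmeas borel g" using g_meas gB by (rule bmeasI)
    have "continuous_on {-\<infinity><..} g"
      using cont by (rule continuous_on_eq) (simp add: g_def)
    then have h: "continuous_on UNIV (\<lambda>y. symz g (llr y))"
      by (rule continuous_symz_llr[OF _ gB]) (simp add: g_def)
    have hB: "\<bar>symz g x\<bar> \<le> \<bar>B\<bar>" for x
    proof -
      have "\<bar>(1 + bias x) / 2 * g x\<bar> \<le> (1 + bias x) / 2 * \<bar>B\<bar>" "\<bar>(1 - bias x) / 2 * g (- x)\<bar> \<le> (1 - bias x) / 2 * \<bar>B\<bar>"
        using bias_bounds[of x] gB[of x] gB[of "- x"] by (simp_all add: abs_mult mult_left_mono)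
      moreover have "(1 + bias x) / 2 * \<bar>B\<bar> + (1 - bias x) / 2 * \<bar>B\<bar> = \<bar>B\<bar>" by (simp add: field_simps)
      ultimately show ?thesis unfolding symz_def by linarith
    qed
    have eq: "(\<integral>x. g x \<partial>M n) = (\<integral>x. symz g (llr (bias x)) \<partial>M n)" for n
      using balancedD(4)[OF bal g] by simp
    have "convergent (\<lambda>n. \<integral>x. g x \<partial>M n)"
      unfolding eq by (rule even_integrals_convergent[OF bal conv h]) (auto simp: llr_minus symz_even)
    then obtain l where l: "(\<lambda>n. \<integral>x. g x \<partial>M n) \<longlonglongrightarrow> l" by (auto simp: convergent_def)
    have "(\<lambda>n. \<integral>y. symz g (llr y) \<partial>(N \<circ> id \<circ> r) n) \<longlonglongrightarrow> (\<integral>y. symz g (llr y) \<partial>L)"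
      by (rule weak_conv_imp_integral_bdd_continuous_conv[OF _ L wc, where B = "\<bar>B\<bar>"])
        (use h hB rd in \<open>auto simp: continuous_on_eq_continuous_at\<close>)
    moreover have "(\<integral>y. symz g (llr y) \<partial>N n) = (\<integral>x. g x \<partial>M n)" for n
      unfolding N_def eq using meas borel_measurable_continuous_onI[OF h] by (subst integral_distr) auto
    ultimately have "(\<lambda>n. \<integral>x. g x \<partial>M (r n)) \<longlonglongrightarrow> (\<integral>x. g x \<partial>resign L)"
      by (simp add: integral_resign[OF L g])
    moreover have "(\<lambda>n. \<integral>x. g x \<partial>M (r n)) \<longlonglongrightarrow> l"
      using LIMSEQ_subseq_LIMSEQ[OF l r] by (simp add: o_def)
    ultimately have "l = (\<integral>x. g x \<partial>resign L)" by (rule LIMSEQ_unique[rotated])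
    then show "(\<lambda>n. LINT x:{-\<infinity><..}|M n. f x) \<longlonglongrightarrow> (LINT x:{-\<infinity><..}|resign L. f x)"
      using l by (simp add: set_lebesgue_integral_def g_def)
  qed
  then show ?thesis using llr_distribution_resign[OF L] by blast
qed

section \<open>Boundary irrelevance\<close>

text \<open>Non-triviality of the survey enters here: it makes the gain in each step
  positive.\<close>

lemma mean_square_bias_pos:
  assumes bal: "balanced \<mu>" and ne: "\<mu> \<noteq> return borel 0"
  shows "0 < (\<integral>y. (bias y)\<^sup>2 \<partial>\<mu>)"
proof (rule ccontr)
  interpret prob_space \<mu> by (rule balancedD(1)[OF bal])
  note sets = balancedD(2)[OF bal]
  assume "\<not> ?thesis"
  then have 0: "(\<integral>y. (bias y)\<^sup>2 \<partial>\<mu>) = 0"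
    by (intro antisym) (simp_all add: not_less)
  have "bmeas borel (\<lambda>y. (bias y)\<^sup>2)" unfolding power2_eq_square by (intro bmeas_intros) auto
  then have "integrable \<mu> (\<lambda>y. (bias y)\<^sup>2)" by (rule balanced_integrable[OF bal])
  then have "AE y in \<mu>. (bias y)\<^sup>2 = 0"
    using 0 by (subst (asm) integral_nonneg_eq_0_iff_AE) auto
  then have AE: "AE y in \<mu>. y = 0"
  proof eventually_elim
    case (elim y)
    then have "llr (bias y) = llr 0" by simp
    then show ?case using llr_bias[of y] llr_bias[of 0] by simp
  qed
  have "\<mu> = return borel 0"
  proof (rule measure_eqI)
    fix A assume A: "A \<in> sets \<mu>"
    have "emeasure \<mu> A = (\<integral>\<^sup>+y. indicator A y \<partial>\<mu>)" using A by simp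
    also have "\<dots> = (\<integral>\<^sup>+y. indicator A 0 \<partial>\<mu>)"
      using AE by (intro nn_integral_cong_AE) (auto elim: eventually_mono)
    also have "\<dots> = indicator A 0" by (simp add: emeasure_space_1)
    finally show "emeasure \<mu> A = emeasure (return borel 0) A" using A sets by simp
  qed (simp add: sets)
  then show False using ne by simp
qed

text \<open>The recursion of \<open>chi_mean_degrade_improve\<close> in the variable s^2, started
  from s = 0.\<close>

primrec overlap :: "real \<Rightarrow> nat \<Rightarrow> real" where
  "overlap b 0 = 0"
| "overlap b (Suc h) = overlap b h + b / 8 * (1 - overlap b h) ^ 5"

lemma overlap_bounds:
  assumes "0 < b" "b \<le> 1"
  shows "0 \<le> overlap b h \<and> overlap b h < 1"
proof (induction h)
  case (Suc h)
  define e where "e = 1 - overlap b h"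
  have e: "0 < e" "e \<le> 1" using Suc by (auto simp: e_def)
  then have "e ^ 5 \<le> e ^ 1" by (intro power_decreasing) auto
  then have "b * e ^ 5 \<le> 1 * e" using assms e by (intro mult_mono) auto
  moreover have "0 \<le> b * e ^ 5" using assms e by auto
  ultimately show ?case using Suc e by (simp add: e_def)
qed simp

text \<open>The sequence is increasing and bounded, and its limit must be a fixed point; as b > 0,
  the only one is 1.\<close>

lemma overlap_tendsto_1:
  assumes "0 < b" "b \<le> 1"
  shows "overlap b \<longlonglongrightarrow> 1"
proof -
  note bounds = overlap_bounds[OF assms]
  have "incseq (overlap b)"
    using bounds assms by (intro incseq_SucI) (auto intro!: mult_nonneg_nonneg simp: less_imp_le)
  then obtain l where l: "overlap b \<longlonglongrightarrow> l"
    using bounds by (elim incseq_convergent[where B = 1]) (auto simp: less_imp_le)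
  have "(\<lambda>h. overlap b (Suc h)) \<longlonglongrightarrow> l + b / 8 * (1 - l) ^ 5"
    unfolding overlap.simps by (intro tendsto_intros l)
  with LIMSEQ_Suc[OF l] have "l = l + b / 8 * (1 - l) ^ 5" by (rule LIMSEQ_unique)
  then have "l = 1" using assms by simp
  then show ?thesis using l by simp
qed

theorem theorem36:
  fixes P\<^sub>d :: "nat pmf" and \<delta> :: real and \<mu>\<^sub>s :: "ereal measure"
  assumes "\<delta> \<in> {0..1}"
    and "symmetric_distribution \<mu>\<^sub>s"
    and "\<mu>\<^sub>s \<noteq> return borel 0"
  shows "\<exists>\<nu>. llr_distribution \<nu> \<and>
           weak_conv_llr (\<lambda>h. (BP_operator P\<^sub>d \<delta> \<mu>\<^sub>s ^^ h) (return borel \<infinity>)) \<nu> \<and>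
           weak_conv_llr (\<lambda>h. (BP_operator P\<^sub>d \<delta> \<mu>\<^sub>s ^^ h) (return borel 0)) \<nu>"
proof -
  have \<delta>: "0 \<le> \<delta>" "\<delta> \<le> 1" using assms(1) by auto
  have S: "balanced \<mu>\<^sub>s" by (rule balanced_of_symmetric[OF assms(2)])
  interpret S: prob_space \<mu>\<^sub>s by (rule balancedD(1)[OF S])
  define Q where "Q = BP_operator P\<^sub>d \<delta> \<mu>\<^sub>s"
  define U where "U h = (Q ^^ h) (return borel \<infinity>)" for h
  define V where "V h = (Q ^^ h) (return borel 0)" for h
  define b where "b = (\<integral>y. (bias y)\<^sup>2 \<partial>\<mu>\<^sub>s)"
  have b: "0 < b" "b \<le> 1"
  proof -
    show "0 < b" unfolding b_def by (rule mean_square_bias_pos[OF S assms(3)])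
    have "bmeas borel (\<lambda>y. (bias y)\<^sup>2)" unfolding power2_eq_square by (intro bmeas_intros) auto
    then have "b \<le> (\<integral>y. 1 \<partial>\<mu>\<^sub>s)"
      unfolding b_def by (intro integral_mono balanced_integrable[OF S] bmeas_const) (auto simp: abs_square_le_1 abs_bias_le_1)
    then show "b \<le> 1" by (simp add: S.prob_space)
  qed
  have balQ: "balanced \<mu> \<Longrightarrow> balanced (Q \<mu>)" for \<mu>
    unfolding Q_def by (rule balanced_BP_operator[OF \<delta> S])
  have balU: "balanced (U h)" and balV: "balanced (V h)" for h
    by (induction h) (auto simp: U_def V_def balanced_return balQ)
  have mono: "chi_mean (Q \<beta>) t \<le> chi_mean (Q \<alpha>) t"
    if "balanced \<alpha>" "balanced \<beta>" "\<And>t. \<bar>t\<bar> < 1 \<Longrightarrow> chi_mean \<beta> t \<le> chi_mean \<alpha> t" "\<bar>t\<bar> < 1" for \<alpha> \<beta> t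
    unfolding Q_def by (intro chi_mean_BP_mono \<delta> S that)
  have zero: "chi_mean (return borel 0) t = 0" for t
    by (simp add: chi_mean_def integral_return)
  have top: "chi_mean (return borel \<infinity>) t = 1 / (1 - t\<^sup>2)" for t
    by (simp add: chi_mean_def integral_return chi_def)
  have V_inc: "chi_mean (V h) t \<le> chi_mean (V (Suc h)) t" if "\<bar>t\<bar> < 1" for h t
    using that
  proof (induction h arbitrary: t)
    case 0
    then show ?case by (simp add: V_def zero chi_mean_nonneg)
  next
    case (Suc h)
    then show ?case using mono[OF balV balV, of h "Suc h" t] by (simp add: V_def)
  qed
  have U_dec: "chi_mean (U (Suc h)) t \<le> chi_mean (U h) t" if "\<bar>t\<bar> < 1" for h t
    using that
  proof (induction h arbitrary: t)
    case 0
    then show ?case using chi_mean_le[OF balU, of t 1] by (simp add: U_def top)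
  next
    case (Suc h)
    then show ?case using mono[OF balU balU, of "Suc h" h t] by (simp add: U_def)
  qed
  have VU: "chi_mean (V h) t \<le> chi_mean (U h) t" if "\<bar>t\<bar> < 1" for h t
    using that
  proof (induction h arbitrary: t)
    case 0
    then show ?case by (simp add: V_def U_def zero chi_mean_nonneg)
  next
    case (Suc h)
    then show ?case using mono[OF balU balV, of h h t] by (simp add: V_def U_def)
  qed
  define s where "s h = sqrt (overlap b h)" for h
  have s: "0 \<le> s h" "s h < 1" "(s h)\<^sup>2 = overlap b h" for h
    using overlap_bounds[OF b, of h] by (auto simp: s_def)
  have degrade: "chi_mean (degrade (s h) (U h)) t \<le> chi_mean (V h) t" if "\<bar>t\<bar> < 1" for h t
    using that
  \<comment> \<open>The start is trivial: scale 0 destroys all information. In the step t must be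
    arbitrary because the tests are tilted.\<close>
  proof (induction h arbitrary: t)
    case 0
    then show ?case
      using chi_mean_nonneg[of t "V 0"] by (simp add: chi_mean_degrade(1) balU s_def)
  next
    case (Suc h)
    have "(s (Suc h))\<^sup>2 = (s h)\<^sup>2 + (\<integral>y. (bias y)\<^sup>2 \<partial>\<mu>\<^sub>s) / 8 * (1 - (s h)\<^sup>2) ^ 5"
      by (simp add: s b_def)
    from chi_mean_BP_degrade[OF \<delta> balV balU S s(1,2) s(1) this Suc.IH Suc.prems]
    show ?case by (simp add: U_def V_def Q_def)
  qed
  have diff: "(\<lambda>h. chi_mean (U h) t - chi_mean (V h) t) \<longlonglongrightarrow> 0" if t: "\<bar>t\<bar> < 1" for t
  proof (rule tendsto_sandwich[OF _ _ tendsto_const])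
    show "\<forall>\<^sub>F h in sequentially. 0 \<le> chi_mean (U h) t - chi_mean (V h) t"
      using VU[OF t] by simp
    \<comment> \<open>\<open>V h\<close> lies above \<open>U h\<close> degraded by
      \<open>s h\<close>. Hence the gap is at most the loss of \<open>U h\<close> between the scales
      1 and \<open>s h\<close>, which vanishes with 1 - s^2.\<close>
    have "chi_mean (U h) t - chi_mean (V h) t \<le> (1 - overlap b h) / (1 - \<bar>t\<bar>\<^sup>2)\<^sup>2" for h
      using chi_mean_degrade_diff_le[OF s(1) less_imp_le[OF s(2)] order_refl balU order_refl t, of h h]
        degrade[OF t, of h] by (simp add: chi_mean_degrade_1 balU t s)
    then show "\<forall>\<^sub>F h in sequentially. chi_mean (U h) t - chi_mean (V h) t \<le> (1 - overlap b h) / (1 - \<bar>t\<bar>\<^sup>2)\<^sup>2"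
      by simp
    have "(\<lambda>h. (1 - overlap b h) / (1 - \<bar>t\<bar>\<^sup>2)\<^sup>2) \<longlonglongrightarrow> (1 - 1) / (1 - \<bar>t\<bar>\<^sup>2)\<^sup>2"
      using t by (intro tendsto_intros overlap_tendsto_1 b) (auto simp: abs_square_eq_1)
    then show "(\<lambda>h. (1 - overlap b h) / (1 - \<bar>t\<bar>\<^sup>2)\<^sup>2) \<longlonglongrightarrow> 0" by simp
  qed
  \<comment> \<open>Interleaving the two sequences gives a single sequence with convergent means.
    Its weak limit is inherited by the even and the odd subsequence, so the limits agree without a
    separate uniqueness argument.\<close>
  define M where "M n = (if even n then U (n div 2) else V (n div 2))" for n
  have balM: "balanced (M n)" for n by (simp add: M_def balU balV)
  have convM: "convergent (\<lambda>n. chi_mean (M n) t)" if t: "\<bar>t\<bar> < 1" for t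
  proof -
    have "incseq (\<lambda>h. chi_mean (V h) t)" by (intro incseq_SucI V_inc t)
    then obtain l where l: "(\<lambda>h. chi_mean (V h) t) \<longlonglongrightarrow> l"
      using chi_mean_le[OF balV t] by (elim incseq_convergent[where B = "1 / (1 - t\<^sup>2)"]) auto
    have "(\<lambda>h. chi_mean (U h) t) \<longlonglongrightarrow> l"
      using tendsto_add[OF diff[OF t] l] by simp
    with l have "(\<lambda>n. chi_mean (M (2 * n)) t) \<longlonglongrightarrow> l" "(\<lambda>n. chi_mean (M (2 * n + 1)) t) \<longlonglongrightarrow> l"
      by (simp_all add: M_def)
    then have "(\<lambda>n. chi_mean (M n) t) \<longlonglongrightarrow> l" by (rule limseq_even_odd)
    then show ?thesis by (rule convergentI)
  qed
  from weak_limit_exists[OF balM convM] obtain \<nu>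
    where \<nu>: "llr_distribution \<nu>" "weak_conv_llr M \<nu>" by blast
  have sub: "weak_conv_llr (\<lambda>h. M (r h)) \<nu>" if "strict_mono r" for r
    unfolding weak_conv_llr_def
  proof (intro allI impI)
    fix f :: "ereal \<Rightarrow> real"
    assume "continuous_on {-\<infinity><..} f \<and> bounded (f ` {-\<infinity><..})"
    then have "(\<lambda>n. LINT x:{-\<infinity><..}|M n. f x) \<longlonglongrightarrow> (LINT x:{-\<infinity><..}|\<nu>. f x)"
      using \<nu>(2) unfolding weak_conv_llr_def by blast
    from LIMSEQ_subseq_LIMSEQ[OF this that]
    show "(\<lambda>n. LINT x:{-\<infinity><..}|M (r n). f x) \<longlonglongrightarrow> (LINT x:{-\<infinity><..}|\<nu>. f x)"
      by (simp add: o_def)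
  qed
  have "weak_conv_llr U \<nu>"
    using sub[of "\<lambda>h. 2 * h"] by (simp add: M_def strict_mono_def)
  moreover have "weak_conv_llr V \<nu>"
    using sub[of "\<lambda>h. 2 * h + 1"] by (simp add: M_def strict_mono_def)
  ultimately show ?thesis using \<nu>(1) unfolding U_def V_def Q_def by blast
qed

end
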